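(* Let $K\subset\mathbb{C}$ be non-polar, compact and polynomially convex, and let $(q_k)_{k\in\mathbb{N}}$ be a sequence of complex polynomials with degrees $n_k=\deg q_k\to\infty$. If $(q_k)_{k\in\mathbb{N}}$ is $K$-regular and centers on $K$, then for every $r>0$ $$\omega_{q_k^{-1}(\overline{\mathbb{D}(r)})}\to\omega_K\quad\text{weak* as } k\to\infty.$$
   Context: $\mathbb{D}(R)=\{z\in\mathbb{C}:|z|<R\}$. Polynomially convex (full) for a compact $K\subset\mathbb{C}$ means that $\Omega:=\mathbb{C}\setminus K$ is connected. For a non-polar compact set $C\subset\mathbb{C}$, $\omega_C$ is the equilibrium measure of $C$, i.e. the unique Borel probability measure on $C$ maximizing the energy $I(\mu)=\iint\log|z-w|\,d\mu(w)\,d\mu(z)$. The Green's function of $\Omega$ with pole at $\infty$ is $g_\Omega(z)=\int\log|z-w|\,d\omega_K(w)-I(\omega_K)$. Weak* convergence $\mu_k\to\mu$ of probability measures means $\int f\,d\mu_k\to\int f\,d\mu$ for every compactly supported continuous $f$ on $\mathbb{C}$. All sequences of polynomials considered have degrees tending to infinity, so finitely many terms of degree too small for the expressions to make sense are disregarded. Centering: a sequence $(q_k)_k$ of polynomials centers on a non-empty compact set $C\subset\mathbb{C}$ if there exist $N\in\mathbb{N}$ and $R>0$ such that (1) $q_k^{-1}(\{0\})\subset\mathbb{D}(R)$ for all $k\ge N$; and (2) for every closed set $L\subset\mathbb{C}$ with $L\cap C=\emptyset$ there exists $M=M(L)>0$ such that for all $k\ge N$ the number of zeros of $q_k$ in $L$,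 counted with multiplicity, is at most $M$. $K$-regularity: a sequence $(q_k)_k$ of polynomials of degrees $n_k$ is $K$-regular if for some $R>0$ (taken large enough that $K\subset\mathbb{D}(R)$) one has $\lim_{k\to\infty}\frac{1}{n_k}\log|q_k(z)|=g_\Omega(z)$ uniformly on $\mathbb{C}\setminus\mathbb{D}(R)$. *)

theory Defs
  imports
    "HOL-Analysis.Analysis"
    "HOL-Probability.Probability_Measure"
    "HOL-Computational_Algebra.Fundamental_Theorem_Algebra"
begin

text \<open>The logarithm with value \<open>-\<infinity>\<close> at 0. In the library \<open>ln 0 = 0\<close>, and the Bochner
  integral of a non-integrable function is 0; either would give measures with atoms a finite
  logarithmic energy.\<close>

definition ereal_ln :: "real \<Rightarrow> ereal" where
  "ereal_ln x = (if x = 0 then -\<infinity> else ereal (ln x))"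

text \<open>Integral of the positive part minus integral of the negative part. It is used below only
  for functions bounded above almost everywhere on a probability space, so that the first integral
  is finite and \<open>\<infinity> - \<infinity>\<close> does not occur.\<close>

definition ereal_integral :: "'a measure \<Rightarrow> ('a \<Rightarrow> ereal) \<Rightarrow> ereal" where
  "ereal_integral M f =
     enn2ereal (\<integral>\<^sup>+ x. e2ennreal (f x) \<partial>M) - enn2ereal (\<integral>\<^sup>+ x. e2ennreal (- f x) \<partial>M)"

definition log_potential :: "complex measure \<Rightarrow> complex \<Rightarrow> ereal" where
  "log_potential \<mu> z = ereal_integral \<mu> (\<lambda>w. ereal_ln (dist z w))"

definition log_energy :: "complex measure \<Rightarrow> ereal" where
  "log_energy \<mu> = ereal_integral \<mu> (log_potential \<mu>)"

text \<open>Borel probability measures on a Borel set \<open>C\<close>, as measures on the whole plane that are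
  concentrated on \<open>C\<close>.\<close>

definition borel_probs_on :: "complex set \<Rightarrow> complex measure set" where
  "borel_probs_on C = {\<mu>. sets \<mu> = sets borel \<and> prob_space \<mu> \<and> emeasure \<mu> C = 1}"

definition polar :: "complex set \<Rightarrow> bool" where
  "polar E \<longleftrightarrow> (\<forall>C \<mu>. compact C \<and> C \<subseteq> E \<and> \<mu> \<in> borel_probs_on C \<longrightarrow> log_energy \<mu> = -\<infinity>)"

text \<open>Energies carry the sign convention \<open>I(\<mu>) = \<integral>\<integral> log |z - w|\<close>, so equilibrium measures
  are maximizers. For non-polar compact \<open>C\<close> there is exactly one.\<close>

definition equilibrium_measure :: "complex set \<Rightarrow> complex measure" where
  "equilibrium_measure C =
     (THE \<mu>. \<mu> \<in> borel_probs_on C \<and> (\<forall>\<nu> \<in> borel_probs_on C. log_energy \<nu> \<le> log_energy \<mu>))"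

definition polynomially_convex :: "complex set \<Rightarrow> bool" where
  "polynomially_convex K \<longleftrightarrow> connected (- K)"

text \<open>The Green's function of \<open>- K\<close> with pole at \<open>\<infinity>\<close>. For non-polar compact \<open>K\<close> the energy is
  finite, and the potential is finite at every point of \<open>- K\<close>.\<close>

definition green_function :: "complex set \<Rightarrow> complex \<Rightarrow> real" where
  "green_function K z =
     real_of_ereal (log_potential (equilibrium_measure K) z - log_energy (equilibrium_measure K))"

definition centers_on :: "(nat \<Rightarrow> complex poly) \<Rightarrow> complex set \<Rightarrow> bool" where
  "centers_on q C \<longleftrightarrow> compact C \<and> C \<noteq> {} \<and>
     (\<exists>N. \<exists>R>0.
        (\<forall>k\<ge>N. {z. poly (q k) z = 0} \<subseteq> ball 0 R) \<and>
        (\<forall>L. closed L \<and> L \<inter> C = {} \<longrightarrow>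
           (\<exists>M>0. \<forall>k\<ge>N. size {# z \<in># proots (q k). z \<in> L #} \<le> M)))"

text \<open>The convention \<open>ln 0 = 0\<close> is harmless here: if a non-constant \<open>q k\<close> has a zero of modulus
  at least \<open>R\<close>, then \<open>ln (cmod (poly (q k) z))\<close> is unbounded below near that zero on
  \<open>- ball 0 R\<close>, whereas the Green's function is locally bounded there.\<close>

definition K_regular :: "complex set \<Rightarrow> (nat \<Rightarrow> complex poly) \<Rightarrow> bool" where
  "K_regular K q \<longleftrightarrow>
     (\<exists>R>0. K \<subseteq> ball 0 R \<and>
        uniform_limit (- ball 0 R)
          (\<lambda>k z. ln (cmod (poly (q k) z)) / real (degree (q k)))
          (green_function K) sequentially)"

definition weak_star_converges :: "(nat \<Rightarrow> complex measure) \<Rightarrow> complex measure \<Rightarrow> bool" where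
  "weak_star_converges \<mu> \<nu> \<longleftrightarrow>
     (\<forall>f :: complex \<Rightarrow> real.
        continuous_on UNIV f \<and> compact (closure {z. f z \<noteq> 0}) \<longrightarrow>
        (\<lambda>k. \<integral>z. f z \<partial>\<mu> k) \<longlonglongrightarrow> (\<integral>z. f z \<partial>\<nu>))"

end

theory Submission
  imports
    Defs
    "HOL-Probability.Probability"
    "HOL-Complex_Analysis.Complex_Analysis"
    "HOL-Real_Asymp.Real_Asymp"
begin

text \<open>
  Let \<open>a\<^sub>k\<close> be the leading coefficient and \<open>n\<^sub>k\<close> the degree of \<open>q\<^sub>k\<close>, let \<open>c\<close> be the energy of
  \<open>\<omega>\<^sub>K\<close>, and let \<open>\<Omega>\<^sub>k\<close> be the equilibrium measure of the preimage of the disc. Regularity near infinity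
  gives \<open>ln |a\<^sub>k| / n\<^sub>k \<longlonglongrightarrow> - c\<close>, and the energy of \<open>\<Omega>\<^sub>k\<close> is at least \<open>(ln r - ln |a\<^sub>k|) / n\<^sub>k\<close>,
  which tends to \<open>c\<close>. Since the energy is upper semicontinuous, every weak limit \<open>\<nu>\<close> of the \<open>\<Omega>\<^sub>k\<close> has
  energy at least \<open>c\<close>; by uniqueness of the maximizer \<open>\<nu> = \<omega>\<^sub>K\<close> once \<open>\<nu>\<close> is known to live on \<open>K\<close>.
  For the latter, the zero counting measures converge to a measure on \<open>K\<close> whose potential agrees
  with that of \<open>\<omega>\<^sub>K\<close> near infinity, hence off \<open>K\<close>, where it exceeds \<open>c\<close>. So near a point off \<open>K\<close>
  the polynomial \<open>q\<^sub>k\<close> is exponentially large apart from boundedly many linear factors: the preimage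
  is covered there by boundedly many exponentially small discs, and these carry little
  mass because the energies of the \<open>\<Omega>\<^sub>k\<close> are bounded below.
\<close>

subsection \<open>Weak compactness of probability measures on a compact subset of the plane\<close>

text \<open>The inequality \<open>c \<le> potential \<omega> z\<close> off \<open>K\<close> is the
  outer half of Frostman's theorem. It comes from finite subsets of \<open>K\<close> in which every
  point has a large product of distances to the others: Lagrange interpolation of the constant 1
  turns this into a lower bound for the product of distances from \<open>z\<close>. On the
  preimages, greedily chosen points give the energy bound in terms of the leading coefficient. Such
  discrete measures have energy -infinity, so energies are compared through continuous kernels that
  decrease to the logarithm; this yields semicontinuity in the needed direction. A second obstacle
  is that boundedly many zeros may stay off \<open>K\<close> and spoil uniform convergence of the
  potentials of the zero measures there. With a truncated kernel these zeros count only through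
  their mass, which vanishes in the limit. Connectedness of \<open>- K\<close> enters twice: in
  continuing the equality of potentials from infinity, and in making the minimum strict.\<close>

text \<open>Unbounded test functions are harmless, since all measures in question live on a fixed
  compact set.\<close>

definition bounded_weak_conv :: "(nat \<Rightarrow> complex measure) \<Rightarrow> complex measure \<Rightarrow> bool" where
  "bounded_weak_conv \<mu> \<nu> \<longleftrightarrow>
     (\<forall>f :: complex \<Rightarrow> real. continuous_on UNIV f \<longrightarrow> (\<lambda>k. \<integral>z. f z \<partial>\<mu> k) \<longlonglongrightarrow> (\<integral>z. f z \<partial>\<nu>))"

lemma borel_probs_onD:
  assumes "\<mu> \<in> borel_probs_on C" "closed C"
  shows "sets \<mu> = sets borel" "space \<mu> = UNIV" "prob_space \<mu>" "AE z in \<mu>. z \<in> C"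
proof -
  show s: "sets \<mu> = sets borel" and p: "prob_space \<mu>" using assms by (auto simp: borel_probs_on_def)
  show "space \<mu> = UNIV" using sets_eq_imp_space_eq[OF s] by simp
  interpret prob_space \<mu> by (rule p)
  have "C \<in> sets \<mu>" using assms s by auto
  moreover have "prob C = 1" using assms(1) by (simp add: borel_probs_on_def measure_def)
  ultimately show "AE z in \<mu>. z \<in> C" using prob_eq_1 by blast
qed

lemma borel_probs_onI:
  assumes "sets \<mu> = sets borel" "prob_space \<mu>" "AE z in \<mu>. z \<in> C" "closed C"
  shows "\<mu> \<in> borel_probs_on C"
proof -
  interpret prob_space \<mu> by fact
  have "C \<in> sets \<mu>" using assms by auto
  then have "prob C = 1" using assms prob_eq_1 by blast
  then show ?thesis using assms by (simp add: borel_probs_on_def emeasure_eq_measure)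
qed

lemma borel_probs_on_integrable:
  fixes f :: "complex \<Rightarrow> real"
  assumes "\<mu> \<in> borel_probs_on C" "compact C" "continuous_on UNIV f"
  shows "integrable \<mu> f"
proof -
  note d = borel_probs_onD[OF assms(1) compact_imp_closed[OF assms(2)]]
  interpret prob_space \<mu> by (rule d)
  have "compact (f ` C)" by (intro compact_continuous_image assms continuous_on_subset[OF assms(3)]) auto
  then obtain B where B: "\<And>z. z \<in> C \<Longrightarrow> norm (f z) \<le> B"
    using compact_imp_bounded[of "f ` C"] unfolding bounded_iff by auto
  have "f \<in> borel_measurable \<mu>"
    using borel_measurable_continuous_onI[OF assms(3)] by (simp add: measurable_cong_sets[OF d(1) refl])
  moreover have "AE z in \<mu>. norm (f z) \<le> B" using d(4) by eventually_elim (rule B)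
  ultimately show ?thesis by (intro integrable_const_bound) auto
qed

text \<open>A tent function around each point off \<open>K\<close> produces a null ball. By the
  Lindelof property countably many of these balls cover the complement of \<open>K\<close>, which is
  therefore null.\<close>

lemma weak_limit_support:
  assumes D: "compact D" and \<nu>: "\<nu> \<in> borel_probs_on D" and conv: "bounded_weak_conv \<theta> \<nu>"
    and K: "closed K"
    and null: "\<And>z. z \<notin> K \<Longrightarrow> \<exists>\<rho>>0. (\<lambda>j. \<integral>w. max 0 (\<rho> - dist z w) \<partial>\<theta> j) \<longlonglongrightarrow> 0"
  shows "\<nu> \<in> borel_probs_on K"
proof -
  note d = borel_probs_onD[OF \<nu> compact_imp_closed[OF D]]
  have "\<exists>\<rho>>0. AE w in \<nu>. w \<notin> ball z \<rho>" if z: "z \<notin> K" for z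
  proof -
    obtain \<rho> where \<rho>: "\<rho> > 0" "(\<lambda>j. \<integral>w. max 0 (\<rho> - dist z w) \<partial>\<theta> j) \<longlonglongrightarrow> 0" using null[OF z] by blast
    have c: "continuous_on UNIV (\<lambda>w. max 0 (\<rho> - dist z w))" by (intro continuous_intros)
    have "(\<lambda>j. \<integral>w. max 0 (\<rho> - dist z w) \<partial>\<theta> j) \<longlonglongrightarrow> (\<integral>w. max 0 (\<rho> - dist z w) \<partial>\<nu>)"
      using conv c unfolding bounded_weak_conv_def by blast
    then have "(\<integral>w. max 0 (\<rho> - dist z w) \<partial>\<nu>) = 0" using \<rho>(2) by (rule LIMSEQ_unique)
    moreover have "integrable \<nu> (\<lambda>w. max 0 (\<rho> - dist z w))" by (rule borel_probs_on_integrable[OF \<nu> D c])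
    ultimately have "AE w in \<nu>. max 0 (\<rho> - dist z w) = 0" by (subst (asm) integral_nonneg_eq_0_iff_AE) auto
    then have "AE w in \<nu>. w \<notin> ball z \<rho>" by eventually_elim (auto simp: max_def split: if_splits)
    then show ?thesis using \<rho>(1) by blast
  qed
  then obtain \<rho> where \<rho>: "\<And>z. z \<notin> K \<Longrightarrow> \<rho> z > 0 \<and> (AE w in \<nu>. w \<notin> ball z (\<rho> z))" by metis
  define F where "F = (\<lambda>z. ball z (\<rho> z)) ` (- K)"
  obtain F' where F': "F' \<subseteq> F" "countable F'" "\<Union>F' = \<Union>F"
    using Lindelof[of F] unfolding F_def by auto
  have "AE w in \<nu>. \<forall>B\<in>F'. w \<notin> B"
    using F' \<rho> by (subst AE_ball_countable) (auto simp: F_def)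
  then have "AE w in \<nu>. w \<in> K"
  proof eventually_elim
    case (elim w)
    show ?case
    proof (rule ccontr)
      assume "w \<notin> K"
      then have "w \<in> \<Union>F" using \<rho>[of w] by (force simp: F_def)
      then show False using F' elim by blast
    qed
  qed
  then show ?thesis using d K by (intro borel_probs_onI) auto
qed

lemma compact_subset_cball:
  fixes C :: "complex set"
  assumes "compact C"
  obtains R where "R > 0" "C \<subseteq> cball 0 R"
  using compact_imp_bounded[OF assms] bounded_subset_ballD[of C 0] ball_subset_cball by blast

lemma distance_to_closed:
  fixes z :: complex
  assumes "closed C" "z \<notin> C"
  obtains d where "d > 0" "\<And>w. w \<in> C \<Longrightarrow> d \<le> cmod (z - w)"
  using separate_point_closed[OF assms] by (auto simp: dist_norm)

text \<open>Schoenberg's space-filling curve: on a point \<open>t\<close> of the Cantor set, \<open>ramp (3 ^ k * t)\<close> is the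
  \<open>k\<close>-th binary digit encoded by \<open>t\<close>. Interleaving the digits of the two coordinates gives a Borel
  right inverse, and this reduces weak compactness in the plane to Helly's theorem on the line.\<close>

definition ramp :: "real \<Rightarrow> real" where
  "ramp t = max 0 (min 1 (1/2 - cos (pi * t)))"

definition cantor :: "(nat \<Rightarrow> int) \<Rightarrow> real" where
  "cantor b = (\<Sum>k. 2 * of_int (b k) / 3 ^ Suc k)"

definition schoenberg :: "nat \<Rightarrow> real \<Rightarrow> real" where
  "schoenberg c t = (\<Sum>k. ramp (3 ^ (2 * k + c) * t) / 2 ^ Suc k)"

definition bit_of :: "real \<Rightarrow> nat \<Rightarrow> int" where
  "bit_of x k = \<lfloor>2 ^ Suc k * x\<rfloor> mod 2"

lemma ramp_bounds: "0 \<le> ramp t" "ramp t \<le> 1"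
  by (auto simp: ramp_def)

lemma ramp_add_even: "ramp (2 * of_int m + t) = ramp t"
proof -
  have "cos (pi * (2 * of_int m + t)) = cos (2 * pi * of_int m + pi * t)"
    by (simp add: algebra_simps)
  also have "\<dots> = cos (pi * t)"
    using cos_int_2pin[of m] sin_int_2pin[of m] by (simp add: cos_add)
  finally show ?thesis by (simp add: ramp_def)
qed

text \<open>The constants in \<open>ramp\<close> make \<open>1/2 - cos (pi * t)\<close> pass 0 at
  1/3 and 1 at 2/3, the ends of the middle third that the Cantor set omits.\<close>

lemma ramp_low: assumes "0 \<le> t" "t \<le> 1/3" shows "ramp t = 0"
proof -
  have "cos (pi/3) \<le> cos (pi * t)"
    by (rule cos_monotone_0_pi_le) (use assms in \<open>auto simp: field_simps\<close>)
  then show ?thesis by (simp add: ramp_def cos_60)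
qed

lemma ramp_high: assumes "2/3 \<le> t" "t \<le> 1" shows "ramp t = 1"
proof -
  have "cos (pi * t) \<le> cos (2 * pi/3)"
    by (rule cos_monotone_0_pi_le) (use assms in \<open>auto simp: field_simps\<close>)
  also have "cos (2*pi/3) = -1/2" by (rule cos_120)
  finally show ?thesis by (simp add: ramp_def)
qed

lemma cantor_summable:
  assumes "\<And>k. b k \<in> {0,1}"
  shows "summable (\<lambda>k. 2 * real_of_int (b k) / 3 ^ Suc k)"
proof (rule summable_comparison_test)
  show "\<exists>N. \<forall>n\<ge>N. norm (2 * real_of_int (b n) / 3 ^ Suc n) \<le> (1/3)^n"
  proof (intro exI allI impI)
    fix n show "norm (2 * real_of_int (b n) / 3 ^ Suc n) \<le> (1/3)^n"
      using assms[of n] by (auto simp: field_simps)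
  qed
  show "summable (\<lambda>n. (1/3)^n :: real)" by (rule summable_geometric) simp
qed

lemma cantor_rec:
  assumes "\<And>k. b k \<in> {0,1}"
  shows "3 * cantor b = 2 * of_int (b 0) + cantor (b \<circ> Suc)"
proof -
  have "cantor b = 2 * of_int (b 0) / 3 + (\<Sum>k. 2 * of_int (b (Suc k)) / 3 ^ Suc (Suc k))"
    unfolding cantor_def using suminf_split_head[OF cantor_summable[of b]] assms by simp
  also have "(\<Sum>k. 2 * real_of_int (b (Suc k)) / 3 ^ Suc (Suc k)) = (1/3) * cantor (b \<circ> Suc)"
    unfolding cantor_def
    by (subst suminf_mult[OF cantor_summable, symmetric]) (use assms in auto)
  finally show ?thesis by simp
qed

lemma cantor_bounds:
  assumes "\<And>k. b k \<in> {0,1}"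
  shows "0 \<le> cantor b" "cantor b \<le> 1"
proof -
  have nn: "0 \<le> real_of_int (b k)" "real_of_int (b k) \<le> 1" for k using assms[of k] by auto
  show "0 \<le> cantor b" unfolding cantor_def
    by (intro suminf_nonneg cantor_summable assms divide_nonneg_nonneg mult_nonneg_nonneg nn) auto
  have n1: "b k \<le> 1" for k using assms[of k] by auto
  have g: "(\<lambda>k. (2/3) * (1/3::real)^k) sums ((2/3) * (1 / (1 - 1/3)))"
    by (intro sums_mult geometric_sums) auto
  have "cantor b \<le> (\<Sum>k. (2/3) * (1/3::real)^k)" unfolding cantor_def
    by (intro suminf_le cantor_summable assms sums_summable[OF g]) (auto simp: field_simps n1)
  also have "\<dots> = 1" using sums_unique[OF g] by simp
  finally show "cantor b \<le> 1" .
qed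

text \<open>Multiplication by 3 shifts the ternary digits 0 and 2. The digits shifted out form an
  even integer, invisible to \<open>ramp\<close> because of its period 2, and the remaining Cantor
  point lies in the lower or upper third according to its leading digit.\<close>

lemma ramp_cantor:
  assumes "\<And>k. b k \<in> {0,1}"
  shows "ramp (3 ^ k * cantor b) = of_int (b k)"
  using assms
proof (induction k arbitrary: b)
  case 0
  have rec: "3 * cantor b = 2 * of_int (b 0) + cantor (b \<circ> Suc)" by (rule cantor_rec[OF 0])
  have bd: "0 \<le> cantor (b \<circ> Suc)" "cantor (b \<circ> Suc) \<le> 1" 
    using cantor_bounds[of "b \<circ> Suc"] 0 by auto
  from 0[of 0] show ?case
  proof (elim insertE)
    assume "b 0 = 0"
    then have "ramp (cantor b) = 0" using rec bd by (intro ramp_low) (auto simp: o_def)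
    then show ?thesis using \<open>b 0 = 0\<close> by simp
  next
    assume "b 0 = 1"
    then have "ramp (cantor b) = 1" using rec bd by (intro ramp_high) (auto simp: o_def)
    then show ?thesis using \<open>b 0 = 1\<close> by simp
  qed auto
next
  case (Suc k)
  have "3 ^ Suc k * cantor b = 3 ^ k * (3 * cantor b)" by simp
  also have "\<dots> = 2 * of_int (3 ^ k * b 0) + 3 ^ k * cantor (b \<circ> Suc)"
    by (subst cantor_rec[of b]) (use Suc.prems in \<open>simp_all add: algebra_simps\<close>)
  finally have "ramp (3 ^ Suc k * cantor b) = ramp (3 ^ k * cantor (b \<circ> Suc))"
    by (simp only: ramp_add_even)
  also have "\<dots> = of_int ((b \<circ> Suc) k)" by (rule Suc.IH) (use Suc.prems in auto)
  finally show ?case by simp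
qed

lemma bit_of_01: "bit_of x k \<in> {0,1}"
  by (auto simp: bit_of_def)

lemma bit_of_sums:
  assumes "0 \<le> x" "x < 1"
  shows "(\<lambda>k. of_int (bit_of x k) / 2 ^ Suc k) sums x"
proof -
  \<comment> \<open>The partial sums are the dyadic truncations of \<open>x\<close>: doubling inside
    the floor doubles the old value and adds the new digit. The start at 0 uses
    \<open>x < 1\<close>.\<close>
  have part: "(\<Sum>k<n. real_of_int (bit_of x k) / 2 ^ Suc k) = of_int \<lfloor>2 ^ n * x\<rfloor> / 2 ^ n" for n
  proof (induction n)
    case 0
    have "\<lfloor>x\<rfloor> = 0" using assms by (simp add: floor_eq_iff)
    then show ?case by simp
  next
    case (Suc n)
    have "\<lfloor>2 ^ Suc n * x\<rfloor> div 2 = \<lfloor>2 ^ n * x\<rfloor>"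
      using floor_divide_real_eq_div[of 2 "2 ^ Suc n * x"] by simp
    then have "\<lfloor>2 ^ Suc n * x\<rfloor> = 2 * \<lfloor>2 ^ n * x\<rfloor> + bit_of x n"
      unfolding bit_of_def by presburger
    then have "real_of_int \<lfloor>2 ^ Suc n * x\<rfloor> = 2 * of_int \<lfloor>2 ^ n * x\<rfloor> + of_int (bit_of x n)"
      by simp
    then show ?case using Suc by (simp add: field_simps)
  qed
  have "(\<lambda>n. of_int \<lfloor>2 ^ n * x\<rfloor> / 2 ^ n) \<longlonglongrightarrow> x"
  proof (rule tendsto_sandwich)
    show "\<forall>\<^sub>F n in sequentially. x - (1/2)^n \<le> of_int \<lfloor>2 ^ n * x\<rfloor> / 2 ^ n"
    proof (intro always_eventually allI)
      fix n
      have "2 ^ n * x - 1 \<le> of_int \<lfloor>2 ^ n * x\<rfloor>" by linarith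
      then have "(2 ^ n * x - 1) / 2 ^ n \<le> of_int \<lfloor>2 ^ n * x\<rfloor> / 2 ^ n"
        by (intro divide_right_mono) auto
      then show "x - (1/2)^n \<le> of_int \<lfloor>2 ^ n * x\<rfloor> / 2 ^ n"
        by (simp add: diff_divide_distrib power_divide)
    qed
    show "\<forall>\<^sub>F n in sequentially. of_int \<lfloor>2 ^ n * x\<rfloor> / 2 ^ n \<le> x"
    proof (intro always_eventually allI)
      fix n
      have "of_int \<lfloor>2 ^ n * x\<rfloor> \<le> 2 ^ n * x" by linarith
      then show "of_int \<lfloor>2 ^ n * x\<rfloor> / 2 ^ n \<le> x" by (simp add: field_simps)
    qed
    have "(\<lambda>n. x - (1/2)^n) \<longlonglongrightarrow> x - 0"
      by (intro tendsto_intros LIMSEQ_power_zero) auto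
    then show "(\<lambda>n. x - (1/2)^n) \<longlonglongrightarrow> x" by simp
  qed simp
  then show ?thesis unfolding sums_def part .
qed

lemma schoenberg_summable: "summable (\<lambda>k. ramp (3 ^ (2 * k + c) * t) / 2 ^ Suc k)"
proof (rule summable_comparison_test)
  show "\<exists>N. \<forall>n\<ge>N. norm (ramp (3 ^ (2 * n + c) * t) / 2 ^ Suc n) \<le> (1/2)^n"
  proof (intro exI allI impI)
    fix n show "norm (ramp (3 ^ (2 * n + c) * t) / 2 ^ Suc n) \<le> (1/2)^n"
      using ramp_bounds[of "3 ^ (2 * n + c) * t"] by (auto simp: field_simps)
  qed
  show "summable (\<lambda>n. (1/2)^n :: real)" by (rule summable_geometric) simp
qed

lemma schoenberg_bounds: "0 \<le> schoenberg c t" "schoenberg c t \<le> 1"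
proof -
  show "0 \<le> schoenberg c t" unfolding schoenberg_def
    by (intro suminf_nonneg schoenberg_summable) (auto simp: ramp_bounds)
  have g: "(\<lambda>k. (1/2) * (1/2::real)^k) sums ((1/2) * (1 / (1 - 1/2)))"
    by (intro sums_mult geometric_sums) auto
  have "schoenberg c t \<le> (\<Sum>k. (1/2) * (1/2::real)^k)" unfolding schoenberg_def
    by (intro suminf_le schoenberg_summable sums_summable[OF g]) (auto simp: field_simps ramp_bounds)
  also have "\<dots> = 1" using sums_unique[OF g] by simp
  finally show "schoenberg c t \<le> 1" .
qed

lemma schoenberg_continuous: "continuous_on UNIV (schoenberg c)"
proof -
  have "uniform_limit UNIV (\<lambda>n t. \<Sum>k<n. ramp (3 ^ (2 * k + c) * t) / 2 ^ Suc k)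
          (\<lambda>t. \<Sum>k. ramp (3 ^ (2 * k + c) * t) / 2 ^ Suc k) sequentially"
  proof (rule Weierstrass_m_test)
    show "norm (ramp (3 ^ (2 * n + c) * t) / 2 ^ Suc n) \<le> (1/2)^n" for n t
      using ramp_bounds[of "3 ^ (2 * n + c) * t"] by (auto simp: field_simps)
    show "summable (\<lambda>n. (1/2)^n :: real)" by (rule summable_geometric) simp
  qed
  then show ?thesis unfolding schoenberg_def
    by (rule uniform_limit_theorem[rotated])
       (auto intro!: always_eventually continuous_intros simp: ramp_def)
qed

text \<open>The right inverse \<open>s\<close> is discontinuous, as binary digits are, but it is a
  limit of Borel functions. Continuity is required of \<open>\<phi>\<close> only.\<close>

lemma square_curve:
  assumes "R > 0"
  obtains \<phi> :: "real \<Rightarrow> complex" and s :: "complex \<Rightarrow> real" where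
    "continuous_on UNIV \<phi>" "bounded (range \<phi>)" "s \<in> borel_measurable borel"
    "\<And>z. 0 \<le> s z" "\<And>z. s z \<le> 1" "\<And>z. z \<in> cball 0 R \<Longrightarrow> \<phi> (s z) = z"
proof -
  \<comment> \<open>The scale \<open>4 * R\<close> puts the coordinates of the disc into [1/4, 3/4],
    strictly below 1 as \<open>bit_of_sums\<close> demands. The even positions in \<open>b\<close>
    then hold the digits of the real part, the odd ones those of the imaginary part.\<close>
  define u where "u x = x / (4 * R) + 1/2" for x
  define b where "b z k = (if even k then bit_of (u (Re z)) (k div 2) else bit_of (u (Im z)) (k div 2))" for z k
  define s where "s z = cantor (b z)" for z
  define \<phi> where "\<phi> t = Complex (4 * R * (schoenberg 0 t - 1/2)) (4 * R * (schoenberg 1 t - 1/2))" for t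
  have b01: "b z k \<in> {0,1}" for z k unfolding b_def using bit_of_01 by simp
  have c: "continuous_on UNIV \<phi>"
    unfolding \<phi>_def Complex_eq by (intro continuous_intros schoenberg_continuous)
  have bd: "bounded (range \<phi>)"
  proof (rule boundedI)
    fix z assume "z \<in> range \<phi>"
    then obtain t where z: "z = \<phi> t" by auto
    have "\<bar>schoenberg c t - 1/2\<bar> \<le> 1" for c using schoenberg_bounds[of c t] by auto
    then have "\<bar>Re z\<bar> \<le> 4 * R" "\<bar>Im z\<bar> \<le> 4 * R"
      using assms by (auto simp: z \<phi>_def abs_mult)
    then show "norm z \<le> 8 * R" using cmod_le[of z] by linarith
  qed
  have bm: "(\<lambda>z. real_of_int (b z k)) \<in> borel_measurable borel" for k
    unfolding b_def bit_of_def u_def by measurable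
  have m: "s \<in> borel_measurable borel"
    unfolding s_def cantor_def by (intro borel_measurable_suminf) (use bm in measurable)
  have inv: "\<phi> (s z) = z" if z: "z \<in> cball 0 R" for z
  proof -
    have "\<bar>Re z\<bar> \<le> R" "\<bar>Im z\<bar> \<le> R" using z abs_Re_le_cmod[of z] abs_Im_le_cmod[of z] by auto
    then have uu: "0 \<le> u (Re z)" "u (Re z) < 1" "0 \<le> u (Im z)" "u (Im z) < 1"
      using assms by (auto simp: u_def field_simps)
    have "schoenberg 0 (s z) = u (Re z)"
      unfolding schoenberg_def s_def ramp_cantor[OF b01]
      using bit_of_sums[OF uu(1,2)] by (simp add: b_def sums_iff)
    moreover have "schoenberg 1 (s z) = u (Im z)"
      unfolding schoenberg_def s_def ramp_cantor[OF b01]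
      using bit_of_sums[OF uu(3,4)] by (simp add: b_def sums_iff)
    ultimately show ?thesis using assms by (simp add: \<phi>_def u_def complex_eq_iff)
  qed
  show thesis
    by (rule that[OF c bd m]) (auto simp: s_def inv[unfolded s_def] cantor_bounds[OF b01])
qed

text \<open>The measures go to the line along the Borel map \<open>s\<close>, and the limit comes
  back along \<open>\<phi>\<close>. Test functions are composed with \<open>\<phi>\<close> alone, so
  they stay continuous and bounded on the line.\<close>

lemma weak_compactness:
  assumes C: "compact C" "C \<noteq> {}" and \<mu>: "\<And>k. \<mu> k \<in> borel_probs_on C"
  obtains r \<nu> where "strict_mono (r :: nat \<Rightarrow> nat)" "\<nu> \<in> borel_probs_on C"
    "bounded_weak_conv (\<mu> \<circ> r) \<nu>"
proof -
  have cl: "closed C" using C compact_imp_closed by auto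
  obtain R where R: "R > 0" "C \<subseteq> cball 0 R"
    by (rule compact_subset_cball[OF C(1)])
  obtain \<phi> :: "real \<Rightarrow> complex" and s :: "complex \<Rightarrow> real" where
    \<phi>: "continuous_on UNIV \<phi>" "bounded (range \<phi>)" and s [measurable]: "s \<in> borel_measurable borel"
    and s01: "\<And>z. 0 \<le> s z" "\<And>z. s z \<le> 1" and inv: "\<And>z. z \<in> cball 0 R \<Longrightarrow> \<phi> (s z) = z"
    using square_curve[OF R(1)] by metis
  note d = borel_probs_onD[OF \<mu> cl]
  have sm: "s \<in> borel_measurable (\<mu> k)" for k using s d(1)[of k] by (simp cong: measurable_cong_sets)
  define \<mu>' where "\<mu>' k = distr (\<mu> k) borel s" for k
  have rd: "real_distribution (\<mu>' k)" for k
    unfolding \<mu>'_def using prob_space.real_distribution_distr[OF d(3) sm] .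
  have tight: "tight \<mu>'"
    unfolding tight_def
  proof (intro conjI allI impI rd)
    fix e :: real assume "e > 0"
    have "measure (\<mu>' k) {-1<..2} = 1" for k
    proof -
      have "s -` {-1<..2} \<inter> space (\<mu> k) = space (\<mu> k)"
      proof -
        have "-1 < s z" "s z \<le> 2" for z using s01(1)[of z] s01(2)[of z] by linarith+
        then show ?thesis by auto
      qed
      then show ?thesis unfolding \<mu>'_def using sm prob_space.prob_space[OF d(3)]
        by (simp add: measure_distr)
    qed
    then show "\<exists>a b. a < b \<and> (\<forall>n. 1 - e < measure (\<mu>' n) {a<..b})"
      using \<open>e > 0\<close> by (intro exI[of _ "-1"] exI[of _ 2]) auto
  qed
  obtain r M where r: "strict_mono (r :: nat \<Rightarrow> nat)" and M: "real_distribution M"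
    and wc: "weak_conv_m (\<mu>' \<circ> r) M"
    using tight_imp_convergent_subsubsequence[OF tight strict_mono_id] by (auto simp: o_def)
  interpret M: real_distribution M by (rule M)
  have \<phi>m [measurable]: "\<phi> \<in> borel_measurable borel"
    using \<phi> by (simp add: borel_measurable_continuous_onI)
  have \<phi>M: "\<phi> \<in> borel_measurable M" by (simp add: measurable_cong_sets[OF M.events_eq_borel refl])
  define \<nu> where "\<nu> = distr M borel \<phi>"
  have \<nu>p: "prob_space \<nu>" unfolding \<nu>_def by (rule M.prob_space_distr[OF \<phi>M])
  have \<nu>s: "sets \<nu> = sets borel" by (simp add: \<nu>_def)
  have conv: "bounded_weak_conv (\<mu> \<circ> r) \<nu>"
    unfolding bounded_weak_conv_def
  proof (intro allI impI)
    fix f :: "complex \<Rightarrow> real" assume f: "continuous_on UNIV f"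
    have fm [measurable]: "f \<in> borel_measurable borel" using f by (simp add: borel_measurable_continuous_onI)
    have cf: "continuous_on UNIV (\<lambda>t. f (\<phi> t))"
      using continuous_on_compose2[OF f \<phi>(1)] by auto
    have "compact (closure (range \<phi>))" using \<phi>(2) by auto
    then have "bounded (f ` closure (range \<phi>))"
      by (intro compact_imp_bounded compact_continuous_image continuous_on_subset[OF f]) auto
    then obtain B where B: "\<And>x. x \<in> closure (range \<phi>) \<Longrightarrow> norm (f x) \<le> B"
      unfolding bounded_iff by auto
    have B': "norm (f (\<phi> t)) \<le> B" for t by (rule B) (rule subsetD[OF closure_subset], simp)
    have "(\<lambda>n. \<integral>t. f (\<phi> t) \<partial>(\<mu>' \<circ> r) n) \<longlonglongrightarrow> (\<integral>t. f (\<phi> t) \<partial>M)"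
    proof (rule weak_conv_imp_integral_bdd_continuous_conv[OF _ M wc])
      show "\<And>n. real_distribution ((\<mu>' \<circ> r) n)" using rd by simp
      show "isCont (\<lambda>t. f (\<phi> t)) x" for x using cf by (simp add: continuous_on_eq_continuous_at)
      show "\<And>x. norm (f (\<phi> x)) \<le> B" by (rule B')
    qed
    moreover have "(\<integral>t. f (\<phi> t) \<partial>\<mu>' k) = (\<integral>z. f z \<partial>\<mu> k)" for k
    proof -
      have "(\<integral>t. f (\<phi> t) \<partial>\<mu>' k) = (\<integral>z. f (\<phi> (s z)) \<partial>\<mu> k)"
        unfolding \<mu>'_def by (rule integral_distr[OF sm]) measurable
      also have "\<dots> = (\<integral>z. f z \<partial>\<mu> k)"
      proof (rule integral_cong_AE)
        show "AE z in \<mu> k. f (\<phi> (s z)) = f z"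
          using d(4)[of k] by eventually_elim (use inv R in auto)
        have "(\<lambda>z. f (\<phi> (s z))) \<in> borel_measurable borel" by measurable
        then show "(\<lambda>z. f (\<phi> (s z))) \<in> borel_measurable (\<mu> k)" "f \<in> borel_measurable (\<mu> k)"
          using fm by (simp_all add: measurable_cong_sets[OF d(1) refl])
      qed
      finally show ?thesis .
    qed
    moreover have "(\<integral>t. f (\<phi> t) \<partial>M) = (\<integral>z. f z \<partial>\<nu>)"
      unfolding \<nu>_def by (rule integral_distr[OF \<phi>M, symmetric]) measurable
    ultimately show "(\<lambda>k. \<integral>z. f z \<partial>(\<mu> \<circ> r) k) \<longlonglongrightarrow> (\<integral>z. f z \<partial>\<nu>)" by (simp add: o_def)
  qed
  \<comment> \<open>As an image under \<open>\<phi>\<close> the limit is so far known to live only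
    on the closure of the range. The tent functions that vanish on \<open>C\<close> then confine it
    to \<open>C\<close>.\<close>
  have "AE z in \<nu>. z \<in> closure (range \<phi>)"
    unfolding \<nu>_def using closure_subset[of "range \<phi>"] by (subst AE_distr_iff[OF \<phi>M]) auto
  then have \<nu>D: "\<nu> \<in> borel_probs_on (closure (range \<phi>))"
    by (intro borel_probs_onI \<nu>s \<nu>p) auto
  have "compact (closure (range \<phi>))" using \<phi>(2) by auto
  then have "\<nu> \<in> borel_probs_on C"
  proof (rule weak_limit_support[OF _ \<nu>D conv cl])
    fix z assume "z \<notin> C"
    then obtain d where e: "d > 0" "\<And>w. w \<in> C \<Longrightarrow> d \<le> cmod (z - w)" using distance_to_closed[OF cl] by blast
    have "(\<integral>w. max 0 (d - dist z w) \<partial>\<mu> k) = 0" for k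
    proof (rule integral_eq_zero_AE)
      show "AE w in \<mu> k. max 0 (d - dist z w) = 0"
        using d(4)[of k] by eventually_elim (use e(2) in \<open>simp add: dist_norm\<close>)
    qed
    then show "\<exists>\<rho>>0. (\<lambda>j. \<integral>w. max 0 (\<rho> - dist z w) \<partial>(\<mu> \<circ> r) j) \<longlonglongrightarrow> 0" using e(1) by auto
  qed
  then show thesis using that r conv by blast
qed

subsection \<open>Regularized logarithmic energy\<close>

lemma borel_probs_on_integral_le:
  fixes f g :: "complex \<Rightarrow> real"
  assumes "\<mu> \<in> borel_probs_on C" "compact C" "continuous_on UNIV f" "continuous_on UNIV g"
    "\<And>z. z \<in> C \<Longrightarrow> f z \<le> g z"
  shows "(\<integral>z. f z \<partial>\<mu>) \<le> (\<integral>z. g z \<partial>\<mu>)"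
proof (rule integral_mono_AE)
  show "integrable \<mu> f" "integrable \<mu> g" using assms borel_probs_on_integrable by blast+
  show "AE z in \<mu>. f z \<le> g z"
    using borel_probs_onD(4)[OF assms(1) compact_imp_closed[OF assms(2)]] by eventually_elim (rule assms)
qed

lemma borel_probs_on_integral_diff:
  fixes f g :: "complex \<Rightarrow> real"
  assumes "\<mu> \<in> borel_probs_on C" "compact C" "continuous_on UNIV f" "continuous_on UNIV g"
    "\<And>z. z \<in> C \<Longrightarrow> \<bar>f z - g z\<bar> \<le> e"
  shows "\<bar>(\<integral>z. f z \<partial>\<mu>) - (\<integral>z. g z \<partial>\<mu>)\<bar> \<le> e"
proof -
  interpret prob_space \<mu> using assms(1) by (simp add: borel_probs_on_def)
  have i: "integrable \<mu> f" "integrable \<mu> g" using assms borel_probs_on_integrable by blast+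
  have "(\<integral>z. f z \<partial>\<mu>) \<le> (\<integral>z. g z + e \<partial>\<mu>)" 
    by (rule borel_probs_on_integral_le[OF assms(1,2)]) (use assms in \<open>force intro!: continuous_intros simp: abs_le_iff\<close>)+
  moreover have "(\<integral>z. g z \<partial>\<mu>) \<le> (\<integral>z. f z + e \<partial>\<mu>)" 
    by (rule borel_probs_on_integral_le[OF assms(1,2)]) (use assms in \<open>force intro!: continuous_intros simp: abs_le_iff\<close>)+
  ultimately show ?thesis using i by (simp add: prob_space)
qed

lemma continuous_on_section:
  fixes k :: "complex \<Rightarrow> complex \<Rightarrow> real"
  assumes "continuous_on UNIV (\<lambda>(z, w). k z w)"
  shows "continuous_on UNIV (k z)"
proof -
  have "continuous_on UNIV (\<lambda>w. (z, w))" by (intro continuous_on_Pair continuous_on_const continuous_on_id)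
  from continuous_on_compose2[OF assms this] show ?thesis by simp
qed

text \<open>The modulus of continuity is that of \<open>k\<close> on a compact product, so one
  \<open>d\<close> serves all probability measures on \<open>C\<close>. This is what upgrades
  pointwise to uniform convergence of smoothed potentials.\<close>

lemma integral_kernel_equicontinuous:
  fixes k :: "complex \<Rightarrow> complex \<Rightarrow> real"
  assumes k: "continuous_on UNIV (\<lambda>(z, w). k z w)" and "compact A" "compact C" "e > 0"
  obtains d where "d > 0" "\<And>\<mu> z z'. \<mu> \<in> borel_probs_on C \<Longrightarrow> z \<in> A \<Longrightarrow> z' \<in> A \<Longrightarrow> dist z z' < d \<Longrightarrow>
    \<bar>(\<integral>w. k z w \<partial>\<mu>) - (\<integral>w. k z' w \<partial>\<mu>)\<bar> \<le> e"
proof -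
  have "uniformly_continuous_on (A \<times> C) (\<lambda>(z, w). k z w)"
    by (intro compact_uniformly_continuous continuous_on_subset[OF k] compact_Times assms) auto
  then obtain d where d: "d > 0" and D: "\<And>x x'. x \<in> A \<times> C \<Longrightarrow> x' \<in> A \<times> C \<Longrightarrow> dist x' x < d \<Longrightarrow>
      dist ((\<lambda>(z, w). k z w) x') ((\<lambda>(z, w). k z w) x) < e"
    using \<open>e > 0\<close> unfolding uniformly_continuous_on_def by blast
  note kz = continuous_on_section[OF k]
  show thesis
  proof (rule that[OF d])
    fix \<mu> z z' assume *: "\<mu> \<in> borel_probs_on C" "z \<in> A" "z' \<in> A" "dist z z' < d"
    show "\<bar>(\<integral>w. k z w \<partial>\<mu>) - (\<integral>w. k z' w \<partial>\<mu>)\<bar> \<le> e"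
    proof (rule borel_probs_on_integral_diff[OF *(1) assms(3) kz kz])
      fix w assume "w \<in> C"
      then show "\<bar>k z w - k z' w\<bar> \<le> e"
        using D[of "(z', w)" "(z, w)"] * by (auto simp: dist_Pair_Pair dist_real_def)
    qed
  qed
qed

lemma continuous_on_integral_kernel:
  fixes k :: "complex \<Rightarrow> complex \<Rightarrow> real"
  assumes k: "continuous_on UNIV (\<lambda>(z, w). k z w)" and \<mu>: "\<mu> \<in> borel_probs_on C" "compact C"
  shows "continuous_on UNIV (\<lambda>z. \<integral>w. k z w \<partial>\<mu>)"
  unfolding continuous_on_iff
proof (intro ballI allI impI)
  fix z0 :: complex and e :: real assume "e > 0"
  then obtain d where d: "d > 0" "\<And>\<mu> z z'. \<mu> \<in> borel_probs_on C \<Longrightarrow> z \<in> cball z0 1 \<Longrightarrow> z' \<in> cball z0 1 \<Longrightarrow> dist z z' < d \<Longrightarrow>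
    \<bar>(\<integral>w. k z w \<partial>\<mu>) - (\<integral>w. k z' w \<partial>\<mu>)\<bar> \<le> e/2"
    using integral_kernel_equicontinuous[OF k compact_cball \<mu>(2), of "e/2" z0 1] by (metis half_gt_zero)
  show "\<exists>d>0. \<forall>z\<in>UNIV. dist z z0 < d \<longrightarrow> dist (\<integral>w. k z w \<partial>\<mu>) (\<integral>w. k z0 w \<partial>\<mu>) < e"
  proof (intro exI[of _ "min d 1"] conjI ballI impI)
    show "min d 1 > 0" using d by auto
    fix z assume "dist z z0 < min d 1"
    then show "dist (\<integral>w. k z w \<partial>\<mu>) (\<integral>w. k z0 w \<partial>\<mu>) < e"
      using d(2)[OF \<mu>(1), of z z0] \<open>e > 0\<close> by (auto simp: dist_real_def dist_commute)
  qed
qed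

lemma uniform_limit_integral_kernel:
  fixes k :: "complex \<Rightarrow> complex \<Rightarrow> real"
  assumes k: "continuous_on UNIV (\<lambda>(z, w). k z w)" and C: "compact C" and A: "compact A"
    and \<mu>: "\<And>j. \<mu> j \<in> borel_probs_on C" "\<nu> \<in> borel_probs_on C" "bounded_weak_conv \<mu> \<nu>"
  shows "uniform_limit A (\<lambda>j z. \<integral>w. k z w \<partial>\<mu> j) (\<lambda>z. \<integral>w. k z w \<partial>\<nu>) sequentially"
  unfolding uniform_limit_iff
proof (intro allI impI)
  fix e :: real assume "e > 0"
  then obtain d where d: "d > 0" and D: "\<And>\<mu> z z'. \<mu> \<in> borel_probs_on C \<Longrightarrow> z \<in> A \<Longrightarrow> z' \<in> A \<Longrightarrow> dist z z' < d \<Longrightarrow>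
    \<bar>(\<integral>w. k z w \<partial>\<mu>) - (\<integral>w. k z' w \<partial>\<mu>)\<bar> \<le> e/4"
    using integral_kernel_equicontinuous[OF k A C, of "e/4"] by (metis zero_less_divide_iff zero_less_numeral)
  obtain F where F: "finite F" "F \<subseteq> A" "A \<subseteq> (\<Union>x\<in>F. ball x d)"
    by (rule compactE_image[OF A, of A "\<lambda>x. ball x d"]) (use d in auto)
  have "\<forall>\<^sub>F j in sequentially. \<forall>x\<in>F. dist (\<integral>w. k x w \<partial>\<mu> j) (\<integral>w. k x w \<partial>\<nu>) < e/4"
  proof (rule eventually_ball_finite[OF F(1)], intro ballI)
    fix x
    have "(\<lambda>j. \<integral>w. k x w \<partial>\<mu> j) \<longlonglongrightarrow> (\<integral>w. k x w \<partial>\<nu>)"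
      using \<mu>(3) continuous_on_section[OF k, of x] unfolding bounded_weak_conv_def by blast
    then show "\<forall>\<^sub>F j in sequentially. dist (\<integral>w. k x w \<partial>\<mu> j) (\<integral>w. k x w \<partial>\<nu>) < e/4"
      using \<open>e > 0\<close> by (intro tendstoD) auto
  qed
  then show "\<forall>\<^sub>F j in sequentially. \<forall>z\<in>A. dist (\<integral>w. k z w \<partial>\<mu> j) (\<integral>w. k z w \<partial>\<nu>) < e"
  proof eventually_elim
    case (elim j)
    show ?case
    proof
      fix z assume z: "z \<in> A"
      then obtain x where x: "x \<in> F" "dist x z < d" using F by auto
      have "\<bar>(\<integral>w. k x w \<partial>\<mu> j) - (\<integral>w. k z w \<partial>\<mu> j)\<bar> \<le> e/4" "\<bar>(\<integral>w. k x w \<partial>\<nu>) - (\<integral>w. k z w \<partial>\<nu>)\<bar> \<le> e/4"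
        using x z F by (intro D[OF \<mu>(1)] D[OF \<mu>(2)]; blast)+
      moreover have "dist (\<integral>w. k x w \<partial>\<mu> j) (\<integral>w. k x w \<partial>\<nu>) < e/4" using elim x by auto
      ultimately show "dist (\<integral>w. k z w \<partial>\<mu> j) (\<integral>w. k z w \<partial>\<nu>) < e"
        using \<open>e > 0\<close> unfolding dist_real_def by linarith
    qed
  qed
qed

text \<open>Replacing the inner measure by \<open>\<nu>\<close> costs a uniformly small error;
  afterwards the outer integrand is a fixed continuous function, to which weak convergence applies
  directly.\<close>

lemma tendsto_double_integral_kernel:
  fixes k :: "complex \<Rightarrow> complex \<Rightarrow> real"
  assumes k: "continuous_on UNIV (\<lambda>(z, w). k z w)" and C: "compact C"
    and \<mu>: "\<And>j. \<mu> j \<in> borel_probs_on C" "\<nu> \<in> borel_probs_on C" "bounded_weak_conv \<mu> \<nu>"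
  shows "(\<lambda>j. \<integral>z. \<integral>w. k z w \<partial>\<mu> j \<partial>\<mu> j) \<longlonglongrightarrow> (\<integral>z. \<integral>w. k z w \<partial>\<nu> \<partial>\<nu>)"
proof -
  note c = continuous_on_integral_kernel[OF k _ C]
  have "(\<lambda>j. \<integral>z. \<integral>w. k z w \<partial>\<nu> \<partial>\<mu> j) \<longlonglongrightarrow> (\<integral>z. \<integral>w. k z w \<partial>\<nu> \<partial>\<nu>)"
    using \<mu>(3) c[OF \<mu>(2)] unfolding bounded_weak_conv_def by blast
  moreover have "(\<lambda>j. (\<integral>z. \<integral>w. k z w \<partial>\<mu> j \<partial>\<mu> j) - (\<integral>z. \<integral>w. k z w \<partial>\<nu> \<partial>\<mu> j)) \<longlonglongrightarrow> 0"
  proof (rule tendstoI)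
    fix e :: real assume "e > 0"
    then have "\<forall>\<^sub>F j in sequentially. \<forall>z\<in>C. dist (\<integral>w. k z w \<partial>\<mu> j) (\<integral>w. k z w \<partial>\<nu>) < e/2"
      using uniform_limit_integral_kernel[OF k C C \<mu>] unfolding uniform_limit_iff
      by (elim allE[of _ "e/2"]) auto
    then show "\<forall>\<^sub>F j in sequentially. dist ((\<integral>z. \<integral>w. k z w \<partial>\<mu> j \<partial>\<mu> j) - (\<integral>z. \<integral>w. k z w \<partial>\<nu> \<partial>\<mu> j)) 0 < e"
    proof eventually_elim
      case (elim j)
      have "\<bar>(\<integral>z. \<integral>w. k z w \<partial>\<mu> j \<partial>\<mu> j) - (\<integral>z. \<integral>w. k z w \<partial>\<nu> \<partial>\<mu> j)\<bar> \<le> e/2"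
        by (rule borel_probs_on_integral_diff[OF \<mu>(1) C c[OF \<mu>(1)] c[OF \<mu>(2)]])
           (use elim in \<open>force simp: dist_real_def\<close>)
      then show ?case using \<open>e > 0\<close> by (simp add: dist_real_def)
    qed
  qed
  ultimately show ?thesis using tendsto_add by fastforce
qed

text \<open>Monotone convergence for the positive and the negative parts separately. The positive
  parts have finite integral from the start, so the difference of the limits is never of the form
  infinity minus infinity.\<close>

lemma ereal_integral_decreasing:
  fixes f :: "nat \<Rightarrow> 'a \<Rightarrow> real" and g :: "'a \<Rightarrow> ereal"
  assumes int: "\<And>j. integrable M (f j)" and dec: "AE x in M. decseq (\<lambda>j. f j x)"
    and lim: "AE x in M. (\<lambda>j. ereal (f j x)) \<longlonglongrightarrow> g x"
  shows "(\<lambda>j. ereal (\<integral>x. f j x \<partial>M)) \<longlonglongrightarrow> ereal_integral M g"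
proof -
  have [measurable]: "f j \<in> borel_measurable M" for j using int by auto
  have fin: "(\<integral>\<^sup>+x. ennreal (f j x) \<partial>M) < \<infinity>" "(\<integral>\<^sup>+x. ennreal (- f j x) \<partial>M) < \<infinity>" for j
    using int[of j] unfolding real_integrable_def by (auto simp: top.not_eq_extremum)
  have p: "AE x in M. e2ennreal (g x) = (INF j. ennreal (f j x))"
    using dec lim
  proof eventually_elim
    case (elim x)
    have "(\<lambda>j. e2ennreal (ereal (f j x))) \<longlonglongrightarrow> e2ennreal (g x)"
      by (intro tendsto_e2ennrealI elim)
    moreover have "(\<lambda>j. ennreal (f j x)) \<longlonglongrightarrow> (INF j. ennreal (f j x))"
      using elim(1) by (intro LIMSEQ_INF) (auto simp: decseq_def intro: ennreal_leI)
    ultimately show ?case by (auto intro: LIMSEQ_unique)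
  qed
  have n: "AE x in M. e2ennreal (- g x) = (SUP j. ennreal (- f j x))"
    using dec lim
  proof eventually_elim
    case (elim x)
    have "(\<lambda>j. - ereal (f j x)) \<longlonglongrightarrow> - g x" using elim(2) by (intro tendsto_uminus_ereal)
    then have "(\<lambda>j. e2ennreal (- ereal (f j x))) \<longlonglongrightarrow> e2ennreal (- g x)"
      by (intro tendsto_e2ennrealI)
    moreover have "(\<lambda>j. ennreal (- f j x)) \<longlonglongrightarrow> (SUP j. ennreal (- f j x))"
      using elim(1) by (intro LIMSEQ_SUP) (auto simp: decseq_def incseq_def intro: ennreal_leI)
    ultimately show ?case by (auto intro: LIMSEQ_unique)
  qed
  have decf: "AE x in M. f (Suc j) x \<le> f j x" for j using dec by eventually_elim (auto simp: decseq_def)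
  then have decP: "AE x in M. ennreal (f (Suc j) x) \<le> ennreal (f j x)"
    and decN: "AE x in M. ennreal (- f j x) \<le> ennreal (- f (Suc j) x)" for j
    using decf[of j] by (eventually_elim, simp add: ennreal_leI)+
  have P: "(\<integral>\<^sup>+x. e2ennreal (g x) \<partial>M) = (INF j. \<integral>\<^sup>+x. ennreal (f j x) \<partial>M)"
    unfolding nn_integral_cong_AE[OF p]
    by (rule nn_integral_monotone_convergence_INF_AE[where i = 0 and f = "\<lambda>j x. ennreal (f j x)", OF decP _ fin(1)]) simp
  have N: "(\<integral>\<^sup>+x. e2ennreal (- g x) \<partial>M) = (SUP j. \<integral>\<^sup>+x. ennreal (- f j x) \<partial>M)"
    unfolding nn_integral_cong_AE[OF n]
    by (rule nn_integral_monotone_convergence_SUP_AE[where f = "\<lambda>j x. ennreal (- f j x)", OF decN]) simp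
  have P': "(\<lambda>j. \<integral>\<^sup>+x. ennreal (f j x) \<partial>M) \<longlonglongrightarrow> (\<integral>\<^sup>+x. e2ennreal (g x) \<partial>M)"
    unfolding P by (intro LIMSEQ_INF decseq_SucI nn_integral_mono_AE decP)
  have N': "(\<lambda>j. \<integral>\<^sup>+x. ennreal (- f j x) \<partial>M) \<longlonglongrightarrow> (\<integral>\<^sup>+x. e2ennreal (- g x) \<partial>M)"
    unfolding N by (intro LIMSEQ_SUP incseq_SucI nn_integral_mono_AE decN)
  have "(\<integral>\<^sup>+x. e2ennreal (g x) \<partial>M) \<le> (\<integral>\<^sup>+x. ennreal (f 0 x) \<partial>M)"
    unfolding P by (rule INF_lower) simp
  then have Pfin: "(\<integral>\<^sup>+x. e2ennreal (g x) \<partial>M) < \<infinity>" using fin(1)[of 0] by (rule le_less_trans)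
  have eq: "ereal (\<integral>x. f j x \<partial>M) = enn2ereal (\<integral>\<^sup>+x. ennreal (f j x) \<partial>M) - enn2ereal (\<integral>\<^sup>+x. ennreal (- f j x) \<partial>M)" for j
    unfolding real_lebesgue_integral_def[OF int]
    using fin[of j] by (cases "\<integral>\<^sup>+x. ennreal (f j x) \<partial>M"; cases "\<integral>\<^sup>+x. ennreal (- f j x) \<partial>M") 
      (auto simp: enn2ereal_ennreal)
  have "\<bar>enn2ereal (\<integral>\<^sup>+x. e2ennreal (g x) \<partial>M)\<bar> \<noteq> \<infinity>"
    using Pfin by (cases "\<integral>\<^sup>+x. e2ennreal (g x) \<partial>M") (auto simp: enn2ereal_ennreal)
  moreover have "(\<lambda>j. enn2ereal (\<integral>\<^sup>+x. ennreal (f j x) \<partial>M)) \<longlonglongrightarrow> enn2ereal (\<integral>\<^sup>+x. e2ennreal (g x) \<partial>M)"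
    "(\<lambda>j. enn2ereal (\<integral>\<^sup>+x. ennreal (- f j x) \<partial>M)) \<longlonglongrightarrow> enn2ereal (\<integral>\<^sup>+x. e2ennreal (- g x) \<partial>M)"
    using P' N' by (auto intro: tendsto_enn2erealI)
  ultimately show ?thesis unfolding eq ereal_integral_def
    by (intro tendsto_diff_ereal_general) auto
qed

text \<open>With these weights the regularized kernel is, up to terms in one variable, a function of the
  chordal distance, which is what the positivity argument for uniqueness needs.\<close>

definition reg_kernel :: "real \<Rightarrow> complex \<Rightarrow> complex \<Rightarrow> real" where
  "reg_kernel s z w = ln ((cmod (z - w))\<^sup>2 + s * (1 + (cmod z)\<^sup>2) * (1 + (cmod w)\<^sup>2)) / 2"

definition reg_energy :: "real \<Rightarrow> complex measure \<Rightarrow> complex measure \<Rightarrow> real" where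
  "reg_energy s \<mu> \<nu> = (\<integral>z. \<integral>w. reg_kernel s z w \<partial>\<nu> \<partial>\<mu>)"

lemma reg_kernel_arg_pos:
  assumes "s > 0"
  shows "(cmod (z - w))\<^sup>2 + s * (1 + (cmod z)\<^sup>2) * (1 + (cmod w)\<^sup>2) > 0"
  by (intro add_nonneg_pos mult_pos_pos assms add_pos_nonneg) auto

lemma continuous_reg_kernel:
  assumes "s > 0"
  shows "continuous_on UNIV (\<lambda>(z, w). reg_kernel s z w)"
  unfolding reg_kernel_def case_prod_unfold
proof (intro continuous_on_divide continuous_on_ln continuous_on_const ballI)
  show "continuous_on UNIV (\<lambda>p. (cmod (fst p - snd p))\<^sup>2 + s * (1 + (cmod (fst p))\<^sup>2) * (1 + (cmod (snd p))\<^sup>2))"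
    by (intro continuous_intros)
  show "(cmod (fst p - snd p))\<^sup>2 + s * (1 + (cmod (fst p))\<^sup>2) * (1 + (cmod (snd p))\<^sup>2) \<noteq> 0" for p
    using reg_kernel_arg_pos[OF assms, of "fst p" "snd p"] by (rule less_imp_neq[symmetric])
qed simp

lemma reg_kernel_mono:
  assumes "0 < s" "s \<le> t" shows "reg_kernel s z w \<le> reg_kernel t z w"
proof -
  have "s * ((1 + (cmod z)\<^sup>2) * (1 + (cmod w)\<^sup>2)) \<le> t * ((1 + (cmod z)\<^sup>2) * (1 + (cmod w)\<^sup>2))"
    using assms by (intro mult_right_mono) auto
  then show ?thesis unfolding reg_kernel_def
    using reg_kernel_arg_pos[OF assms(1), of z w] by (intro divide_right_mono ln_mono) (auto simp: mult.assoc)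
qed

lemma ln_le_reg_kernel:
  assumes "0 < s" "z \<noteq> w" shows "ln (cmod (z - w)) \<le> reg_kernel s z w"
proof -
  have "2 * ln (cmod (z - w)) = ln ((cmod (z - w))\<^sup>2)" using assms by (simp add: ln_realpow)
  also have "\<dots> \<le> ln ((cmod (z - w))\<^sup>2 + s * (1 + (cmod z)\<^sup>2) * (1 + (cmod w)\<^sup>2))"
    using assms by (intro ln_mono) auto
  finally show ?thesis by (simp add: reg_kernel_def)
qed

lemma reg_kernel_tendsto:
  "(\<lambda>j. ereal (reg_kernel (1 / Suc j) z w)) \<longlonglongrightarrow> ereal_ln (dist z w)"
proof (cases "z = w")
  case True
  define A where "A = (1 + (cmod w)\<^sup>2) * (1 + (cmod w)\<^sup>2)"
  have A: "A > 0" unfolding A_def by (simp add: add_pos_nonneg)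
  have "filterlim (\<lambda>j. ln (1 / real (Suc j) * A) / 2) at_bot sequentially"
    using A by real_asymp
  then have "filterlim (\<lambda>j. reg_kernel (1 / Suc j) z w) at_bot sequentially"
    using True by (simp add: reg_kernel_def A_def mult.assoc)
  then have "\<forall>\<^sub>F j in sequentially. reg_kernel (1 / Suc j) z w < r" for r
    by (simp add: filterlim_at_bot_dense)
  then show ?thesis using True by (simp add: ereal_ln_def tendsto_MInfty)
next
  case False
  have "(\<lambda>j. reg_kernel (1 / Suc j) z w) \<longlonglongrightarrow> ln ((cmod (z - w))\<^sup>2 + 0 * (1 + (cmod z)\<^sup>2) * (1 + (cmod w)\<^sup>2)) / 2"
    unfolding reg_kernel_def using False
    by (intro tendsto_intros) (auto intro!: LIMSEQ_Suc[OF lim_1_over_n, simplified])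
  then show ?thesis using False by (simp add: ereal_ln_def ln_realpow dist_norm)
qed

text \<open>Monotone convergence is used twice, for the potential and then for its integral. From
  here on extended real energies are reached only through these real approximations.\<close>

lemma reg_energy_tendsto:
  assumes "\<mu> \<in> borel_probs_on C" "compact C"
  shows "(\<lambda>j. ereal (reg_energy (1 / Suc j) \<mu> \<mu>)) \<longlonglongrightarrow> log_energy \<mu>"
proof -
  have pos: "1 / real (Suc j) > 0" for j by simp
  have dec: "decseq (\<lambda>j. reg_kernel (1 / Suc j) z w)" for z w
    by (intro decseq_SucI reg_kernel_mono) (auto simp: field_simps)
  note c = continuous_on_section[OF continuous_reg_kernel[OF pos]]
  have 1: "(\<lambda>j. ereal (\<integral>w. reg_kernel (1 / Suc j) z w \<partial>\<mu>)) \<longlonglongrightarrow> log_potential \<mu> z" for z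
    unfolding log_potential_def
    by (intro ereal_integral_decreasing borel_probs_on_integrable[OF assms c] AE_I2 dec reg_kernel_tendsto)
  show ?thesis unfolding log_energy_def reg_energy_def
    by (intro ereal_integral_decreasing borel_probs_on_integrable[OF assms] AE_I2 1 decseq_SucI integral_mono
        continuous_on_integral_kernel[OF _ assms] continuous_reg_kernel c pos decseq_SucD[OF dec])
qed

lemma reg_energy_mono:
  assumes \<mu>: "\<mu> \<in> borel_probs_on C" "\<nu> \<in> borel_probs_on C" "compact C" and s: "0 < s" "s \<le> t"
  shows "reg_energy s \<mu> \<nu> \<le> reg_energy t \<mu> \<nu>"
proof -
  have t: "t > 0" using s by simp
  show ?thesis unfolding reg_energy_def
    by (intro borel_probs_on_integral_le[OF \<mu>(1,3)] borel_probs_on_integral_le[OF \<mu>(2,3)]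
      continuous_on_integral_kernel[OF continuous_reg_kernel[OF s(1)] \<mu>(2,3)]
      continuous_on_integral_kernel[OF continuous_reg_kernel[OF t] \<mu>(2,3)]
      continuous_on_section[OF continuous_reg_kernel[OF s(1)]]
      continuous_on_section[OF continuous_reg_kernel[OF t]] reg_kernel_mono s)
qed

lemma log_energy_le_reg_energy:
  assumes "\<mu> \<in> borel_probs_on C" "compact C" "s > 0"
  shows "log_energy \<mu> \<le> ereal (reg_energy s \<mu> \<mu>)"
proof (rule LIMSEQ_le_const2[OF reg_energy_tendsto[OF assms(1,2)]])
  obtain N where N: "1 / real (Suc N) < s" using nat_approx_posE[OF assms(3)] by blast
  show "\<exists>N. \<forall>n\<ge>N. ereal (reg_energy (1 / Suc n) \<mu> \<mu>) \<le> ereal (reg_energy s \<mu> \<mu>)"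
  proof (intro exI allI impI)
    fix n assume "n \<ge> N"
    then have "1 / real (Suc n) \<le> 1 / real (Suc N)" by (simp add: field_simps)
    then show "ereal (reg_energy (1 / Suc n) \<mu> \<mu>) \<le> ereal (reg_energy s \<mu> \<mu>)"
      using reg_energy_mono[OF assms(1,1,2), of "1 / Suc n" s] N by simp
  qed
qed

lemma log_energy_ge:
  assumes "\<mu> \<in> borel_probs_on C" "compact C" "\<And>s. 0 < s \<Longrightarrow> s \<le> 1 \<Longrightarrow> c \<le> reg_energy s \<mu> \<mu>"
  shows "ereal c \<le> log_energy \<mu>"
  by (rule LIMSEQ_le_const[OF reg_energy_tendsto[OF assms(1,2)]]) (auto intro!: assms)

lemma log_energy_not_PInf:
  assumes "\<mu> \<in> borel_probs_on C" "compact C" shows "log_energy \<mu> \<noteq> \<infinity>"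
  using log_energy_le_reg_energy[OF assms, of 1] by auto

lemma log_energy_usc:
  assumes C: "compact C" and \<mu>: "\<And>j. \<mu> j \<in> borel_probs_on C" "\<nu> \<in> borel_probs_on C" "bounded_weak_conv \<mu> \<nu>"
    and c: "\<And>s. 0 < s \<Longrightarrow> \<exists>b. b \<longlonglongrightarrow> c \<and> (\<forall>\<^sub>F j in sequentially. b j \<le> reg_energy s (\<mu> j) (\<mu> j))"
  shows "ereal c \<le> log_energy \<nu>"
proof (rule log_energy_ge[OF \<mu>(2) C])
  fix s :: real assume s: "0 < s"
  obtain b where b: "b \<longlonglongrightarrow> c" "\<forall>\<^sub>F j in sequentially. b j \<le> reg_energy s (\<mu> j) (\<mu> j)" using c[OF s] by blast
  have "(\<lambda>j. reg_energy s (\<mu> j) (\<mu> j)) \<longlonglongrightarrow> reg_energy s \<nu> \<nu>"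
    unfolding reg_energy_def by (rule tendsto_double_integral_kernel[OF continuous_reg_kernel[OF s] C \<mu>])
  from tendsto_le[OF _ this b] show "c \<le> reg_energy s \<nu> \<nu>" by simp
qed

lemma log_energy_usc':
  assumes C: "compact C" and \<mu>: "\<And>j. \<mu> j \<in> borel_probs_on C" "\<nu> \<in> borel_probs_on C" "bounded_weak_conv \<mu> \<nu>"
    and c: "b \<longlonglongrightarrow> c" "\<forall>\<^sub>F j in sequentially. ereal (b j) \<le> log_energy (\<mu> j)"
  shows "ereal c \<le> log_energy \<nu>"
proof (rule log_energy_usc[OF C \<mu>])
  fix s :: real assume s: "0 < s"
  have "\<forall>\<^sub>F j in sequentially. b j \<le> reg_energy s (\<mu> j) (\<mu> j)"
    using c(2) by eventually_elim (use log_energy_le_reg_energy[OF \<mu>(1) C s] order_trans in fastforce)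
  then show "\<exists>b. b \<longlonglongrightarrow> c \<and> (\<forall>\<^sub>F j in sequentially. b j \<le> reg_energy s (\<mu> j) (\<mu> j))" using c by blast
qed

text \<open>The Bochner version of \<open>log_potential\<close>. It is meaningful off the support,
  and almost everywhere for a measure of finite energy; elsewhere \<open>ln 0 = 0\<close> and the
  default value of the integral may interfere.\<close>

definition potential :: "complex measure \<Rightarrow> complex \<Rightarrow> real" where
  "potential \<mu> z = (\<integral>w. ln (cmod (z - w)) \<partial>\<mu>)"

lemma continuous_trunc_log:
  assumes "d > 0" shows "continuous_on UNIV (\<lambda>(z, w). ln (max d (cmod (z - w))))"
  unfolding case_prod_unfold using assms by (intro continuous_intros) (auto simp: max_def)

text \<open>Truncating the logarithm at the distance to the support gives an integrand continuous on
  the whole plane, hence a legitimate test function for weak convergence.\<close>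

lemma potential_eq_trunc:
  assumes \<mu>: "\<mu> \<in> borel_probs_on C" "closed C" and d: "\<And>w. w \<in> C \<Longrightarrow> d \<le> cmod (z - w)"
  shows "potential \<mu> z = (\<integral>w. ln (max d (cmod (z - w))) \<partial>\<mu>)"
  unfolding potential_def
proof (rule integral_cong_AE)
  note D = borel_probs_onD[OF \<mu>]
  show "(\<lambda>w. ln (cmod (z - w))) \<in> borel_measurable \<mu>" "(\<lambda>w. ln (max d (cmod (z - w)))) \<in> borel_measurable \<mu>"
    by (simp_all add: measurable_cong_sets[OF D(1) refl])
  show "AE w in \<mu>. ln (cmod (z - w)) = ln (max d (cmod (z - w)))"
    using D(4) by eventually_elim (use d in \<open>simp add: max_absorb2\<close>)
qed

lemma log_potential_eq_potential:
  assumes \<mu>: "\<mu> \<in> borel_probs_on C" "compact C" and z: "z \<notin> C"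
  shows "log_potential \<mu> z = ereal (potential \<mu> z)"
proof -
  have cl: "closed C" using \<mu> compact_imp_closed by auto
  obtain d where d: "d > 0" "\<And>w. w \<in> C \<Longrightarrow> d \<le> cmod (z - w)"
    using distance_to_closed[OF cl z] by blast
  \<comment> \<open>Off \<open>C\<close> the truncated kernel already equals the logarithm almost
    everywhere, so a constant sequence serves as the decreasing one.\<close>
  have "(\<lambda>j::nat. ereal (\<integral>w. ln (max d (cmod (z - w))) \<partial>\<mu>)) \<longlonglongrightarrow> log_potential \<mu> z"
    unfolding log_potential_def
  proof (rule ereal_integral_decreasing)
    show "integrable \<mu> (\<lambda>w. ln (max d (cmod (z - w))))"
      by (rule borel_probs_on_integrable[OF \<mu>]) (use continuous_on_section[OF continuous_trunc_log[OF d(1)]] in auto)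
    show "AE w in \<mu>. (\<lambda>j::nat. ereal (ln (max d (cmod (z - w))))) \<longlonglongrightarrow> ereal_ln (dist z w)"
      using borel_probs_onD(4)[OF \<mu>(1) cl]
    proof eventually_elim
      case (elim w)
      then show ?case using d by (force simp: ereal_ln_def dist_norm max_absorb2)
    qed
  qed (auto simp: decseq_def)
  then show ?thesis using potential_eq_trunc[OF \<mu>(1) cl d(2)] by (simp add: LIMSEQ_const_iff)
qed

text \<open>The map from an index set keeps multiplicities: the zeros of a polynomial are indexed by
  positions in a list, whereas finite point sets use the identity.\<close>

definition uniform_on :: "'a set \<Rightarrow> ('a \<Rightarrow> complex) \<Rightarrow> complex measure" where
  "uniform_on A f = distr (measure_pmf (pmf_of_set A)) borel f"

lemma uniform_on_integral:
  fixes h :: "complex \<Rightarrow> real"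
  assumes "finite A" "A \<noteq> {}" "continuous_on UNIV h"
  shows "(\<integral>z. h z \<partial>uniform_on A f) = (\<Sum>a\<in>A. h (f a)) / card A"
  unfolding uniform_on_def using assms
  by (subst integral_distr) (auto intro!: borel_measurable_continuous_onI simp: integral_pmf_of_set)

lemma uniform_on_borel_probs:
  assumes "finite A" "A \<noteq> {}" "f ` A \<subseteq> C" "closed C"
  shows "uniform_on A f \<in> borel_probs_on C"
proof (rule borel_probs_onI)
  show "prob_space (uniform_on A f)" unfolding uniform_on_def
    by (rule prob_space.prob_space_distr) (auto simp: measure_pmf.prob_space_axioms)
  show "AE z in uniform_on A f. z \<in> C" unfolding uniform_on_def
    using assms by (subst AE_distr_iff) (auto simp: AE_measure_pmf_iff)
qed (auto simp: uniform_on_def assms)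

subsection \<open>Existence and uniqueness of equilibrium measures\<close>

text \<open>The indicator of a closed set is a bounded pointwise limit of continuous functions of
  the distance to it, and closed sets form an intersection-stable generator of the Borel
  sets.\<close>

lemma measure_eqI_continuous:
  assumes \<mu>: "\<mu> \<in> borel_probs_on C" "\<nu> \<in> borel_probs_on C" "compact C"
    and eq: "\<And>f :: complex \<Rightarrow> real. continuous_on UNIV f \<Longrightarrow> (\<integral>z. f z \<partial>\<mu>) = (\<integral>z. f z \<partial>\<nu>)"
  shows "\<mu> = \<nu>"
proof (rule measure_eqI_generator_eq[where E = "Collect closed" and \<Omega> = UNIV and A = "\<lambda>_. UNIV"])
  note d = borel_probs_onD[OF \<mu>(1) compact_imp_closed[OF \<mu>(3)]] borel_probs_onD[OF \<mu>(2) compact_imp_closed[OF \<mu>(3)]]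
  interpret m: prob_space \<mu> by (rule d)
  interpret n: prob_space \<nu> by (rule d)
  have cl: "sets borel = sigma_sets UNIV (Collect (closed :: complex set \<Rightarrow> bool))"
    by (simp add: borel_eq_closed)
  show "sets \<mu> = sigma_sets UNIV (Collect closed)" "sets \<nu> = sigma_sets UNIV (Collect closed)"
    using d cl by simp_all
  show "Int_stable (Collect (closed :: complex set \<Rightarrow> bool))" by (auto simp: Int_stable_def)
  show "emeasure \<mu> UNIV \<noteq> \<infinity>" by simp
  fix F :: "complex set" assume "F \<in> Collect closed"
  then have F: "closed F" by simp
  show "emeasure \<mu> F = emeasure \<nu> F"
  proof (cases "F = {}")
    case False
    define f where "f n z = max 0 (1 - real n * infdist z F)" for n z
    have fc: "continuous_on UNIV (f n)" for n unfolding f_def by (intro continuous_intros)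
    have lim: "(\<lambda>n. f n z) \<longlonglongrightarrow> indicator F z" for z
    proof (cases "z \<in> F")
      case True then show ?thesis by (simp add: f_def)
    next
      case nz: False
      then have "infdist z F > 0" using F False infdist_nonneg[of z F] in_closed_iff_infdist_zero[OF F False, of z]
        by (simp add: less_le)
      then have "eventually (\<lambda>n. f n z = 0) sequentially" 
      proof -
        obtain N where "1 / infdist z F < real N" using reals_Archimedean2 by blast
        then have "\<forall>n\<ge>N. f n z = 0" using \<open>infdist z F > 0\<close>
          by (auto simp: f_def field_simps max_def) (smt (verit) mult_right_mono of_nat_mono)
        then show ?thesis by (auto simp: eventually_sequentially)
      qed
      then show ?thesis using nz by (simp add: tendsto_eventually)
    qed
    have gen: "(\<lambda>n. \<integral>z. f n z \<partial>M) \<longlonglongrightarrow> measure M F" if M: "prob_space M" "sets M = sets borel" for M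
    proof -
      interpret prob_space M by (rule M)
      have "(\<lambda>n. \<integral>z. f n z \<partial>M) \<longlonglongrightarrow> (\<integral>z. indicator F z \<partial>M)"
      proof (rule integral_dominated_convergence[where w = "\<lambda>_. 1"])
        show "(indicator F :: complex \<Rightarrow> real) \<in> borel_measurable M" using F M by (intro borel_measurable_indicator) auto
        show "f n \<in> borel_measurable M" for n
          using borel_measurable_continuous_onI[OF fc] by (simp add: measurable_cong_sets[OF M(2) refl])
        show "AE z in M. norm (f n z) \<le> 1" for n by (auto simp: f_def infdist_nonneg)
      qed (use lim in auto)
      then show ?thesis using F M by simp
    qed
    have "measure \<mu> F = measure \<nu> F"
      using gen[OF d(3,1)] gen[OF d(7,5)] eq[OF fc] by (auto intro: LIMSEQ_unique)
    then show ?thesis by (simp add: m.emeasure_eq_measure n.emeasure_eq_measure)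
  qed simp
qed auto

text \<open>The half sum is realized as the mixture of the two measures over a fair coin, and is
  described by its integrals because that is how it enters energies.\<close>

lemma midpoint_measure:
  assumes \<mu>: "\<mu> \<in> borel_probs_on C" "\<nu> \<in> borel_probs_on C" and C: "compact C"
  obtains \<kappa> where "\<kappa> \<in> borel_probs_on C"
    "\<And>f :: complex \<Rightarrow> real. continuous_on UNIV f \<Longrightarrow> (\<integral>z. f z \<partial>\<kappa>) = ((\<integral>z. f z \<partial>\<mu>) + (\<integral>z. f z \<partial>\<nu>)) / 2"
proof -
  note d = borel_probs_onD[OF \<mu>(1) compact_imp_closed[OF C]] borel_probs_onD[OF \<mu>(2) compact_imp_closed[OF C]]
  define M where "M = measure_pmf (bernoulli_pmf (1/2))"
  define N where "N b = (if b then \<mu> else \<nu>)" for b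
  define \<kappa> where "\<kappa> = M \<bind> N"
  have Np: "prob_space (N b)" "sets (N b) = sets borel" for b using d by (auto simp: N_def)
  have NM: "N \<in> measurable M (subprob_algebra borel)"
    unfolding M_def using Np by (auto simp: space_subprob_algebra prob_space_imp_subprob_space)
  interpret M: prob_space M unfolding M_def by (rule prob_space_measure_pmf)
  have p: "prob_space \<kappa>" unfolding \<kappa>_def
    by (rule M.prob_space_bind[OF _ NM]) (use Np in simp)
  have s: "sets \<kappa> = sets borel" unfolding \<kappa>_def using sets_bind[of M N borel] Np(2) by (simp add: M_def)
  have ae: "AE z in \<kappa>. z \<in> C"
    unfolding \<kappa>_def
  proof (subst AE_bind[OF NM])
    have "C \<in> sets borel" using compact_imp_closed[OF C] by simp
    then show "Measurable.pred borel (\<lambda>z. z \<in> C)" by measurable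
    show "AE b in M. AE z in N b. z \<in> C"
    proof (rule AE_I2)
      show "AE z in N b. z \<in> C" for b using d(4,8) unfolding N_def by (cases b) simp_all
    qed
  qed
  have \<kappa>: "\<kappa> \<in> borel_probs_on C" by (rule borel_probs_onI[OF s p ae compact_imp_closed[OF C]])
  show thesis
  proof (rule that[OF \<kappa>])
    fix f :: "complex \<Rightarrow> real" assume f: "continuous_on UNIV f"
    have "compact (f ` C)" by (intro compact_continuous_image C continuous_on_subset[OF f]) auto
    then obtain B where B: "\<And>z. z \<in> C \<Longrightarrow> norm (f z) \<le> B"
      using compact_imp_bounded[of "f ` C"] unfolding bounded_iff by auto
    \<comment> \<open>The integral formula for mixtures wants a globally bounded integrand. Clamping
      \<open>f\<close> at its bound on \<open>C\<close> alters none of the integrals.\<close>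
    define h where "h z = max (-\<bar>B\<bar>) (min \<bar>B\<bar> (f z))" for z
    have h: "continuous_on UNIV h" unfolding h_def using f by (intro continuous_intros)
    have fh: "(\<integral>z. f z \<partial>\<theta>) = (\<integral>z. h z \<partial>\<theta>)" if "\<theta> \<in> borel_probs_on C" for \<theta>
    proof -
      have "\<bar>(\<integral>z. f z \<partial>\<theta>) - (\<integral>z. h z \<partial>\<theta>)\<bar> \<le> 0"
        by (rule borel_probs_on_integral_diff[OF that C f h]) (use B in \<open>force simp: h_def\<close>)
      then show ?thesis by simp
    qed
    have "(\<integral>z. h z \<partial>\<kappa>) = (\<integral>b. \<integral>z. h z \<partial>N b \<partial>M)" unfolding \<kappa>_def
    proof (rule integral_bind[where K = borel and B = "\<bar>B\<bar>" and B' = 1])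
      show "h \<in> borel_measurable borel" using h by (simp add: borel_measurable_continuous_onI)
      show "finite_measure M" unfolding M_def by (rule measure_pmf.finite_measure)
      show "AE x in M. emeasure (N x) (space (N x)) \<le> ennreal 1"
        using prob_space.emeasure_space_1[OF Np(1)] by simp
    qed (auto simp: h_def NM)
    also have "\<dots> = ((\<integral>z. h z \<partial>\<mu>) + (\<integral>z. h z \<partial>\<nu>)) / 2"
      unfolding M_def by (subst integral_bernoulli_pmf) (auto simp: N_def field_simps)
    finally show "(\<integral>z. f z \<partial>\<kappa>) = ((\<integral>z. f z \<partial>\<mu>) + (\<integral>z. f z \<partial>\<nu>)) / 2"
      using fh[OF \<kappa>] fh[OF \<mu>(1)] fh[OF \<mu>(2)] by simp
  qed
qed

text \<open>Stereographic projection: the chordal metric satisfies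
  \<open>|z - w|\<^sup>2 = (1 + |z|\<^sup>2) (1 + |w|\<^sup>2) (1 - P z \<bullet> P w) / 2\<close>, so up to terms depending on
  one variable only, \<open>- ln |z - w|\<close> is the power series \<open>\<Sum> (P z \<bullet> P w)\<^sup>n / (2 n)\<close>
  with nonnegative coefficients. This makes minus the energy positive definite.\<close>

definition sph :: "nat \<Rightarrow> complex \<Rightarrow> real" where
  "sph i z = (if i = 0 then 2 * Re z else if i = 1 then 2 * Im z else (cmod z)\<^sup>2 - 1) / (1 + (cmod z)\<^sup>2)"

definition sph_dot :: "complex \<Rightarrow> complex \<Rightarrow> real" where
  "sph_dot z w = (\<Sum>i<3. sph i z * sph i w)"

definition sph_monom :: "nat \<Rightarrow> (nat \<Rightarrow> nat) \<Rightarrow> complex \<Rightarrow> real" where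
  "sph_monom n g z = (\<Prod>k<n. sph (g k) z)"

lemma one_plus_sq_pos: "1 + (cmod z)\<^sup>2 > 0"
  by (rule add_pos_nonneg) auto

lemma continuous_sph: "continuous_on UNIV (sph i)"
  unfolding sph_def using one_plus_sq_pos
  by (cases "i = 0"; cases "i = 1") (auto intro!: continuous_intros simp: less_imp_neq[symmetric])

lemma continuous_sph_monom: "continuous_on UNIV (sph_monom n g)"
  unfolding sph_monom_def by (intro continuous_intros continuous_sph)

text \<open>The first identity is the chordal distance to \<open>w\<close>, the second the one to
  its antipode. Nonnegativity of both right-hand sides confines \<open>sph_dot\<close> to
  [-1, 1].\<close>

lemma sph_dot_eq: 
  "(1 + (cmod z)\<^sup>2) * (1 + (cmod w)\<^sup>2) * (1 - sph_dot z w) = 2 * (cmod (z - w))\<^sup>2"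
  "(1 + (cmod z)\<^sup>2) * (1 + (cmod w)\<^sup>2) * (1 + sph_dot z w) = 2 * (cmod (1 + z * cnj w))\<^sup>2"
proof -
  define A B where "A = 1 + (cmod z)\<^sup>2" and "B = 1 + (cmod w)\<^sup>2"
  have AB: "A > 0" "B > 0" unfolding A_def B_def by (rule one_plus_sq_pos)+
  have "sph_dot z w = (4 * Re z * Re w + 4 * Im z * Im w + (A - 2) * (B - 2)) / (A * B)"
    using AB by (simp add: sph_dot_def sph_def numeral_3_eq_3 A_def B_def add_divide_distrib)
  then have *: "A * B * sph_dot z w = 4 * Re z * Re w + 4 * Im z * Im w + (A - 2) * (B - 2)"
    using AB by simp
  have "A * B * (1 - sph_dot z w) = 2 * (cmod (z - w))\<^sup>2"
    unfolding right_diff_distrib * unfolding A_def B_def cmod_power2 by (simp add: power2_eq_square algebra_simps)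
  moreover have "A * B * (1 + sph_dot z w) = 2 * (cmod (1 + z * cnj w))\<^sup>2"
    unfolding distrib_left * unfolding A_def B_def cmod_power2 by (simp add: power2_eq_square algebra_simps)
  ultimately show "(1 + (cmod z)\<^sup>2) * (1 + (cmod w)\<^sup>2) * (1 - sph_dot z w) = 2 * (cmod (z - w))\<^sup>2"
    "(1 + (cmod z)\<^sup>2) * (1 + (cmod w)\<^sup>2) * (1 + sph_dot z w) = 2 * (cmod (1 + z * cnj w))\<^sup>2"
    by (simp_all add: A_def B_def)
qed

lemma abs_sph_dot: "\<bar>sph_dot z w\<bar> \<le> 1"
proof -
  define T where "T = (1 + (cmod z)\<^sup>2) * (1 + (cmod w)\<^sup>2)"
  have T: "T > 0" unfolding T_def by (intro mult_pos_pos one_plus_sq_pos)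
  have "T * (1 - sph_dot z w) \<ge> 0" "T * (1 + sph_dot z w) \<ge> 0" unfolding T_def sph_dot_eq by auto
  then show ?thesis using T by (simp add: zero_le_mult_iff)
qed

text \<open>The weight in the regularization is exactly what turns \<open>s\<close> into a damping
  factor \<open>1 / (1 + 2 * s)\<close> on \<open>sph_dot\<close>. The factor is below 1, so the
  logarithmic series converges uniformly.\<close>

lemma reg_kernel_sph:
  assumes "s > 0"
  shows "reg_kernel s z w = (ln (1 + (cmod z)\<^sup>2) + ln (1 + (cmod w)\<^sup>2) + ln (1/2 + s)) / 2
    + ln (1 - 1 / (1 + 2 * s) * sph_dot z w) / 2"
proof -
  define T where "T = (1 + (cmod z)\<^sup>2) * (1 + (cmod w)\<^sup>2)"
  have T: "T > 0" unfolding T_def by (intro mult_pos_pos one_plus_sq_pos)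
  have lt: "\<bar>1 / (1 + 2 * s) * sph_dot z w\<bar> < 1"
    using abs_sph_dot[of z w] assms by (simp add: abs_mult field_simps)
  have "(cmod (z - w))\<^sup>2 + s * T = T * (1 - sph_dot z w) / 2 + s * T"
    unfolding T_def sph_dot_eq by simp
  also have "\<dots> = T * ((1/2 + s) * (1 - 1 / (1 + 2 * s) * sph_dot z w))"
    using assms by (simp add: field_simps)
  finally have "ln ((cmod (z - w))\<^sup>2 + s * T) = ln T + (ln (1/2 + s) + ln (1 - 1 / (1 + 2 * s) * sph_dot z w))"
    using T assms lt by (simp add: ln_mult_pos)
  moreover have "ln T = ln (1 + (cmod z)\<^sup>2) + ln (1 + (cmod w)\<^sup>2)"
    unfolding T_def by (intro ln_mult_pos one_plus_sq_pos)
  ultimately show ?thesis by (simp add: reg_kernel_def T_def mult.assoc)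
qed

text \<open>A power of an inner product is the inner product of tensor powers;
  \<open>sph_monom\<close> runs through their coordinates, indexed by words over three
  letters.\<close>

lemma sph_dot_power:
  "sph_dot z w ^ n = (\<Sum>g\<in>{..<n} \<rightarrow>\<^sub>E {..<3}. sph_monom n g z * sph_monom n g w)"
proof -
  have "sph_dot z w ^ n = (\<Prod>k<n. \<Sum>i<3. sph i z * sph i w)" by (simp add: sph_dot_def)
  also have "\<dots> = (\<Sum>g\<in>{..<n} \<rightarrow>\<^sub>E {..<3}. \<Prod>k<n. sph (g k) z * sph (g k) w)"
    by (rule prod_sum_PiE) auto
  finally show ?thesis by (simp add: sph_monom_def prod.distrib)
qed

text \<open>The integral of \<open>sph_dot z w ^ n\<close> in both variables, written through
  moments. Bilinearity then turns the form evaluated at a difference of measures into a sum of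
  squares.\<close>

definition sph_moment :: "nat \<Rightarrow> complex measure \<Rightarrow> complex measure \<Rightarrow> real" where
  "sph_moment n \<mu> \<nu> = (\<Sum>g\<in>{..<n} \<rightarrow>\<^sub>E {..<3}. (\<integral>z. sph_monom n g z \<partial>\<mu>) * (\<integral>z. sph_monom n g z \<partial>\<nu>))"

text \<open>The logarithmic series is integrated term by term, with a geometric majorant that does
  not depend on the points. The one-variable terms of the kernel become the two integrals of
  \<open>ln (1 + (cmod z)\<^sup>2)\<close>.\<close>

lemma reg_energy_sums:
  assumes \<mu>: "\<mu> \<in> borel_probs_on C" "\<nu> \<in> borel_probs_on C" and C: "compact C" and s: "s > 0"
  shows "(\<lambda>n. (1 / (1 + 2 * s)) ^ n / n * sph_moment n \<mu> \<nu>) sums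
    ((\<integral>z. ln (1 + (cmod z)\<^sup>2) \<partial>\<mu>) + (\<integral>z. ln (1 + (cmod z)\<^sup>2) \<partial>\<nu>) + ln (1/2 + s) - 2 * reg_energy s \<mu> \<nu>)"
proof -
  define \<theta> where "\<theta> = 1 / (1 + 2 * s)"
  have \<theta>: "0 < \<theta>" "\<theta> < 1" using s by (auto simp: \<theta>_def)
  interpret m: prob_space \<mu> using \<mu> by (simp add: borel_probs_on_def)
  interpret n: prob_space \<nu> using \<mu> by (simp add: borel_probs_on_def)
  define L where "L z = ln (1 + (cmod z)\<^sup>2)" for z
  have L: "continuous_on UNIV L" unfolding L_def
    by (intro continuous_on_ln continuous_intros ballI less_imp_neq[OF one_plus_sq_pos, symmetric])
  define c where "c = ln (1/2 + s)"
  define S where "S N z w = (L z + L w + c) / 2 - (\<Sum>n<N. \<theta> ^ n / n * (\<Sum>g\<in>{..<n} \<rightarrow>\<^sub>E {..<3}. sph_monom n g z * sph_monom n g w)) / 2" for N z w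
  have Lint: "integrable \<mu> L" "integrable \<nu> L"
    by (auto intro!: borel_probs_on_integrable[OF _ C L] \<mu>)
  have mint: "integrable \<mu> (sph_monom n g)" "integrable \<nu> (sph_monom n g)" for n g
    by (auto intro!: borel_probs_on_integrable[OF _ C continuous_sph_monom] \<mu>)
  have Sc: "continuous_on UNIV (\<lambda>(z, w). S N z w)" for N
    unfolding S_def case_prod_unfold
    by (intro continuous_intros continuous_on_compose2[OF L] continuous_on_compose2[OF continuous_sph_monom]) auto
  have SI: "(\<integral>z. \<integral>w. S N z w \<partial>\<nu> \<partial>\<mu>) = ((\<integral>z. L z \<partial>\<mu>) + (\<integral>z. L z \<partial>\<nu>) + c) / 2 - (\<Sum>n<N. \<theta> ^ n / n * sph_moment n \<mu> \<nu>) / 2" for N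
  proof -
    have "(\<integral>w. S N z w \<partial>\<nu>) = (L z + (\<integral>w. L w \<partial>\<nu>) + c) / 2 - (\<Sum>n<N. \<theta> ^ n / n * (\<Sum>g\<in>{..<n} \<rightarrow>\<^sub>E {..<3}. sph_monom n g z * (\<integral>w. sph_monom n g w \<partial>\<nu>))) / 2" for z
      unfolding S_def using Lint mint by (simp add: n.prob_space)
    then show ?thesis using Lint mint by (simp add: m.prob_space sph_moment_def)
  qed
  \<comment> \<open>The summand for \<open>n = 0\<close> is 0, since division by 0 yields 0; the
    series effectively starts at 1.\<close>
  define t where "t n z w = - ((- (- \<theta> * sph_dot z w)) ^ n) / real n" for n z w
  have ul: "uniform_limit UNIV (\<lambda>N p. \<Sum>n<N. t n (fst p) (snd p)) 
     (\<lambda>p. \<Sum>n. t n (fst p) (snd p)) sequentially"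
  proof (rule Weierstrass_m_test)
    fix n :: nat and p
    have "\<bar>\<theta> * sph_dot (fst p) (snd p)\<bar> \<le> \<theta> * 1"
      unfolding abs_mult using \<theta> abs_sph_dot by (intro mult_mono) auto
    then have "\<bar>\<theta> * sph_dot (fst p) (snd p)\<bar> ^ n \<le> \<theta> ^ n" by (intro power_mono) auto
    moreover have "\<theta> ^ n / n \<le> \<theta> ^ n" using \<theta> by (cases n) (auto simp: field_simps)
    moreover have "norm (t n (fst p) (snd p)) = \<bar>\<theta> * sph_dot (fst p) (snd p)\<bar> ^ n / n"
      by (simp add: t_def power_abs)
    ultimately show "norm (t n (fst p) (snd p)) \<le> \<theta> ^ n"
      using divide_right_mono[of "\<bar>\<theta> * sph_dot (fst p) (snd p)\<bar> ^ n" "\<theta> ^ n" "real n"] by linarith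
  next
    show "summable (\<lambda>n. \<theta> ^ n)" using \<theta> by (intro summable_geometric) auto
  qed
  have lnser: "(\<Sum>n. t n z w) = ln (1 - \<theta> * sph_dot z w)" for z w
  proof -
    have "\<bar>- \<theta> * sph_dot z w\<bar> < 1"
      using abs_sph_dot[of z w] \<theta> by (simp add: abs_mult) (smt (verit) mult_left_le)
    from sums_unique[OF ln_series'[OF this]] show ?thesis by (simp add: t_def)
  qed
  have eqS: "S N z w = (L z + L w + c) / 2 + (\<Sum>n<N. t n z w) / 2" for N z w
    unfolding S_def sph_dot_power[symmetric] t_def by (simp add: power_mult_distrib sum_negf)
  have eqR: "reg_kernel s z w = (L z + L w + c) / 2 + (\<Sum>n. t n z w) / 2" for z w
    unfolding reg_kernel_sph[OF s] lnser by (simp add: L_def c_def \<theta>_def)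
  have "(\<lambda>N. \<integral>z. \<integral>w. S N z w \<partial>\<nu> \<partial>\<mu>) \<longlonglongrightarrow> reg_energy s \<mu> \<nu>"
  proof (rule tendstoI)
    fix e :: real assume e: "e > 0"
    then have "\<forall>\<^sub>F N in sequentially. \<forall>p\<in>UNIV. dist (\<Sum>n<N. t n (fst p) (snd p))
       (\<Sum>n. t n (fst p) (snd p)) < e"
      using ul unfolding uniform_limit_iff by blast
    then show "\<forall>\<^sub>F N in sequentially. dist (\<integral>z. \<integral>w. S N z w \<partial>\<nu> \<partial>\<mu>) (reg_energy s \<mu> \<nu>) < e"
    proof eventually_elim
      case (elim N)
      have b: "\<bar>S N z w - reg_kernel s z w\<bar> \<le> e / 2" for z w
      proof -
        have *: "\<bar>(x + a / 2) - (x + b / 2)\<bar> \<le> e / 2" if "\<bar>a - b\<bar> < e" for x a b :: real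
          using that by linarith
        show ?thesis unfolding eqS eqR
          by (rule *) (use elim[THEN bspec, of "(z, w)", OF UNIV_I] in \<open>simp only: dist_real_def fst_conv snd_conv\<close>)
      qed
      have "\<bar>(\<integral>z. \<integral>w. S N z w \<partial>\<nu> \<partial>\<mu>) - reg_energy s \<mu> \<nu>\<bar> \<le> e / 2"
        unfolding reg_energy_def
        by (intro borel_probs_on_integral_diff[OF \<mu>(1) C] borel_probs_on_integral_diff[OF \<mu>(2) C] b
          continuous_on_integral_kernel[OF Sc \<mu>(2) C] continuous_on_integral_kernel[OF continuous_reg_kernel[OF s] \<mu>(2) C]
          continuous_on_section[OF Sc] continuous_on_section[OF continuous_reg_kernel[OF s]])
      then show ?case using e by (simp add: dist_real_def)
    qed
  qed
  then have "(\<lambda>N. (\<integral>z. L z \<partial>\<mu>) + (\<integral>z. L z \<partial>\<nu>) + c - 2 * (\<integral>z. \<integral>w. S N z w \<partial>\<nu> \<partial>\<mu>)) \<longlonglongrightarrow> 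
     (\<integral>z. L z \<partial>\<mu>) + (\<integral>z. L z \<partial>\<nu>) + c - 2 * reg_energy s \<mu> \<nu>"
    by (intro tendsto_intros)
  moreover have "(\<integral>z. L z \<partial>\<mu>) + (\<integral>z. L z \<partial>\<nu>) + c - 2 * (\<integral>z. \<integral>w. S N z w \<partial>\<nu> \<partial>\<mu>)
    = (\<Sum>n<N. \<theta> ^ n / n * sph_moment n \<mu> \<nu>)" for N unfolding SI by (simp add: field_simps)
  ultimately have "(\<lambda>n. \<theta> ^ n / n * sph_moment n \<mu> \<nu>) sums ((\<integral>z. L z \<partial>\<mu>) + (\<integral>z. L z \<partial>\<nu>) + c - 2 * reg_energy s \<mu> \<nu>)"
    by (simp add: sums_def)
  then show ?thesis unfolding L_def[abs_def] c_def \<theta>_def .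
qed

text \<open>The algebra generated by the spherical coordinates, to which Stone-Weierstrass is
  applied. Products are introduced one coordinate at a time, which matches the extension of a word
  in \<open>sph_monom\<close> by one letter.\<close>

inductive_set sph_ring :: "(complex \<Rightarrow> real) set" where
  const: "(\<lambda>_. c) \<in> sph_ring"
| add: "f \<in> sph_ring \<Longrightarrow> h \<in> sph_ring \<Longrightarrow> (\<lambda>z. f z + h z) \<in> sph_ring"
| mult_sph: "f \<in> sph_ring \<Longrightarrow> i < 3 \<Longrightarrow> (\<lambda>z. sph i z * f z) \<in> sph_ring"

lemma sph_ring_continuous: "f \<in> sph_ring \<Longrightarrow> continuous_on UNIV f"
  by (induction rule: sph_ring.induct) (auto intro!: continuous_intros continuous_sph)

lemma sph_ring_mult: 
  assumes "f \<in> sph_ring" "h \<in> sph_ring" shows "(\<lambda>z. f z * h z) \<in> sph_ring"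
  using assms(1)
proof (induction rule: sph_ring.induct)
  case (const c)
  show ?case using assms(2)
  proof (induction rule: sph_ring.induct)
    case (mult_sph f i)
    then show ?case using sph_ring.mult_sph[of "\<lambda>z. c * f z" i] by (simp add: mult.left_commute)
  qed (auto simp: distrib_left intro: sph_ring.intros)
next
  case (add f h)
  then show ?case by (simp add: distrib_right sph_ring.add)
next
  case (mult_sph f i)
  then show ?case using sph_ring.mult_sph by (simp add: mult.assoc)
qed

lemma sph_inj:
  assumes "\<And>i. i < 3 \<Longrightarrow> sph i z = sph i w" shows "z = w"
proof -
  have "sph_dot z w = sph_dot w w" unfolding sph_dot_def using assms by simp
  also have "\<dots> = 1" using sph_dot_eq(1)[of w w] one_plus_sq_pos[of w] by simp
  finally show ?thesis using sph_dot_eq(1)[of z w] by simp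
qed

lemma sph_monoms_determine:
  assumes \<mu>: "\<mu> \<in> borel_probs_on C" "\<nu> \<in> borel_probs_on C" and C: "compact C"
    and eq: "\<And>n g. (\<And>k. k < n \<Longrightarrow> g k < 3) \<Longrightarrow> (\<integral>z. sph_monom n g z \<partial>\<mu>) = (\<integral>z. sph_monom n g z \<partial>\<nu>)"
  shows "\<mu> = \<nu>"
proof (rule measure_eqI_continuous[OF \<mu> C])
  fix f :: "complex \<Rightarrow> real" assume f: "continuous_on UNIV f"
  note int = borel_probs_on_integrable[OF \<mu>(1) C] borel_probs_on_integrable[OF \<mu>(2) C]
  \<comment> \<open>The claim is strengthened by a monomial factor, so that in the induction a new
    coordinate can be absorbed into the monomial.\<close>
  have R: "(\<integral>z. h z * sph_monom n g z \<partial>\<mu>) = (\<integral>z. h z * sph_monom n g z \<partial>\<nu>)"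
    if "h \<in> sph_ring" "\<And>k. k < n \<Longrightarrow> g k < 3" for h n g
    using that
  proof (induction arbitrary: n g rule: sph_ring.induct)
    case (const c)
    then show ?case using eq by simp
  next
    case (add f h)
    have "integrable \<mu> (\<lambda>z. f z * sph_monom n g z)" "integrable \<nu> (\<lambda>z. f z * sph_monom n g z)" if "f \<in> sph_ring" for f
      using sph_ring_continuous[OF that] by (intro int continuous_on_mult continuous_sph_monom; assumption)+
    then show ?case using add by (simp add: distrib_right)
  next
    case (mult_sph f i)
    define g' where "g' = g(n := i)"
    have "sph_monom (Suc n) g' z = sph i z * sph_monom n g z" for z
      unfolding sph_monom_def g'_def by (simp add: mult.commute)
    moreover have "(\<integral>z. f z * sph_monom (Suc n) g' z \<partial>\<mu>) = (\<integral>z. f z * sph_monom (Suc n) g' z \<partial>\<nu>)"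
      by (rule mult_sph.IH) (use mult_sph in \<open>auto simp: g'_def less_Suc_eq\<close>)
    ultimately show ?case by (simp add: ac_simps)
  qed
  have R0: "(\<integral>z. h z \<partial>\<mu>) = (\<integral>z. h z \<partial>\<nu>)" if "h \<in> sph_ring" for h
    using R[OF that, of 0] by (simp add: sph_monom_def)
  interpret function_ring_on sph_ring C
  proof
    show "\<exists>f\<in>sph_ring. f z \<noteq> f w" if "z \<noteq> w" for z w
    proof -
      obtain i where "i < 3" "sph i z \<noteq> sph i w" using sph_inj[of z w] \<open>z \<noteq> w\<close> by blast
      moreover have "sph i \<in> sph_ring" using sph_ring.mult_sph[OF sph_ring.const[of 1] \<open>i < 3\<close>] by simp
      ultimately show ?thesis by blast
    qed
  qed (auto intro: C sph_ring.intros sph_ring_mult continuous_on_subset[OF sph_ring_continuous])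
  have "\<bar>(\<integral>z. f z \<partial>\<mu>) - (\<integral>z. f z \<partial>\<nu>)\<bar> \<le> 0 + e" if e: "e > 0" for e
  proof -
    obtain h where h: "h \<in> sph_ring" "\<forall>z\<in>C. \<bar>f z - h z\<bar> < e/2"
      using Stone_Weierstrass_basic[OF continuous_on_subset[OF f], of "e/2"] e by auto
    have "\<bar>(\<integral>z. f z \<partial>\<mu>) - (\<integral>z. h z \<partial>\<mu>)\<bar> \<le> e/2" "\<bar>(\<integral>z. f z \<partial>\<nu>) - (\<integral>z. h z \<partial>\<nu>)\<bar> \<le> e/2"
      using h(2) by (intro borel_probs_on_integral_diff[OF _ C f sph_ring_continuous[OF h(1)]] \<mu> less_imp_le; blast)+
    then show ?thesis using R0[OF h(1)] by linarith
  qed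
  then have "\<bar>(\<integral>z. f z \<partial>\<mu>) - (\<integral>z. f z \<partial>\<nu>)\<bar> \<le> 0" by (rule field_le_epsilon)
  then show "(\<integral>z. f z \<partial>\<mu>) = (\<integral>z. f z \<partial>\<nu>)" by simp
qed

definition maximizes_energy :: "complex set \<Rightarrow> complex measure \<Rightarrow> bool" where
  "maximizes_energy C \<mu> \<longleftrightarrow> \<mu> \<in> borel_probs_on C \<and> (\<forall>\<nu> \<in> borel_probs_on C. log_energy \<nu> \<le> log_energy \<mu>)"

text \<open>By the parallelogram identity the energy of the midpoint exceeds the mean of the two
  energies by a positive definite form in the difference of the measures. Maximality makes the form
  vanish, so all spherical moments agree.\<close>

lemma maximizes_energy_unique:
  assumes C: "compact C" and \<mu>: "maximizes_energy C \<mu>" and \<nu>: "maximizes_energy C \<nu>" 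
    and fin: "log_energy \<mu> \<noteq> -\<infinity>"
  shows "\<mu> = \<nu>"
proof -
  have m: "\<mu> \<in> borel_probs_on C" "\<nu> \<in> borel_probs_on C" using \<mu> \<nu> by (auto simp: maximizes_energy_def)
  obtain I where I: "log_energy \<mu> = ereal I"
    using fin log_energy_not_PInf[OF m(1) C] by (cases "log_energy \<mu>") auto
  have I': "log_energy \<nu> = ereal I" using \<mu> \<nu> m I by (auto simp: maximizes_energy_def intro!: antisym)
  obtain \<kappa> where \<kappa>: "\<kappa> \<in> borel_probs_on C" and K:
    "\<And>f :: complex \<Rightarrow> real. continuous_on UNIV f \<Longrightarrow> (\<integral>z. f z \<partial>\<kappa>) = ((\<integral>z. f z \<partial>\<mu>) + (\<integral>z. f z \<partial>\<nu>)) / 2"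
    using midpoint_measure[OF m C] by metis
  have \<kappa>I: "log_energy \<kappa> \<le> ereal I" using \<mu> \<kappa> I by (simp add: maximizes_energy_def)
  define Q where "Q n = sph_moment n \<mu> \<mu> + sph_moment n \<nu> \<nu> - 2 * sph_moment n \<mu> \<nu>" for n
  have Q: "Q n = (\<Sum>g\<in>{..<n} \<rightarrow>\<^sub>E {..<3}. ((\<integral>z. sph_monom n g z \<partial>\<mu>) - (\<integral>z. sph_monom n g z \<partial>\<nu>))\<^sup>2)" for n
    unfolding Q_def sph_moment_def sum.distrib[symmetric] sum_distrib_left sum_subtractf[symmetric]
    by (intro sum.cong refl) (simp add: power2_eq_square algebra_simps)
  have Q0: "Q n \<ge> 0" for n unfolding Q by (intro sum_nonneg) auto
  define D where "D s = reg_energy s \<mu> \<mu> + reg_energy s \<nu> \<nu> - 2 * reg_energy s \<mu> \<nu>" for s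
  \<comment> \<open>Symmetry of the mixed energy is read off from the moment series, which is
    visibly symmetric; this replaces an exchange of integrals.\<close>
  have comm: "reg_energy s \<nu> \<mu> = reg_energy s \<mu> \<nu>" if s: "s > 0" for s
  proof -
    have "sph_moment n \<nu> \<mu> = sph_moment n \<mu> \<nu>" for n by (simp add: sph_moment_def mult.commute)
    then have "(\<lambda>n. (1 / (1 + 2 * s)) ^ n / n * sph_moment n \<mu> \<nu>) sums
      ((\<integral>z. ln (1 + (cmod z)\<^sup>2) \<partial>\<nu>) + (\<integral>z. ln (1 + (cmod z)\<^sup>2) \<partial>\<mu>) + ln (1/2 + s) - 2 * reg_energy s \<nu> \<mu>)"
      using reg_energy_sums[OF m(2,1) C s] by simp
    from sums_unique2[OF reg_energy_sums[OF m C s] this] show ?thesis by simp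
  qed
  have Dsum: "(\<lambda>n. (1 / (1 + 2 * s)) ^ n / n * Q n) sums (- 2 * D s)" if s: "s > 0" for s
    using sums_diff[OF sums_add[OF reg_energy_sums[OF m(1,1) C s] reg_energy_sums[OF m(2,2) C s]] 
       sums_mult[OF reg_energy_sums[OF m C s], of 2]]
    by (simp add: Q_def D_def algebra_simps add_divide_distrib diff_divide_distrib)
  have \<kappa>E: "reg_energy s \<kappa> \<kappa> = (reg_energy s \<mu> \<mu> + reg_energy s \<nu> \<nu>) / 2 - D s / 4" if s: "s > 0" for s
  proof -
    note c = continuous_on_integral_kernel[OF continuous_reg_kernel[OF s] _ C]
    have i: "integrable \<theta> (\<lambda>z. \<integral>w. reg_kernel s z w \<partial>\<theta>')" if "\<theta> \<in> borel_probs_on C" "\<theta>' \<in> borel_probs_on C" for \<theta> \<theta>'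
      by (rule borel_probs_on_integrable[OF that(1) C c[OF that(2)]])
    have "reg_energy s \<kappa> \<kappa> = (\<integral>z. ((\<integral>w. reg_kernel s z w \<partial>\<mu>) + (\<integral>w. reg_kernel s z w \<partial>\<nu>)) / 2 \<partial>\<kappa>)"
      unfolding reg_energy_def by (simp only: K[OF continuous_on_section[OF continuous_reg_kernel[OF s]]])
    also have "\<dots> = (reg_energy s \<mu> \<mu> + reg_energy s \<mu> \<nu> + reg_energy s \<nu> \<mu> + reg_energy s \<nu> \<nu>) / 4"
      using m c by (subst K) (auto intro!: continuous_intros simp: reg_energy_def i add_divide_distrib)
    finally show ?thesis using comm[OF s] by (simp add: D_def field_simps)
  qed
  have Qz: "Q n = 0" if n: "n > 0" for n
  proof (rule ccontr)
    assume "Q n \<noteq> 0"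
    then have Qp: "Q n > 0" using Q0[of n] by simp
    \<comment> \<open>Here \<open>1/3\<close> is the least value of \<open>1 / (1 + 2 * s)\<close>
      for \<open>s \<le> 1\<close>, and 8 combines the 2 in \<open>- 2 * D s\<close> with the 4 in
      \<open>D s / 4\<close>. The gain thus does not depend on \<open>s\<close> and survives the
      limit.\<close>
    define \<delta> where "\<delta> = (1/3) ^ n / n * Q n / 8"
    have \<delta>: "\<delta> > 0" unfolding \<delta>_def using Qp n by simp
    have "I + \<delta> \<le> reg_energy s \<kappa> \<kappa>" if s: "0 < s" "s \<le> 1" for s
    proof -
      have "(1/3) ^ n / n * Q n \<le> (1 / (1 + 2 * s)) ^ n / n * Q n"
        using s Qp by (intro mult_right_mono divide_right_mono power_mono) (auto simp: field_simps)
      also have "\<dots> \<le> - 2 * D s"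
        using sums_unique[OF Dsum[OF s(1)]] sum_le_suminf[OF sums_summable[OF Dsum[OF s(1)]], of "{n}"] s Q0
        by (auto simp: zero_le_divide_iff)
      finally have "\<delta> \<le> - D s / 4" by (simp add: \<delta>_def)
      moreover have "I \<le> reg_energy s \<mu> \<mu>" "I \<le> reg_energy s \<nu> \<nu>"
        using log_energy_le_reg_energy[OF m(1) C s(1)] log_energy_le_reg_energy[OF m(2) C s(1)] I I' by auto
      moreover have "b \<le> (x + y) / 2 - d / 4" if "b = I + \<delta>" "\<delta> \<le> - d / 4" "I \<le> x" "I \<le> y" for b x y d :: real
        using that by argo
      ultimately show ?thesis unfolding \<kappa>E[OF s(1)] by blast
    qed
    then have "ereal (I + \<delta>) \<le> log_energy \<kappa>" by (intro log_energy_ge[OF \<kappa> C]) auto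
    then have "ereal (I + \<delta>) \<le> ereal I" using \<kappa>I by (rule order_trans)
    then show False using \<delta> by simp
  qed
  show ?thesis
  proof (rule sph_monoms_determine[OF m C])
    fix n :: nat and g :: "nat \<Rightarrow> nat" assume g: "\<And>k. k < n \<Longrightarrow> g k < 3"
    show "(\<integral>z. sph_monom n g z \<partial>\<mu>) = (\<integral>z. sph_monom n g z \<partial>\<nu>)"
    proof (cases "n = 0")
      case True
      interpret mp: prob_space \<mu> using m by (simp add: borel_probs_on_def)
      interpret np: prob_space \<nu> using m by (simp add: borel_probs_on_def)
      show ?thesis using True by (simp add: sph_monom_def mp.prob_space np.prob_space)
    next
      case False
      define g' where "g' = restrict g {..<n}"
      have g': "g' \<in> {..<n} \<rightarrow>\<^sub>E {..<3}" using g by (auto simp: g'_def)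
      have "Q n = 0" using Qz False by simp
      then have "\<forall>g\<in>{..<n} \<rightarrow>\<^sub>E {..<3}. ((\<integral>z. sph_monom n g z \<partial>\<mu>) - (\<integral>z. sph_monom n g z \<partial>\<nu>))\<^sup>2 = 0"
        unfolding Q by (subst (asm) sum_nonneg_eq_0_iff) (auto intro!: finite_PiE)
      then have "((\<integral>z. sph_monom n g' z \<partial>\<mu>) - (\<integral>z. sph_monom n g' z \<partial>\<nu>))\<^sup>2 = 0"
        using g' by blast
      moreover have "sph_monom n g' = sph_monom n g" by (auto simp: sph_monom_def g'_def)
      ultimately show ?thesis by simp
    qed
  qed
qed

text \<open>The direct method: a weak limit of a maximizing sequence is a maximizer by upper
  semicontinuity. If all energies are -infinity, any measure will do.\<close>

lemma maximizes_energy_exists: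
  assumes C: "compact C" and \<mu>: "\<mu> \<in> borel_probs_on C"
  shows "\<exists>\<nu>. maximizes_energy C \<nu>"
proof (cases "\<exists>\<mu> \<in> borel_probs_on C. log_energy \<mu> \<noteq> -\<infinity>")
  case False
  then show ?thesis using \<mu> by (intro exI[of _ \<mu>]) (auto simp: maximizes_energy_def)
next
  case True
  \<comment> \<open>Only real lower bounds are collected, so that the supremum is a real number;
    \<open>reg_kernel 1\<close> bounds it from above.\<close>
  define S where "S = {c. \<exists>\<mu> \<in> borel_probs_on C. ereal c \<le> log_energy \<mu>}"
  have ne: "C \<noteq> {}" using \<mu> by (auto simp: borel_probs_on_def)
  have Sne: "S \<noteq> {}"
  proof -
    obtain \<mu>0 where "\<mu>0 \<in> borel_probs_on C" "log_energy \<mu>0 \<noteq> -\<infinity>" using True by blast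
    moreover from this obtain a where "log_energy \<mu>0 = ereal a" using log_energy_not_PInf[OF _ C] by (cases "log_energy \<mu>0") auto
    ultimately have "a \<in> S" unfolding S_def by force
    then show ?thesis by blast
  qed
  have Sbd: "bdd_above S"
  proof -
    have "compact ((\<lambda>(z, w). reg_kernel 1 z w) ` (C \<times> C))"
      by (intro compact_continuous_image continuous_on_subset[OF continuous_reg_kernel] compact_Times C) auto
    then obtain B where B: "\<And>z w. z \<in> C \<Longrightarrow> w \<in> C \<Longrightarrow> \<bar>reg_kernel 1 z w\<bar> \<le> B"
      using compact_imp_bounded[of "(\<lambda>(z, w). reg_kernel 1 z w) ` (C \<times> C)"] unfolding bounded_iff by fastforce
    have "c \<le> B" if c: "c \<in> S" for c
    proof -
      obtain \<mu> where m: "\<mu> \<in> borel_probs_on C" "ereal c \<le> log_energy \<mu>" using c unfolding S_def by blast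
      interpret prob_space \<mu> using m by (simp add: borel_probs_on_def)
      have "ereal c \<le> ereal (reg_energy 1 \<mu> \<mu>)" using order_trans[OF m(2) log_energy_le_reg_energy[OF m(1) C, of 1]] by simp
      moreover have "reg_energy 1 \<mu> \<mu> \<le> (\<integral>z. \<integral>w. B \<partial>\<mu> \<partial>\<mu>)"
        unfolding reg_energy_def using B
        by (intro borel_probs_on_integral_le[OF m(1) C] continuous_on_integral_kernel[OF continuous_reg_kernel m(1) C]
           continuous_on_section[OF continuous_reg_kernel] continuous_on_const) (auto simp: abs_le_iff)
      ultimately show ?thesis by (simp add: prob_space)
    qed
    then show ?thesis by (rule bdd_aboveI)
  qed
  have "\<exists>\<mu> \<in> borel_probs_on C. ereal (Sup S - 1 / Suc j) \<le> log_energy \<mu>" for j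
  proof -
    obtain c where c: "c \<in> S" "Sup S - 1 / Suc j < c" using less_cSup_iff[OF Sne Sbd, of "Sup S - 1 / Suc j"] by auto
    from c(1) obtain \<theta> where \<theta>: "\<theta> \<in> borel_probs_on C" "ereal c \<le> log_energy \<theta>" unfolding S_def by blast
    have "ereal (Sup S - 1 / Suc j) \<le> ereal c" using c(2) by simp
    from order_trans[OF this \<theta>(2)] show ?thesis using \<theta>(1) by blast
  qed
  then have "\<forall>j. \<exists>\<mu>. \<mu> \<in> borel_probs_on C \<and> ereal (Sup S - 1 / Suc j) \<le> log_energy \<mu>" by blast
  from choice[OF this] obtain \<mu>' where \<mu>': "\<And>j. \<mu>' j \<in> borel_probs_on C" "\<And>j. ereal (Sup S - 1 / Suc j) \<le> log_energy (\<mu>' j)" by blast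
  obtain r \<nu> where r: "strict_mono (r :: nat \<Rightarrow> nat)" "\<nu> \<in> borel_probs_on C" "bounded_weak_conv (\<mu>' \<circ> r) \<nu>"
    by (rule weak_compactness[OF C ne \<mu>'(1)])
  have "(\<lambda>j. Sup S - 1 / Suc j) \<longlonglongrightarrow> Sup S - 0"
    by (rule tendsto_diff[OF tendsto_const LIMSEQ_Suc[OF lim_1_over_n]])
  then have "(\<lambda>j. Sup S - 1 / Suc (r j)) \<longlonglongrightarrow> Sup S"
    using LIMSEQ_subseq_LIMSEQ[OF _ r(1), of "\<lambda>j. Sup S - 1 / Suc j" "Sup S"] by (simp add: o_def)
  moreover have "\<forall>\<^sub>F j in sequentially. ereal (Sup S - 1 / Suc (r j)) \<le> log_energy ((\<mu>' \<circ> r) j)"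
    using \<mu>'(2) unfolding o_def by (intro always_eventually allI)
  ultimately have E: "ereal (Sup S) \<le> log_energy \<nu>"
    by (intro log_energy_usc'[OF C _ r(2,3)]) (simp_all add: \<mu>'(1))
  have "log_energy \<theta> \<le> log_energy \<nu>" if t: "\<theta> \<in> borel_probs_on C" for \<theta>
  proof (cases "log_energy \<theta>")
    case (real a)
    then have "a \<in> S" using t unfolding S_def by force
    then have "ereal a \<le> ereal (Sup S)" using cSup_upper[OF _ Sbd] by simp
    from order_trans[OF this E] show ?thesis using real by simp
  qed (use log_energy_not_PInf[OF t C] in auto)
  then show ?thesis using r by (auto simp: maximizes_energy_def)
qed

text \<open>A competitor of finite energy makes every maximizer finite. Existence and uniqueness
  then hold together, and the definite description denotes the maximizer.\<close>

lemma equilibrium_measure_maximizes: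
  assumes C: "compact C" and \<mu>: "\<mu> \<in> borel_probs_on C" "log_energy \<mu> \<noteq> -\<infinity>"
  shows "maximizes_energy C (equilibrium_measure C)" "log_energy \<mu> \<le> log_energy (equilibrium_measure C)"
proof -
  obtain \<nu> where \<nu>: "maximizes_energy C \<nu>" using maximizes_energy_exists[OF C \<mu>(1)] by blast
  have fin: "log_energy \<theta> \<noteq> -\<infinity>" if "maximizes_energy C \<theta>" for \<theta>
    using that \<mu> by (auto simp: maximizes_energy_def)
  have "equilibrium_measure C = (THE \<mu>. maximizes_energy C \<mu>)"
    by (simp add: equilibrium_measure_def maximizes_energy_def)
  also have "\<dots> = \<nu>" using maximizes_energy_unique[OF C _ \<nu> fin] \<nu> by blast
  finally show "maximizes_energy C (equilibrium_measure C)" using \<nu> by simp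
  then show "log_energy \<mu> \<le> log_energy (equilibrium_measure C)" using \<mu> by (simp add: maximizes_energy_def)
qed

lemma equilibrium_measure_eqI:
  assumes "compact C" "maximizes_energy C \<mu>" "log_energy \<mu> \<noteq> -\<infinity>"
  shows "\<mu> = equilibrium_measure C"
proof -
  have "\<mu> \<in> borel_probs_on C" using assms(2) by (simp add: maximizes_energy_def)
  then show ?thesis
    using maximizes_energy_unique[OF assms(1,2) equilibrium_measure_maximizes(1)[OF assms(1) _ assms(3)] assms(3)] by simp
qed

subsection \<open>Discrete configurations\<close>

text \<open>The energy is bounded by the regularized one with parameter
  \<open>\<tau>\<^sup>2\<close>. Its kernel is at most \<open>ln \<tau>\<close> plus a constant when
  both points lie in the small disc and at most a constant otherwise, so too much mass in the disc
  would push the energy below \<open>c\<close>.\<close>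

lemma measure_cball_bound:
  assumes C: "compact C" and \<mu>: "\<mu> \<in> borel_probs_on C" and R: "R > 0" "C \<subseteq> cball 0 R"
    and c: "ereal c \<le> log_energy \<mu>" and \<tau>: "0 < \<tau>" "\<tau> \<le> 1"
  shows "(measure \<mu> (cball \<zeta> \<tau>))\<^sup>2 * (ln (4 * R\<^sup>2 + (1 + R\<^sup>2)\<^sup>2) / 2 - (ln \<tau> + ln (4 + (1 + R\<^sup>2)\<^sup>2) / 2))
    \<le> ln (4 * R\<^sup>2 + (1 + R\<^sup>2)\<^sup>2) / 2 - c"
proof -
  note d = borel_probs_onD[OF \<mu> compact_imp_closed[OF C]]
  interpret prob_space \<mu> by (rule d)
  \<comment> \<open>\<open>B\<close> bounds the kernel on all of \<open>C\<close> by distances at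
    most \<open>2 * R\<close> and \<open>\<tau> \<le> 1\<close>. For two points of the disc the
    distance is at most \<open>2 * \<tau>\<close>, and factoring out \<open>\<tau>\<^sup>2\<close>
    gives \<open>b\<close>.\<close>
  define B where "B = ln (4 * R\<^sup>2 + (1 + R\<^sup>2)\<^sup>2) / 2"
  define b where "b = ln \<tau> + ln (4 + (1 + R\<^sup>2)\<^sup>2) / 2"
  define E where "E = cball \<zeta> \<tau>"
  define i where "i z = (indicator E z :: real)" for z
  have E: "E \<in> sets \<mu>" using d by (simp add: E_def)
  have AA: "(1 + (cmod z)\<^sup>2) * (1 + (cmod w)\<^sup>2) \<le> (1 + R\<^sup>2)\<^sup>2" if "z \<in> C" "w \<in> C" for z w
  proof -
    have "cmod z \<le> R" "cmod w \<le> R" using that R by auto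
    then have "(cmod z)\<^sup>2 \<le> R\<^sup>2" "(cmod w)\<^sup>2 \<le> R\<^sup>2" by (auto intro: power_mono)
    then show ?thesis unfolding power2_eq_square[of "1 + R\<^sup>2"] by (intro mult_mono) auto
  qed
  have s: "\<tau>\<^sup>2 > 0" using \<tau> by simp
  have kB: "reg_kernel (\<tau>\<^sup>2) z w \<le> B" if "z \<in> C" "w \<in> C" for z w
  proof -
    have "cmod z \<le> R" "cmod w \<le> R" using that R by auto
    then have "cmod (z - w) \<le> 2 * R" using norm_triangle_ineq4[of z w] by linarith
    then have "(cmod (z - w))\<^sup>2 \<le> 4 * R\<^sup>2" using power_mono[of "cmod (z - w)" "2 * R" 2] by (simp add: power_mult_distrib)
    moreover have "\<tau>\<^sup>2 * ((1 + (cmod z)\<^sup>2) * (1 + (cmod w)\<^sup>2)) \<le> 1 * (1 + R\<^sup>2)\<^sup>2"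
      using AA[OF that] \<tau> by (intro mult_mono) (auto simp: power_le_one)
    ultimately show ?thesis unfolding reg_kernel_def B_def
      using reg_kernel_arg_pos[OF s, of z w] by (intro divide_right_mono ln_mono) (auto simp: mult.assoc)
  qed
  have kb: "reg_kernel (\<tau>\<^sup>2) z w \<le> b" if "z \<in> C" "w \<in> C" "z \<in> E" "w \<in> E" for z w
  proof -
    have "dist z w \<le> dist \<zeta> z + dist \<zeta> w" by (rule dist_triangle3)
    then have "cmod (z - w) \<le> 2 * \<tau>" using that by (auto simp: E_def dist_norm)
    then have "(cmod (z - w))\<^sup>2 \<le> 4 * \<tau>\<^sup>2" using power_mono[of "cmod (z - w)" "2 * \<tau>" 2] by (simp add: power_mult_distrib)
    moreover have "\<tau>\<^sup>2 * ((1 + (cmod z)\<^sup>2) * (1 + (cmod w)\<^sup>2)) \<le> \<tau>\<^sup>2 * (1 + R\<^sup>2)\<^sup>2"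
      using AA[OF that(1,2)] \<tau> by (intro mult_left_mono) auto
    ultimately have "reg_kernel (\<tau>\<^sup>2) z w \<le> ln (\<tau>\<^sup>2 * (4 + (1 + R\<^sup>2)\<^sup>2)) / 2" unfolding reg_kernel_def
      using reg_kernel_arg_pos[OF s, of z w] by (intro divide_right_mono ln_mono) (auto simp: algebra_simps)
    also have "\<dots> = b"
    proof -
      have "4 + (1 + R\<^sup>2)\<^sup>2 > 0" by (rule add_pos_nonneg) auto
      then have "ln (\<tau>\<^sup>2 * (4 + (1 + R\<^sup>2)\<^sup>2)) = ln (\<tau>\<^sup>2) + ln (4 + (1 + R\<^sup>2)\<^sup>2)"
        using s by (simp add: ln_mult_pos)
      then show ?thesis using \<tau> by (simp add: b_def ln_realpow)
    qed
    finally show ?thesis .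
  qed
  have k: "reg_kernel (\<tau>\<^sup>2) z w \<le> B - (B - b) * i z * i w" if "z \<in> C" "w \<in> C" for z w
    using kB[OF that] kb[OF that] by (auto simp: i_def indicator_def)
  have iint: "integrable \<mu> i" "(\<integral>z. i z \<partial>\<mu>) = measure \<mu> E" unfolding i_def using E by (auto simp: emeasure_eq_measure)
  have inner: "(\<integral>w. reg_kernel (\<tau>\<^sup>2) z w \<partial>\<mu>) \<le> B - (B - b) * i z * measure \<mu> E" if "z \<in> C" for z
  proof -
    have "(\<integral>w. reg_kernel (\<tau>\<^sup>2) z w \<partial>\<mu>) \<le> (\<integral>w. B - (B - b) * i z * i w \<partial>\<mu>)"
    proof (rule integral_mono_AE)
      show "integrable \<mu> (reg_kernel (\<tau>\<^sup>2) z)"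
        by (rule borel_probs_on_integrable[OF \<mu> C continuous_on_section[OF continuous_reg_kernel[OF s]]])
      show "AE w in \<mu>. reg_kernel (\<tau>\<^sup>2) z w \<le> B - (B - b) * i z * i w"
        using d(4) by eventually_elim (rule k[OF that])
    qed (use iint in auto)
    also have "\<dots> = B - (B - b) * i z * measure \<mu> E" using iint by (simp add: prob_space)
    finally show ?thesis .
  qed
  have "c \<le> reg_energy (\<tau>\<^sup>2) \<mu> \<mu>" using order_trans[OF c log_energy_le_reg_energy[OF \<mu> C s]] by simp
  also have "\<dots> \<le> (\<integral>z. B - (B - b) * i z * measure \<mu> E \<partial>\<mu>)" unfolding reg_energy_def
  proof (rule integral_mono_AE)
    show "integrable \<mu> (\<lambda>z. \<integral>w. reg_kernel (\<tau>\<^sup>2) z w \<partial>\<mu>)"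
      by (rule borel_probs_on_integrable[OF \<mu> C continuous_on_integral_kernel[OF continuous_reg_kernel[OF s] \<mu> C]])
    show "AE z in \<mu>. (\<integral>w. reg_kernel (\<tau>\<^sup>2) z w \<partial>\<mu>) \<le> B - (B - b) * i z * measure \<mu> E"
      using d(4) by eventually_elim (rule inner)
  qed (use iint in auto)
  also have "\<dots> = B - (B - b) * (measure \<mu> E)\<^sup>2" using iint by (simp add: prob_space power2_eq_square)
  finally have "(measure \<mu> E)\<^sup>2 * (B - b) \<le> B - c" by (simp add: mult.commute)
  then show ?thesis by (simp only: B_def b_def E_def)
qed

lemma finite_energy_no_atoms:
  assumes C: "compact C" and \<mu>: "\<mu> \<in> borel_probs_on C" and fin: "log_energy \<mu> \<noteq> -\<infinity>"
  shows "AE w in \<mu>. w \<noteq> \<zeta>"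
proof -
  note d = borel_probs_onD[OF \<mu> compact_imp_closed[OF C]]
  interpret prob_space \<mu> by (rule d)
  obtain c where c: "log_energy \<mu> = ereal c" using fin log_energy_not_PInf[OF \<mu> C] by (cases "log_energy \<mu>") auto
  obtain R where R: "R > 0" "C \<subseteq> cball 0 R"
    by (rule compact_subset_cball[OF C])
  define B where "B = ln (4 * R\<^sup>2 + (1 + R\<^sup>2)\<^sup>2) / 2"
  define b where "b = ln (4 + (1 + R\<^sup>2)\<^sup>2) / 2"
  define m where "m = measure \<mu> {\<zeta>}"
  have m0: "m \<ge> 0" by (simp add: m_def)
  have *: "m\<^sup>2 * (B - b - ln \<tau>) \<le> B - c" if \<tau>: "0 < \<tau>" "\<tau> \<le> 1" "B - b - ln \<tau> \<ge> 0" for \<tau>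
  proof -
    have "m \<le> measure \<mu> (cball \<zeta> \<tau>)" unfolding m_def using d \<tau> by (intro finite_measure_mono) auto
    then have "m\<^sup>2 * (B - b - ln \<tau>) \<le> (measure \<mu> (cball \<zeta> \<tau>))\<^sup>2 * (B - b - ln \<tau>)"
      using m0 \<tau> by (intro mult_right_mono power_mono) auto
    also have "\<dots> \<le> B - c" using measure_cball_bound[OF C \<mu> R, of c \<tau> \<zeta>] c \<tau>
      by (simp add: B_def b_def algebra_simps)
    finally show ?thesis .
  qed
  have "m = 0"
  proof (rule ccontr)
    assume "m \<noteq> 0"
    then have m2: "m\<^sup>2 > 0" by simp
    \<comment> \<open>The radius will be \<open>exp (- x)\<close>, with \<open>x\<close> so large
      that \<open>m\<^sup>2 * (B - b + x)\<close> exceeds \<open>B - c\<close>.\<close>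
    define x where "x = \<bar>B\<bar> + \<bar>b\<bar> + (\<bar>B - c\<bar> + 1) / m\<^sup>2"
    have x0: "x \<ge> 0" unfolding x_def using m2 by simp
    have "B - b + x \<ge> (\<bar>B - c\<bar> + 1) / m\<^sup>2" unfolding x_def by linarith
    moreover have "(\<bar>B - c\<bar> + 1) / m\<^sup>2 \<ge> 0" using m2 by simp
    ultimately have "B - b + x \<ge> 0" by linarith
    then have "m\<^sup>2 * (B - b + x) \<le> B - c"
      using *[of "exp (- x)"] x0 by simp
    have "\<bar>B - c\<bar> + 1 = m\<^sup>2 * ((\<bar>B - c\<bar> + 1) / m\<^sup>2)" using m2 by simp
    also have "\<dots> \<le> m\<^sup>2 * (B - b + x)"
      using \<open>B - b + x \<ge> (\<bar>B - c\<bar> + 1) / m\<^sup>2\<close> m2 by (intro mult_left_mono) auto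
    also have "\<dots> \<le> B - c" by fact
    finally show False by linarith
  qed
  then have "{\<zeta>} \<in> null_sets \<mu>" using d by (auto simp: m_def emeasure_eq_measure)
  then show ?thesis by (rule AE_not_in[THEN AE_mp]) auto
qed

text \<open>On the product space the negated regularized kernels increase to
  \<open>- ln (cmod (z - w))\<close> off the diagonal, with bounded integrals. The diagonal is null
  because there are no atoms, so the value \<open>ln 0 = 0\<close> is harmless, and Fubini
  applies.\<close>

lemma finite_energy_integrable:
  assumes C: "compact C" and \<mu>: "\<mu> \<in> borel_probs_on C" and c: "log_energy \<mu> = ereal c"
  shows "AE z in \<mu>. integrable \<mu> (\<lambda>w. ln (cmod (z - w)))" "integrable \<mu> (potential \<mu>)"
    "(\<integral>z. potential \<mu> z \<partial>\<mu>) = c"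
proof -
  note d = borel_probs_onD[OF \<mu> compact_imp_closed[OF C]]
  interpret prob_space \<mu> by (rule d)
  interpret P: pair_prob_space \<mu> \<mu> by unfold_locales
  have s2: "sets (\<mu> \<Otimes>\<^sub>M \<mu>) = sets (borel :: (complex \<times> complex) measure)"
    using sets_pair_measure_cong[OF d(1) d(1)] unfolding borel_prod .
  have pos: "1 / real (Suc j) > 0" for j by simp
  define f where "f j p = - reg_kernel (1 / Suc j) (fst p) (snd p)" for j p
  define u where "u p = - ln (cmod (fst p - snd p))" for p :: "complex \<times> complex"
  have fc: "continuous_on UNIV (f j)" for j
    using continuous_reg_kernel[OF pos[of j]] unfolding f_def case_prod_unfold by (rule continuous_on_minus)
  have CC: "AE p in \<mu> \<Otimes>\<^sub>M \<mu>. p \<in> C \<times> C"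
  proof (rule P.AE_pair_measure)
    have "C \<in> sets \<mu>" using d(1) compact_imp_closed[OF C] by simp
    then have "C \<times> C \<in> sets (\<mu> \<Otimes>\<^sub>M \<mu>)" by (intro pair_measureI)
    then show "{p \<in> space (\<mu> \<Otimes>\<^sub>M \<mu>). p \<in> C \<times> C} \<in> sets (\<mu> \<Otimes>\<^sub>M \<mu>)"
      by (simp add: space_pair_measure d(2))
    show "AE x in \<mu>. AE y in \<mu>. (x, y) \<in> C \<times> C"
      using d(4) by eventually_elim (use d(4) in auto)
  qed
  have fint: "integrable (\<mu> \<Otimes>\<^sub>M \<mu>) (f j)" for j
  proof -
    have "compact (f j ` (C \<times> C))"
      by (intro compact_continuous_image continuous_on_subset[OF fc] compact_Times C) auto
    then obtain B where B: "\<And>p. p \<in> C \<times> C \<Longrightarrow> norm (f j p) \<le> B"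
      using compact_imp_bounded[of "f j ` (C \<times> C)"] unfolding bounded_iff by blast
    show ?thesis
    proof (rule P.integrable_const_bound)
      show "AE p in \<mu> \<Otimes>\<^sub>M \<mu>. norm (f j p) \<le> B" using CC by eventually_elim (rule B)
      show "f j \<in> borel_measurable (\<mu> \<Otimes>\<^sub>M \<mu>)"
        using borel_measurable_continuous_onI[OF fc] by (simp add: measurable_cong_sets[OF s2 refl])
    qed
  qed
  have fI: "integral\<^sup>L (\<mu> \<Otimes>\<^sub>M \<mu>) (f j) = - reg_energy (1 / Suc j) \<mu> \<mu>" for j
    using P.integral_fst'[OF fint, symmetric] by (simp add: f_def reg_energy_def)
  have lim: "(\<lambda>j. integral\<^sup>L (\<mu> \<Otimes>\<^sub>M \<mu>) (f j)) \<longlonglongrightarrow> - c"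
    using reg_energy_tendsto[OF \<mu> C] unfolding c fI by (intro tendsto_minus) simp
  have um: "u \<in> borel_measurable (\<mu> \<Otimes>\<^sub>M \<mu>)"
  proof -
    have "u \<in> borel_measurable borel" unfolding u_def by (simp add: borel_prod[symmetric])
    then show ?thesis by (simp add: measurable_cong_sets[OF s2 refl])
  qed
  have diag: "AE p in \<mu> \<Otimes>\<^sub>M \<mu>. fst p \<noteq> snd p"
  proof (rule P.AE_pair_measure)
    have "closed {p :: complex \<times> complex. fst p = snd p}" by (intro closed_Collect_eq continuous_intros)
    then have "- {p :: complex \<times> complex. fst p = snd p} \<in> sets borel" by (simp add: borel_open open_Compl)
    moreover have "{p \<in> space (\<mu> \<Otimes>\<^sub>M \<mu>). fst p \<noteq> snd p} = - {p. fst p = snd p}"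
      by (auto simp: space_pair_measure d(2))
    ultimately show "{p \<in> space (\<mu> \<Otimes>\<^sub>M \<mu>). fst p \<noteq> snd p} \<in> sets (\<mu> \<Otimes>\<^sub>M \<mu>)" by (simp add: s2)
    have "AE y in \<mu>. x \<noteq> y" for x
      using finite_energy_no_atoms[OF C \<mu>, of x] c by (auto elim: eventually_mono)
    then show "AE x in \<mu>. AE y in \<mu>. fst (x, y) \<noteq> snd (x, y)" by simp
  qed
  have mono: "AE p in \<mu> \<Otimes>\<^sub>M \<mu>. mono (\<lambda>j. f j p)"
    unfolding f_def by (intro AE_I2 incseq_SucI le_imp_neg_le reg_kernel_mono) (auto simp: field_simps)
  have conv: "AE p in \<mu> \<Otimes>\<^sub>M \<mu>. (\<lambda>j. f j p) \<longlonglongrightarrow> u p"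
    using diag
  proof eventually_elim
    case (elim p)
    then show ?case using reg_kernel_tendsto[of "fst p" "snd p"]
      unfolding f_def u_def by (intro tendsto_minus) (simp add: ereal_ln_def dist_norm)
  qed
  have ui: "integrable (\<mu> \<Otimes>\<^sub>M \<mu>) u" by (rule integrable_monotone_convergence[OF fint mono conv lim um])
  have uI: "integral\<^sup>L (\<mu> \<Otimes>\<^sub>M \<mu>) u = - c" by (rule integral_monotone_convergence[OF fint mono conv lim um])
  show "AE z in \<mu>. integrable \<mu> (\<lambda>w. ln (cmod (z - w)))"
    using P.AE_integrable_fst'[OF ui] by eventually_elim (auto simp: u_def)
  have "integrable \<mu> (\<lambda>z. - potential \<mu> z)"
    using P.integrable_fst'[OF ui] by (simp add: u_def potential_def)
  then show "integrable \<mu> (potential \<mu>)" by simp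
  show "(\<integral>z. potential \<mu> z \<partial>\<mu>) = c"
    using P.integral_fst'[OF ui] uI by (simp add: u_def potential_def)
qed

text \<open>The logarithm of the squared modulus of the Vandermonde determinant: every unordered
  pair is counted twice, hence the targets of the form \<open>n * (n - 1) * c\<close>.\<close>

definition pair_sum :: "complex set \<Rightarrow> real" where
  "pair_sum S = (\<Sum>x\<in>S. \<Sum>y\<in>S - {x}. ln (cmod (x - y)))"

lemma pair_sum_insert:
  assumes "finite S" "z \<notin> S"
  shows "pair_sum (insert z S) = pair_sum S + 2 * (\<Sum>y\<in>S. ln (cmod (z - y)))"
proof -
  have "(\<Sum>y\<in>insert z S - {x}. ln (cmod (x - y))) = ln (cmod (z - x)) + (\<Sum>y\<in>S - {x}. ln (cmod (x - y)))"
    if "x \<in> S" for x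
  proof -
    have "insert z S - {x} = insert z (S - {x})" using that assms by auto
    then show ?thesis using assms by (simp add: norm_minus_commute)
  qed
  then show ?thesis using assms by (simp add: pair_sum_def sum.distrib insert_Diff_if)
qed

text \<open>The conditional expectation of \<open>pair_sum\<close>, when the remaining points are chosen
  independently with law \<open>\<mu>\<close>, can be kept from decreasing at each choice.\<close>

lemma exists_pair_sum_ge:
  assumes C: "compact C" and \<mu>: "\<mu> \<in> borel_probs_on C" and c: "log_energy \<mu> = ereal c"
  shows "\<exists>T. finite T \<and> T \<subseteq> C \<and> card T = N \<and> pair_sum T \<ge> real N * (real N - 1) * c"
proof -
  note d = borel_probs_onD[OF \<mu> compact_imp_closed[OF C]]
  note fe = finite_energy_integrable[OF C \<mu> c]
  interpret prob_space \<mu> by (rule d)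
  \<comment> \<open>With \<open>m\<close> points chosen, pairs of a chosen and a pending point
    contribute potentials, and pairs of pending points contribute \<open>c\<close> each.
    Integrability is carried along so that these potentials are genuine integrals.\<close>
  have "m \<le> N \<Longrightarrow> \<exists>T. finite T \<and> T \<subseteq> C \<and> card T = m \<and> (\<forall>x\<in>T. integrable \<mu> (\<lambda>w. ln (cmod (x - w)))) \<and>
    pair_sum T + 2 * (real N - real m) * (\<Sum>x\<in>T. potential \<mu> x) + (real N - real m) * (real N - real m - 1) * c
      \<ge> real N * (real N - 1) * c" for m
  proof (induction m)
    case 0
    show ?case by (intro exI[of _ "{}"]) (simp add: pair_sum_def)
  next
    case (Suc m)
    then obtain T where T: "finite T" "T \<subseteq> C" "card T = m" "\<And>x. x \<in> T \<Longrightarrow> integrable \<mu> (\<lambda>w. ln (cmod (x - w)))"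
      and bound: "pair_sum T + 2 * (real N - real m) * (\<Sum>x\<in>T. potential \<mu> x) + (real N - real m) * (real N - real m - 1) * c
      \<ge> real N * (real N - 1) * c" by auto
    define k where "k = real N - real m - 1"
    \<comment> \<open>Half of the part of the conditional expectation that depends on the next
      point. Some point reaches the mean of \<open>h\<close>, and it can be taken from the set of
      full measure on which the invariant persists.\<close>
    define h where "h z = (\<Sum>x\<in>T. ln (cmod (x - z))) + k * potential \<mu> z" for z
    have hint: "integrable \<mu> h" unfolding h_def using T fe by auto
    have hI: "(\<integral>z. h z \<partial>\<mu>) = (\<Sum>x\<in>T. potential \<mu> x) + k * c"
    proof -
      have "(\<integral>z. (\<Sum>x\<in>T. ln (cmod (x - z))) \<partial>\<mu>) = (\<Sum>x\<in>T. potential \<mu> x)"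
        unfolding potential_def using T by simp
      moreover have "integrable \<mu> (\<lambda>z. \<Sum>x\<in>T. ln (cmod (x - z)))" using T by simp
      ultimately show ?thesis unfolding h_def using fe by simp
    qed
    have "AE z in \<mu>. \<forall>x\<in>T. z \<noteq> x"
      using finite_energy_no_atoms[OF C \<mu>] c T(1) by (subst AE_ball_countable) (auto intro: countable_finite)
    with fe(1) d(4) have good: "AE z in \<mu>. z \<in> C \<and> z \<notin> T \<and> integrable \<mu> (\<lambda>w. ln (cmod (z - w)))"
      by eventually_elim blast
    have "\<exists>z. (z \<in> C \<and> z \<notin> T \<and> integrable \<mu> (\<lambda>w. ln (cmod (z - w)))) \<and> (\<integral>z. h z \<partial>\<mu>) \<le> h z"
    proof (rule ccontr)
      assume no: "\<not> ?thesis"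
      have "AE z in \<mu>. h z < (\<integral>z. h z \<partial>\<mu>)" using good by eventually_elim (use no in force)
      then have "(\<integral>z. h z \<partial>\<mu>) < (\<integral>z. (\<integral>z. h z \<partial>\<mu>) \<partial>\<mu>)"
        using hint emeasure_space_1 by (intro integral_less_AE_space) auto
      then show False by (simp add: prob_space)
    qed
    then obtain z where z: "z \<in> C" "z \<notin> T" "integrable \<mu> (\<lambda>w. ln (cmod (z - w)))" and hz: "(\<integral>z. h z \<partial>\<mu>) \<le> h z" by blast
    define A B where "A = (\<Sum>x\<in>T. potential \<mu> x)" and "B = (\<Sum>x\<in>T. ln (cmod (z - x)))"
    have hz': "A + k * c \<le> B + k * potential \<mu> z"
    proof -
      have "h z = B + k * potential \<mu> z" unfolding h_def B_def by (simp add: norm_minus_commute)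
      then show ?thesis using hz hI by (simp add: A_def)
    qed
    have "pair_sum (insert z T) + 2 * k * (\<Sum>x\<in>insert z T. potential \<mu> x) + k * (k - 1) * c
       = pair_sum T + 2 * (B + k * potential \<mu> z) + 2 * k * A + k * (k - 1) * c"
      using T z by (simp add: pair_sum_insert A_def B_def algebra_simps)
    also have "\<dots> \<ge> pair_sum T + 2 * (k + 1) * A + (k + 1) * k * c"
      using hz' by (simp add: algebra_simps)
    finally have "pair_sum (insert z T) + 2 * k * (\<Sum>x\<in>insert z T. potential \<mu> x) + k * (k - 1) * c \<ge> real N * (real N - 1) * c"
      using bound by (simp add: k_def A_def)
    moreover have "k = real N - real (Suc m)" by (simp add: k_def)
    ultimately show ?case using T z by (intro exI[of _ "insert z T"]) (auto simp: card_insert_if)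
  qed
  from this[of N] show ?thesis by auto
qed

text \<open>Deleting the points at which the product of distances to the others is small can only
  increase the excess of \<open>pair_sum\<close> over its target value.\<close>

lemma exists_balanced_set:
  assumes C: "compact C" and \<mu>: "\<mu> \<in> borel_probs_on C" and c: "log_energy \<mu> = ereal c" and e: "e > 0"
  shows "\<exists>S. finite S \<and> S \<subseteq> C \<and> card S \<ge> n0 \<and> (\<forall>x\<in>S. (\<Sum>y\<in>S - {x}. ln (cmod (x - y))) \<ge> (real (card S) - 1) * (c - e))"
proof -
  obtain R where R: "R > 0" "C \<subseteq> cball 0 R"
    by (rule compact_subset_cball[OF C])
  define M where "M = \<bar>ln (2 * R)\<bar> + \<bar>c - e\<bar>"
  \<comment> \<open>The excess over the target with \<open>c - e\<close> in place of
    \<open>c\<close>. It is bounded on sets of at most \<open>n0\<close> points.\<close>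
  define V where "V S = pair_sum S - real (card S) * (real (card S) - 1) * (c - e)" for S
  have VM: "V S \<le> real n0 * real n0 * M" if S: "finite S" "S \<subseteq> C" "card S \<le> n0" for S
  proof -
    have "pair_sum S \<le> (\<Sum>x\<in>S. \<Sum>y\<in>S - {x}. \<bar>ln (2 * R)\<bar>)" unfolding pair_sum_def
    proof (intro sum_mono)
      fix x y assume xy: "x \<in> S" "y \<in> S - {x}"
      have "cmod x \<le> R" "cmod y \<le> R" using xy S R by auto
      then have "cmod (x - y) \<le> 2 * R" using norm_triangle_ineq4[of x y] by linarith
      then have "ln (cmod (x - y)) \<le> ln (2 * R)" using xy by (intro ln_mono) auto
      then show "ln (cmod (x - y)) \<le> \<bar>ln (2 * R)\<bar>" by linarith
    qed
    also have "\<dots> = real (card S) * (real (card S) - 1) * \<bar>ln (2 * R)\<bar>"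
    proof -
      have "(\<Sum>y\<in>S - {x}. \<bar>ln (2 * R)\<bar>) = (real (card S) - 1) * \<bar>ln (2 * R)\<bar>" if "x \<in> S" for x
      proof -
        have "card S \<ge> 1" using that S(1) by (auto simp: Suc_le_eq card_gt_0_iff)
        then show ?thesis using that S by (simp add: card_Diff_singleton of_nat_diff)
      qed
      then have "(\<Sum>x\<in>S. \<Sum>y\<in>S - {x}. \<bar>ln (2 * R)\<bar>) = (\<Sum>x\<in>S. (real (card S) - 1) * \<bar>ln (2 * R)\<bar>)"
        by (rule sum.cong[OF refl])
      then show ?thesis by simp
    qed
    finally have "V S \<le> real (card S) * (real (card S) - 1) * (\<bar>ln (2 * R)\<bar> - (c - e))"
      by (simp add: V_def algebra_simps)
    also have "\<dots> \<le> real (card S) * (real (card S) - 1) * M"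
    proof (rule mult_left_mono)
      show "\<bar>ln (2 * R)\<bar> - (c - e) \<le> M" unfolding M_def by linarith
      show "0 \<le> real (card S) * (real (card S) - 1)" by (cases "card S") auto
    qed
    also have "\<dots> \<le> real n0 * real n0 * M"
    proof (rule mult_right_mono)
      have "real (card S) * (real (card S) - 1) \<le> real (card S) * real (card S)" by (simp add: mult_left_mono)
      also have "\<dots> \<le> real n0 * real n0" using S by (intro mult_mono) auto
      finally show "real (card S) * (real (card S) - 1) \<le> real n0 * real n0" .
    qed (auto simp: M_def)
    finally show ?thesis .
  qed
  \<comment> \<open>The slack \<open>e\<close> gives a set of \<open>N\<close> points an excess of
    at least \<open>N * (N - 1) * e\<close>, which is made larger than that of any set of at most
    \<open>n0\<close> points.\<close>
  obtain N0 where N0: "real N0 > (real n0 * real n0 * M) / e" using reals_Archimedean2 by blast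
  define N where "N = N0 + 2"
  obtain T where T: "finite T" "T \<subseteq> C" "card T = N" "pair_sum T \<ge> real N * (real N - 1) * c"
    using exists_pair_sum_ge[OF C \<mu> c, of N] by auto
  have "real n0 * real n0 * M < real N0 * e" using N0 e by (simp add: field_simps)
  also have "\<dots> \<le> real N * (real N - 1) * e" using e by (intro mult_right_mono) (auto simp: N_def algebra_simps)
  also have "\<dots> \<le> V T" unfolding V_def T(3) using T(4) by (simp add: algebra_simps)
  finally have VT: "real n0 * real n0 * M < V T" .
  \<comment> \<open>A subset maximizing \<open>V\<close> stands for the end of the deletion process:
    it is large because its excess is large, and removing one more point does not raise
    \<open>V\<close>, which is twice the desired inequality.\<close>
  have fin: "finite (Pow T)" "Pow T \<noteq> {}" using T by auto
  then have "Max (V ` Pow T) \<in> V ` Pow T" by (intro Max_in) auto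
  then obtain S where "S \<in> Pow T" "V S = Max (V ` Pow T)" by fastforce
  then have S: "S \<in> Pow T" "\<And>S'. S' \<in> Pow T \<Longrightarrow> V S' \<le> V S" using fin by auto
  have Sf: "finite S" "S \<subseteq> C" using S(1) T finite_subset by auto
  have "V S > real n0 * real n0 * M" using S(2)[of T] VT by auto
  then have n0: "card S \<ge> n0" using VM[OF Sf] by force
  have "(\<Sum>y\<in>S - {x}. ln (cmod (x - y))) \<ge> (real (card S) - 1) * (c - e)" if x: "x \<in> S" for x
  proof -
    have ins: "insert x (S - {x}) = S" using x by auto
    have card: "real (card (S - {x})) = real (card S) - 1"
      using x Sf by (metis card_Suc_Diff1 add_diff_cancel_left' of_nat_Suc)
    have "pair_sum S = pair_sum (S - {x}) + 2 * (\<Sum>y\<in>S - {x}. ln (cmod (x - y)))"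
      using pair_sum_insert[of "S - {x}" x] Sf ins by simp
    moreover have "V (S - {x}) \<le> V S" using S(2)[of "S - {x}"] S(1) by auto
    ultimately show ?thesis unfolding V_def card by (simp add: algebra_simps)
  qed
  then show ?thesis using Sf n0 by blast
qed

text \<open>For the uniform measure on \<open>n\<close> points the regularized energy dominates
  \<open>pair_sum / n\<^sup>2\<close> up to a diagonal contribution of order \<open>1/n\<close>,
  which disappears in the limit for each fixed parameter.\<close>

lemma discrete_energy_limit:
  assumes C: "compact C" and S: "\<And>m. finite (S m)" "\<And>m. S m \<subseteq> C" "\<And>m. S m \<noteq> {}"
    and inf: "filterlim (\<lambda>m. card (S m)) at_top sequentially"
    and b: "\<And>m. pair_sum (S m) \<ge> real (card (S m)) * (real (card (S m)) - 1) * b m" "b \<longlonglongrightarrow> c"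
  obtains r \<nu> where "strict_mono (r :: nat \<Rightarrow> nat)" "\<nu> \<in> borel_probs_on C"
    "bounded_weak_conv ((\<lambda>m. uniform_on (S m) (\<lambda>x. x)) \<circ> r) \<nu>" "ereal c \<le> log_energy \<nu>"
proof -
  define \<mu> where "\<mu> m = uniform_on (S m) (\<lambda>x. x)" for m
  have cl: "closed C" using C compact_imp_closed by auto
  have \<mu>: "\<mu> m \<in> borel_probs_on C" for m unfolding \<mu>_def by (rule uniform_on_borel_probs) (use S cl in auto)
  have ne: "C \<noteq> {}" using S(2)[of 0] S(3)[of 0] by auto
  obtain r \<nu> where r: "strict_mono (r :: nat \<Rightarrow> nat)" "\<nu> \<in> borel_probs_on C" "bounded_weak_conv (\<mu> \<circ> r) \<nu>"
    by (rule weak_compactness[OF C ne \<mu>])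
  define g where "g s m = (1 - inverse (real (card (S m)))) * b m + ln s / 2 * inverse (real (card (S m)))" for s m
  have lb: "g s m \<le> reg_energy s (\<mu> m) (\<mu> m)" if s: "s > 0" for s m
  proof -
    define n where "n = real (card (S m))"
    have n: "n > 0" unfolding n_def using S[of m] by (simp add: card_gt_0_iff)
    note k = continuous_reg_kernel[OF s]
    have "reg_energy s (\<mu> m) (\<mu> m) = (\<Sum>x\<in>S m. (\<Sum>y\<in>S m. reg_kernel s x y) / n) / n"
      unfolding reg_energy_def
      using uniform_on_integral[OF S(1,3) continuous_on_integral_kernel[OF k \<mu> C], of m "\<lambda>x. x" m, folded \<mu>_def]
      using uniform_on_integral[OF S(1,3) continuous_on_section[OF k], of m "\<lambda>x. x", folded \<mu>_def]
      by (simp add: n_def)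
    also have "\<dots> = (\<Sum>x\<in>S m. \<Sum>y\<in>S m. reg_kernel s x y) / (n * n)" by (simp add: sum_divide_distrib)
    also have "\<dots> \<ge> (pair_sum (S m) + n * (ln s / 2)) / (n * n)"
    proof (rule divide_right_mono)
      have "pair_sum (S m) + n * (ln s / 2) = (\<Sum>x\<in>S m. (\<Sum>y\<in>S m - {x}. ln (cmod (x - y))) + ln s / 2)"
        by (simp add: pair_sum_def sum.distrib n_def)
      also have "\<dots> \<le> (\<Sum>x\<in>S m. (\<Sum>y\<in>S m - {x}. reg_kernel s x y) + reg_kernel s x x)"
      proof (intro sum_mono add_mono)
        fix x y assume "x \<in> S m" "y \<in> S m - {x}"
        then show "ln (cmod (x - y)) \<le> reg_kernel s x y" by (intro ln_le_reg_kernel s) auto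
      next
        fix x assume "x \<in> S m"
        have "1 * 1 \<le> (1 + (cmod x)\<^sup>2) * (1 + (cmod x)\<^sup>2)" by (rule mult_mono) auto
        then have "s * 1 \<le> s * ((1 + (cmod x)\<^sup>2) * (1 + (cmod x)\<^sup>2))" using s by (intro mult_left_mono) auto
        then show "ln s / 2 \<le> reg_kernel s x x" using s by (simp add: reg_kernel_def mult.assoc)
      qed
      also have "\<dots> = (\<Sum>x\<in>S m. \<Sum>y\<in>S m. reg_kernel s x y)"
        using S(1)[of m] by (intro sum.cong refl) (simp add: sum.remove add.commute)
      finally show "pair_sum (S m) + n * (ln s / 2) \<le> (\<Sum>x\<in>S m. \<Sum>y\<in>S m. reg_kernel s x y)" .
    qed (use n in auto)
    finally have "(pair_sum (S m) + n * (ln s / 2)) / (n * n) \<le> reg_energy s (\<mu> m) (\<mu> m)" .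
    moreover have "(n * (n - 1) * b m + n * (ln s / 2)) / (n * n) \<le> (pair_sum (S m) + n * (ln s / 2)) / (n * n)"
      using b(1)[of m] n by (intro divide_right_mono add_right_mono) (auto simp: n_def)
    moreover have "(n * (n - 1) * b m + n * (ln s / 2)) / (n * n) = (1 - inverse n) * b m + ln s / 2 * inverse n"
      using n by (simp add: field_simps)
    ultimately show ?thesis by (simp add: n_def g_def)
  qed
  have inv: "(\<lambda>m. inverse (real (card (S m)))) \<longlonglongrightarrow> 0"
    using inf by (intro tendsto_inverse_0_at_top filterlim_compose[OF filterlim_real_sequentially])
  have E: "ereal c \<le> log_energy \<nu>"
  proof (rule log_energy_usc[OF C _ r(2,3)])
    show "(\<mu> \<circ> r) j \<in> borel_probs_on C" for j using \<mu> by simp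
    fix s :: real assume s: "0 < s"
    have "g s \<longlonglongrightarrow> (1 - 0) * c + ln s / 2 * 0"
      unfolding g_def[abs_def] by (intro tendsto_intros inv b)
    then have "(g s \<circ> r) \<longlonglongrightarrow> c"
      by (intro LIMSEQ_subseq_LIMSEQ r) simp
    moreover have "\<forall>j. (g s \<circ> r) j
        \<le> reg_energy s ((\<mu> \<circ> r) j) ((\<mu> \<circ> r) j)"
      using lb[OF s] unfolding o_def by blast
    ultimately show "\<exists>b. b \<longlonglongrightarrow> c \<and> (\<forall>\<^sub>F j in sequentially. b j \<le> reg_energy s ((\<mu> \<circ> r) j) ((\<mu> \<circ> r) j))"
      using always_eventually by blast
  qed
  show thesis using that[OF r(1,2)] r(3) E by (simp add: \<mu>_def[abs_def])
qed

subsection \<open>Lemniscates and the lower bound for the equilibrium potential\<close>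

lemma poly_eq_prod_roots:
  fixes q :: "complex poly"
  shows "poly q z = lead_coeff q * (\<Prod>x\<in>#proots q. z - x)"
proof -
  have "poly q z = poly (smult (lead_coeff q) (\<Prod>x\<in>#proots q. [:-x, 1:])) z"
    by (simp only: complex_poly_decompose_multiset)
  also have "\<dots> = lead_coeff q * (\<Prod>x\<in>#proots q. z - x)" by (simp add: poly_prod_mset)
  finally show ?thesis .
qed

lemma norm_prod_mset: "norm (\<Prod>x\<in>#A. f x :: complex) = (\<Prod>x\<in>#A. norm (f x))"
  by (induction A) (auto simp: norm_mult)

lemma prod_prod_mset_swap:
  fixes f :: "'a \<Rightarrow> 'b \<Rightarrow> real"
  shows "(\<Prod>y\<in>T. \<Prod>x\<in>#A. f x y) = (\<Prod>x\<in>#A. \<Prod>y\<in>T. f x y)"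
  by (induction T rule: infinite_finite_induct) (auto simp: prod_mset.distrib)

lemma prod_mset_power_real:
  fixes f :: "'a \<Rightarrow> real" shows "(\<Prod>x\<in>#A. f x) ^ n = (\<Prod>x\<in>#A. f x ^ n)"
  by (induction A) (auto simp: power_mult_distrib)

lemma prod_mset_less_power:
  fixes f :: "'a \<Rightarrow> real"
  assumes "A \<noteq> {#}" "\<And>x. x \<in># A \<Longrightarrow> 0 \<le> f x" "\<And>x. x \<in># A \<Longrightarrow> f x < c"
  shows "(\<Prod>x\<in>#A. f x) < c ^ size A \<and> 0 \<le> (\<Prod>x\<in>#A. f x)"
  using assms
proof (induction A)
  case (add a A)
  show ?case
  proof (cases "A = {#}")
    case False
    then have IH: "(\<Prod>x\<in>#A. f x) < c ^ size A" "0 \<le> (\<Prod>x\<in>#A. f x)" using add by auto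
    have a: "0 \<le> f a" "f a < c" using add.prems by auto
    have "f a * (\<Prod>x\<in>#A. f x) < c * c ^ size A"
      by (rule mult_strict_mono) (use IH a in auto)
    then show ?thesis using IH a by simp
  qed (use add in auto)
qed simp

text \<open>A resultant argument: the product of \<open>p\<close> over the roots of \<open>q - w\<close> is, up to powers of
  the leading coefficient, the product of \<open>q - w\<close> over the roots of \<open>p\<close>; the latter is monic
  in \<open>w\<close> up to sign, so it is at least \<open>r ^ card T\<close> in modulus at some \<open>w\<close> on the circle.\<close>

lemma lemniscate_large_value:
  fixes q :: "complex poly"
  assumes n: "degree q > 0" and r: "r > 0" and T: "finite T"
  shows "\<exists>x. cmod (poly q x) \<le> r \<and>
    (r / cmod (lead_coeff q)) ^ card T \<le> (\<Prod>y\<in>T. cmod (x - y)) ^ degree q"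
proof -
  \<comment> \<open>With \<open>u = 1 / w\<close> this is the product of \<open>q y - w\<close> over
    \<open>T\<close> normalized to be 1 at \<open>u = 0\<close>. The maximum principle on the disc
    of radius \<open>1/r\<close> finds a circle point where its modulus is at least 1.\<close>
  define U where "U u = (\<Prod>y\<in>T. 1 - u * poly q y)" for u
  have hol: "U holomorphic_on A" for A unfolding U_def by (intro holomorphic_intros)
  have Uc: "continuous_on A U" for A using hol by (rule holomorphic_on_imp_continuous_on)
  have sph: "sphere (0::complex) (1/r) \<noteq> {}" using r by simp
  have "continuous_on (sphere 0 (1/r)) (\<lambda>u. cmod (U u))" by (intro continuous_on_norm Uc)
  from continuous_attains_sup[OF compact_sphere sph this]
  obtain u0 where u0: "u0 \<in> sphere 0 (1/r)" "\<And>u. u \<in> sphere 0 (1/r) \<Longrightarrow> cmod (U u) \<le> cmod (U u0)" by blast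
  have "cmod (U 0) \<le> cmod (U u0)"
  proof (rule maximum_modulus_frontier[where f = U and \<xi> = 0 and S = "cball 0 (1/r)"])
    show "U holomorphic_on interior (cball 0 (1/r))" "continuous_on (closure (cball 0 (1/r))) U"
      by (rule hol Uc)+
    show "\<And>z. z \<in> frontier (cball 0 (1/r)) \<Longrightarrow> cmod (U z) \<le> cmod (U u0)" using u0(2) by simp
  qed (use r in auto)
  then have U1: "1 \<le> cmod (U u0)" by (simp add: U_def)
  define w where "w = 1 / u0"
  have u0n: "u0 \<noteq> 0" "cmod u0 = 1 / r" using u0(1) r by auto
  have w: "cmod w = r" using u0n r by (simp add: w_def norm_divide)
  define p where "p = q - [:w:]"
  have "p = q + [:- w:]" by (simp add: p_def)
  then have dp: "degree p = degree q" using n by (simp add: degree_add_eq_left)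
  have lp: "lead_coeff p = lead_coeff q" unfolding dp unfolding p_def using n by (simp add: coeff_pCons split: nat.splits)
  define a where "a = cmod (lead_coeff q)"
  have a: "a > 0" unfolding a_def using n by auto
  define A where "A = proots p"
  have A: "size A = degree q" unfolding A_def size_proots_complex dp ..
  have "r ^ card T \<le> (\<Prod>y\<in>T. cmod (poly p y))"
  proof -
    have "cmod (poly p y) = r * cmod (1 - u0 * poly q y)" for y
    proof -
      have "poly p y = - w * (1 - u0 * poly q y)" using u0n by (simp add: p_def w_def algebra_simps)
      then show ?thesis using w by (simp add: norm_mult)
    qed
    then have "(\<Prod>y\<in>T. cmod (poly p y)) = r ^ card T * cmod (U u0)"
      by (simp add: prod.distrib U_def prod_norm)
    then show ?thesis using U1 r by simp
  qed
  also have "(\<Prod>y\<in>T. cmod (poly p y)) = a ^ card T * (\<Prod>x\<in>#A. \<Prod>y\<in>T. cmod (x - y))"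
    unfolding poly_eq_prod_roots[of p] lp norm_mult norm_prod_mset prod.distrib
    by (simp add: a_def A_def prod_prod_mset_swap norm_minus_commute)
  finally have "r ^ card T \<le> a ^ card T * (\<Prod>x\<in>#A. \<Prod>y\<in>T. cmod (x - y))" .
  then have X: "(r / a) ^ card T \<le> (\<Prod>x\<in>#A. \<Prod>y\<in>T. cmod (x - y))"
    using a by (simp add: power_divide field_simps)
  \<comment> \<open>Some root reaches the geometric mean over all \<open>degree q\<close> roots;
    otherwise the product over the roots would be too small.\<close>
  have "\<exists>x\<in>#A. (r / a) ^ card T \<le> (\<Prod>y\<in>T. cmod (x - y)) ^ degree q"
  proof (rule ccontr)
    assume no: "\<not> ?thesis"
    have ne: "A \<noteq> {#}" using A n by auto
    have "(\<Prod>x\<in>#A. (\<Prod>y\<in>T. cmod (x - y)) ^ degree q) < ((r / a) ^ card T) ^ size A"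
    proof (rule prod_mset_less_power[OF ne, THEN conjunct1])
      show "0 \<le> (\<Prod>y\<in>T. cmod (x - y)) ^ degree q" for x by (intro zero_le_power prod_nonneg) auto
    qed (use no in \<open>auto simp: not_le\<close>)
    moreover have "((r / a) ^ card T) ^ degree q \<le> (\<Prod>x\<in>#A. \<Prod>y\<in>T. cmod (x - y)) ^ degree q"
      using X a r by (intro power_mono) auto
    ultimately show False unfolding A prod_mset_power_real by simp
  qed
  then obtain x where x: "x \<in># A" "(r / a) ^ card T \<le> (\<Prod>y\<in>T. cmod (x - y)) ^ degree q" by blast
  have "p \<noteq> 0" using dp n by auto
  then have "poly p x = 0" using x(1) by (simp add: A_def)
  then have "cmod (poly q x) \<le> r" using w by (simp add: p_def)
  then show ?thesis using x by (auto simp: a_def)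
qed

lemma lemniscate_compact:
  fixes q :: "complex poly"
  assumes "degree q > 0"
  shows "compact (poly q -` cball 0 r)"
proof -
  obtain a p where q: "q = pCons a p" by (cases q)
  have "p \<noteq> 0" using assms q by auto
  then obtain R where R: "\<And>z. R \<le> cmod z \<Longrightarrow> r + 1 \<le> cmod (poly q z)"
    using poly_infinity[of p "r + 1" a] q by auto
  have "poly q -` cball 0 r \<subseteq> cball 0 R"
  proof
    fix z assume "z \<in> poly q -` cball 0 r"
    then show "z \<in> cball 0 R" using R[of z] by force
  qed
  then have "bounded (poly q -` cball 0 r)" using bounded_cball bounded_subset by blast
  moreover have "closed (poly q -` cball 0 r)"
    by (intro continuous_closed_vimage) (auto intro: continuous_intros)
  ultimately show ?thesis by (simp add: compact_eq_bounded_closed)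
qed

text \<open>A greedy construction in the manner of Leja points: the new point adds at least twice
  \<open>N\<close> times the target value, which is the increment from \<open>N * (N - 1)\<close> to
  \<open>(N + 1) * N\<close>.\<close>

lemma lemniscate_pair_sum:
  fixes q :: "complex poly"
  assumes n: "degree q > 0" and r: "r > 0"
  shows "\<exists>T. finite T \<and> T \<subseteq> poly q -` cball 0 r \<and> card T = N \<and>
    pair_sum T \<ge> real N * (real N - 1) * (ln (r / cmod (lead_coeff q)) / degree q)"
proof (induction N)
  case 0
  show ?case by (intro exI[of _ "{}"]) (simp add: pair_sum_def)
next
  case (Suc N)
  define X where "X = r / cmod (lead_coeff q)"
  have "q \<noteq> 0" using n by auto
  then have X: "X > 0" unfolding X_def using r by simp
  from Suc obtain T where T: "finite T" "T \<subseteq> poly q -` cball 0 r" "card T = N"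
    "pair_sum T \<ge> real N * (real N - 1) * (ln X / degree q)" by (auto simp: X_def)
  obtain x where x: "cmod (poly q x) \<le> r" "X ^ N \<le> (\<Prod>y\<in>T. cmod (x - y)) ^ degree q"
    using lemniscate_large_value[OF n r T(1)] T(3) by (auto simp: X_def)
  \<comment> \<open>Nonvanishing of the product says that \<open>x\<close> is a new point. It
    follows from the positive lower bound and \<open>degree q > 0\<close>.\<close>
  have "(\<Prod>y\<in>T. cmod (x - y)) \<noteq> 0"
  proof
    assume "(\<Prod>y\<in>T. cmod (x - y)) = 0"
    then have "X ^ N \<le> 0" using x(2) n by (simp add: zero_power)
    then show False using zero_less_power[OF X, of N] by linarith
  qed
  then have xT: "x \<notin> T" and P0: "(\<Prod>y\<in>T. cmod (x - y)) > 0" using T(1) by (auto intro!: prod_pos)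
  have "real N * ln X = ln (X ^ N)" using X by (simp add: ln_realpow)
  also have "\<dots> \<le> ln ((\<Prod>y\<in>T. cmod (x - y)) ^ degree q)" using x(2) X P0 by (intro ln_mono) auto
  also have "\<dots> = degree q * ln (\<Prod>y\<in>T. cmod (x - y))" using P0 by (simp add: ln_realpow)
  also have "ln (\<Prod>y\<in>T. cmod (x - y)) = (\<Sum>y\<in>T. ln (cmod (x - y)))"
    using xT T(1) by (intro ln_prod) auto
  finally have "real N * (ln X / degree q) \<le> (\<Sum>y\<in>T. ln (cmod (x - y)))" using n by (simp add: field_simps)
  moreover have "real (Suc N) * (real (Suc N) - 1) * L \<le> p + 2 * s"
    if "real N * L \<le> s" "real N * (real N - 1) * L \<le> p" for L s p :: real
    using that by (simp add: algebra_simps)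
  ultimately have "real (Suc N) * (real (Suc N) - 1) * (ln X / degree q) \<le> pair_sum (insert x T)"
    unfolding pair_sum_insert[OF T(1) xT] using T(4) by blast
  then show ?case using T x xT by (intro exI[of _ "insert x T"]) (auto simp: X_def)
qed

text \<open>The bound is the logarithm of the classical capacity of the lemniscate, the
  \<open>degree q\<close>-th root of \<open>r / cmod (lead_coeff q)\<close>.\<close>

lemma lemniscate_energy:
  fixes q :: "complex poly"
  assumes n: "degree q > 0" and r: "r > 0"
  shows "\<exists>\<nu> \<in> borel_probs_on (poly q -` cball 0 r). ereal (ln (r / cmod (lead_coeff q)) / degree q) \<le> log_energy \<nu>"
proof -
  define c where "c = ln (r / cmod (lead_coeff q)) / degree q"
  have "\<forall>N. \<exists>T. finite T \<and> T \<subseteq> poly q -` cball 0 r \<and> card T = N \<and> pair_sum T \<ge> real N * (real N - 1) * c"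
    using lemniscate_pair_sum[OF n r] unfolding c_def by blast
  from choice[OF this] obtain T where T: "\<And>N. finite (T N)" "\<And>N. T N \<subseteq> poly q -` cball 0 r" "\<And>N. card (T N) = N"
    "\<And>N. pair_sum (T N) \<ge> real N * (real N - 1) * c" by blast
  define S where "S m = T (Suc m)" for m
  have ne: "S m \<noteq> {}" for m using T(3)[of "Suc m"] by (auto simp: S_def)
  obtain r' \<nu> where "\<nu> \<in> borel_probs_on (poly q -` cball 0 r)" "ereal c \<le> log_energy \<nu>"
  proof (rule discrete_energy_limit[OF lemniscate_compact[OF n, of r], of S "\<lambda>_. c" c])
    show "filterlim (\<lambda>m. card (S m)) at_top sequentially" unfolding S_def T(3) by (rule filterlim_Suc)
    show "pair_sum (S m) \<ge> real (card (S m)) * (real (card (S m)) - 1) * c" for m unfolding S_def T(3) by (rule T(4))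
  qed (use T ne in \<open>auto simp: S_def\<close>)
  then show ?thesis unfolding c_def by blast
qed

lemma lagrange_one:
  fixes S :: "complex set"
  assumes S: "finite S" "S \<noteq> {}"
  shows "(\<Sum>x\<in>S. \<Prod>y\<in>S - {x}. (z - y) / (x - y)) = 1"
proof -
  define L where "L = (\<Sum>x\<in>S. smult (inverse (\<Prod>y\<in>S - {x}. x - y)) (\<Prod>y\<in>S - {x}. [:-y, 1:]))"
  have ev: "poly L z = (\<Sum>x\<in>S. \<Prod>y\<in>S - {x}. (z - y) / (x - y))" for z
    unfolding L_def poly_sum poly_smult poly_prod prod_dividef by (simp add: divide_inverse mult.commute)
  have card: "card S > 0" using S by (simp add: card_gt_0_iff)
  have "degree L \<le> card S - 1" unfolding L_def
  proof (rule degree_sum_le[OF S(1)])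
    fix x assume x: "x \<in> S"
    have "degree (\<Prod>y\<in>S - {x}. [:-y, 1:]) \<le> (\<Sum>y\<in>S - {x}. 1)"
      by (rule order_trans[OF degree_prod_sum_le]) (use S in \<open>auto\<close>)
    then show "degree (smult (inverse (\<Prod>y\<in>S - {x}. x - y)) (\<Prod>y\<in>S - {x}. [:-y, 1:])) \<le> card S - 1"
      using x S by (intro order_trans[OF degree_smult_le]) simp
  qed
  then have deg: "degree L < card S" using card by linarith
  have "poly L z = poly 1 z" if z: "z \<in> S" for z
  proof -
    have "(\<Prod>y\<in>S - {x}. (z - y) / (x - y)) = (if x = z then 1 else 0)" if "x \<in> S" for x
      using z S that by (auto intro!: prod.neutral)
    then show ?thesis unfolding ev using S z by simp
  qed
  then have "L = 1" using deg card by (intro poly_eqI_degree[of S]) auto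
  then show ?thesis using ev[of z] by simp
qed

text \<open>The Lagrange basis polynomials sum to 1, so they cannot all be small at
  \<open>z\<close>. Their numerators are the full product of distances divided by at least
  \<open>d\<close>, and the balance condition bounds their denominators below.\<close>

lemma sum_ln_balanced_ge:
  fixes S :: "complex set"
  assumes S: "finite S" "S \<noteq> {}" and b: "\<And>x. x \<in> S \<Longrightarrow> b \<le> (\<Sum>y\<in>S - {x}. ln (cmod (x - y)))"
    and d: "d > 0" "\<And>x. x \<in> S \<Longrightarrow> d \<le> cmod (z - x)"
  shows "b + ln d - ln (card S) \<le> (\<Sum>x\<in>S. ln (cmod (z - x)))"
proof -
  define U where "U = (\<Sum>x\<in>S. ln (cmod (z - x)))"
  have zS: "z \<noteq> x" if "x \<in> S" for x using d that by force
  have "1 = cmod (\<Sum>x\<in>S. \<Prod>y\<in>S - {x}. (z - y) / (x - y))" by (simp add: lagrange_one[OF S])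
  also have "\<dots> \<le> (\<Sum>x\<in>S. exp (U - ln d - b))"
  proof (rule sum_norm_le)
    fix x assume x: "x \<in> S"
    have "cmod (\<Prod>y\<in>S - {x}. (z - y) / (x - y)) = (\<Prod>y\<in>S - {x}. exp (ln (cmod (z - y)) - ln (cmod (x - y))))"
      unfolding prod_norm[symmetric] using zS by (intro prod.cong refl) (auto simp: norm_divide exp_diff)
    also have "\<dots> = exp ((\<Sum>y\<in>S - {x}. ln (cmod (z - y))) - (\<Sum>y\<in>S - {x}. ln (cmod (x - y))))"
      using S by (simp add: exp_sum[symmetric] sum_subtractf)
    also have "\<dots> \<le> exp (U - ln d - b)"
    proof -
      have "U = ln (cmod (z - x)) + (\<Sum>y\<in>S - {x}. ln (cmod (z - y)))" unfolding U_def using S x by (simp add: sum.remove)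
      moreover have "ln d \<le> ln (cmod (z - x))" using d x by (intro ln_mono) auto
      ultimately show ?thesis using b[OF x] by simp
    qed
    finally show "cmod (\<Prod>y\<in>S - {x}. (z - y) / (x - y)) \<le> exp (U - ln d - b)" .
  qed
  also have "\<dots> = exp (ln (card S) + (U - ln d - b))" using S by (simp add: exp_add card_gt_0_iff)
  finally have "0 \<le> ln (card S) + (U - ln d - b)" by simp
  then show ?thesis by (simp add: U_def)
qed

text \<open>Balanced sets converge weakly to the equilibrium measure, and at a fixed
  \<open>z\<close> off \<open>C\<close> the interpolation bound, divided by the number of points,
  tends to \<open>c\<close>.\<close>

lemma equilibrium_potential_ge:
  assumes C: "compact C" and c: "log_energy (equilibrium_measure C) = ereal c"
    and eq: "equilibrium_measure C \<in> borel_probs_on C" and z: "z \<notin> C"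
  shows "c \<le> potential (equilibrium_measure C) z"
proof -
  define \<omega> where "\<omega> = equilibrium_measure C"
  note c = c[folded \<omega>_def] and eq = eq[folded \<omega>_def]
  have max: "maximizes_energy C \<omega>" unfolding \<omega>_def
    by (rule equilibrium_measure_maximizes(1)[OF C eq]) (simp add: c)
  have cl: "closed C" using C compact_imp_closed by auto
  obtain d where d: "d > 0" "\<And>w. w \<in> C \<Longrightarrow> d \<le> cmod (z - w)"
    using distance_to_closed[OF cl z] by blast
  have "\<forall>m. \<exists>S. finite S \<and> S \<subseteq> C \<and> card S \<ge> Suc m \<and>
      (\<forall>x\<in>S. (\<Sum>y\<in>S - {x}. ln (cmod (x - y))) \<ge> (real (card S) - 1) * (c - 1 / Suc m))"
    using exists_balanced_set[OF C eq c] by simp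
  from choice[OF this] obtain S where S: "\<And>m. finite (S m)" "\<And>m. S m \<subseteq> C" "\<And>m. card (S m) \<ge> Suc m"
    and bal: "\<And>m x. x \<in> S m \<Longrightarrow> (\<Sum>y\<in>S m - {x}. ln (cmod (x - y))) \<ge> (real (card (S m)) - 1) * (c - 1 / Suc m)" by blast
  have ne: "S m \<noteq> {}" for m using S(3)[of m] by auto
  have inf: "filterlim (\<lambda>m. card (S m)) at_top sequentially"
    by (rule filterlim_at_top_mono[OF filterlim_Suc]) (use S(3) in auto)
  have b: "(\<lambda>m. c - 1 / real (Suc m)) \<longlonglongrightarrow> c"
    using tendsto_diff[OF tendsto_const LIMSEQ_Suc[OF lim_1_over_n], of c] by simp
  have ps: "pair_sum (S m) \<ge> real (card (S m)) * (real (card (S m)) - 1) * (c - 1 / real (Suc m))" for m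
  proof -
    have "(\<Sum>x\<in>S m. (real (card (S m)) - 1) * (c - 1 / Suc m)) \<le> pair_sum (S m)"
      unfolding pair_sum_def by (intro sum_mono bal)
    then show ?thesis by (simp add: mult.assoc)
  qed
  obtain r \<nu> where r: "strict_mono (r :: nat \<Rightarrow> nat)" "\<nu> \<in> borel_probs_on C"
    "bounded_weak_conv ((\<lambda>m. uniform_on (S m) (\<lambda>x. x)) \<circ> r) \<nu>" "ereal c \<le> log_energy \<nu>"
    by (rule discrete_energy_limit[OF C S(1,2) ne inf ps b])
  \<comment> \<open>The limit of the balanced sets has energy at least \<open>c\<close>, and
    uniqueness identifies it with \<open>\<omega>\<close>.\<close>
  have "maximizes_energy C \<nu>" unfolding maximizes_energy_def
  proof (intro conjI ballI)
    fix \<theta> assume "\<theta> \<in> borel_probs_on C"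
    then have "log_energy \<theta> \<le> ereal c" using max c by (simp add: maximizes_energy_def)
    then show "log_energy \<theta> \<le> log_energy \<nu>" using r(4) by (rule order_trans)
  qed (rule r)
  then have \<nu>: "\<nu> = \<omega>" unfolding \<omega>_def using r(4) by (intro equilibrium_measure_eqI[OF C]) auto
  define t where "t w = ln (max d (cmod (z - w)))" for w
  have tc: "continuous_on UNIV t" unfolding t_def
    using continuous_on_section[OF continuous_trunc_log[OF d(1)], of z] .
  have lim: "(\<lambda>j. \<integral>w. t w \<partial>uniform_on (S (r j)) (\<lambda>x. x)) \<longlonglongrightarrow> potential \<omega> z"
  proof -
    have "potential \<omega> z = (\<integral>w. t w \<partial>\<omega>)" unfolding t_def by (rule potential_eq_trunc[OF eq cl d(2)])
    then show ?thesis
      using r(3)[unfolded bounded_weak_conv_def \<nu>, rule_format, OF tc] by (simp add: o_def)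
  qed
  define n where "n m = real (card (S m))" for m
  have npos: "n m > 0" for m using S(3)[of m] by (simp add: n_def)
  define g where "g m = (1 - inverse (n m)) * (c - 1 / real (Suc m)) + ln d * inverse (n m) - ln (n m) / n m" for m
  have lb: "g m \<le> (\<integral>w. t w \<partial>uniform_on (S m) (\<lambda>x. x))" for m
  proof -
    have "(\<integral>w. t w \<partial>uniform_on (S m) (\<lambda>x. x)) = (\<Sum>x\<in>S m. t x) / n m"
      unfolding n_def by (rule uniform_on_integral[OF S(1) ne tc])
    also have "(\<Sum>x\<in>S m. t x) = (\<Sum>x\<in>S m. ln (cmod (z - x)))"
      using d(2) S(2)[of m] by (intro sum.cong refl) (auto simp: t_def max_absorb2 subset_iff)
    finally have "(\<integral>w. t w \<partial>uniform_on (S m) (\<lambda>x. x)) = (\<Sum>x\<in>S m. ln (cmod (z - x))) / n m" .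
    moreover have "((n m - 1) * (c - 1 / real (Suc m)) + ln d - ln (n m)) / n m \<le> (\<Sum>x\<in>S m. ln (cmod (z - x))) / n m"
      unfolding n_def
      by (intro divide_right_mono sum_ln_balanced_ge[OF S(1) ne bal d(1)]) (use d S(2) in auto)
    moreover have "((n m - 1) * (c - 1 / real (Suc m)) + ln d - ln (n m)) / n m
      = g m"
      unfolding g_def using npos[of m] by (simp add: divide_simps)
    ultimately show ?thesis by simp
  qed
  have nlim: "filterlim n at_top sequentially"
    unfolding n_def by (rule filterlim_compose[OF filterlim_real_sequentially inf])
  have lnn: "(\<lambda>m. ln (n m) / n m) \<longlonglongrightarrow> 0"
  proof -
    have "((\<lambda>x::real. ln x / x) \<longlongrightarrow> 0) at_top" by real_asymp
    from filterlim_compose[OF this nlim] show ?thesis .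
  qed
  have "g \<longlonglongrightarrow> (1 - 0) * c + ln d * 0 - 0"
    unfolding g_def[abs_def] by (intro tendsto_intros b lnn tendsto_inverse_0_at_top nlim)
  then have "(g \<circ> r) \<longlonglongrightarrow> c"
    using LIMSEQ_subseq_LIMSEQ[OF _ r(1)] by force
  from tendsto_le[OF _ lim this] lb show ?thesis unfolding \<omega>_def by (simp add: o_def)
qed

subsection \<open>Potentials off the support\<close>

text \<open>The complex gradient of \<open>potential\<close>. It is holomorphic off the support,
  which makes the identity theorem available for potentials.\<close>

definition cauchy_transform :: "complex measure \<Rightarrow> complex \<Rightarrow> complex" where
  "cauchy_transform \<mu> z = (\<integral>w. 1 / (z - w) \<partial>\<mu>)"

lemma borel_probs_on_integrable_bound:
  fixes f :: "complex \<Rightarrow> 'b :: {banach, second_countable_topology}"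
  assumes \<mu>: "\<mu> \<in> borel_probs_on C" "closed C" and f: "f \<in> borel_measurable borel" "\<And>w. w \<in> C \<Longrightarrow> norm (f w) \<le> B"
  shows "integrable \<mu> f" "norm (\<integral>w. f w \<partial>\<mu>) \<le> B"
proof -
  note d = borel_probs_onD[OF \<mu>]
  interpret prob_space \<mu> by (rule d)
  have m: "f \<in> borel_measurable \<mu>" using f by (simp add: measurable_cong_sets[OF d(1) refl])
  have ae: "AE w in \<mu>. norm (f w) \<le> B" using d(4) by eventually_elim (rule f)
  show i: "integrable \<mu> f" using ae m by (rule integrable_const_bound)
  have "norm (\<integral>w. f w \<partial>\<mu>) \<le> (\<integral>w. norm (f w) \<partial>\<mu>)" by (rule integral_norm_bound)
  also have "\<dots> \<le> (\<integral>w. B \<partial>\<mu>)" using i ae by (intro integral_mono_AE) auto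
  finally show "norm (\<integral>w. f w \<partial>\<mu>) \<le> B" by (simp add: prob_space)
qed

lemma cauchy_transform_has_derivative:
  assumes \<mu>: "\<mu> \<in> borel_probs_on C" "closed C" and z: "z \<notin> C"
  shows "(cauchy_transform \<mu> has_field_derivative - (\<integral>w. 1 / (z - w)^2 \<partial>\<mu>)) (at z)"
proof -
  obtain d where d: "d > 0" "\<And>w. w \<in> C \<Longrightarrow> d \<le> cmod (z - w)"
    using distance_to_closed[OF \<mu>(2) z] by blast
  define D where "D = - (\<integral>w. 1 / (z - w)^2 \<partial>\<mu>)"
  have i0: "integrable \<mu> (\<lambda>w. 1 / (z - w))"
    by (rule borel_probs_on_integrable_bound[OF \<mu>, of _ "1 / d"]) (use d in \<open>auto simp: norm_divide intro!: divide_left_mono mult_pos_pos intro: less_le_trans\<close>)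
  have i2: "integrable \<mu> (\<lambda>w. 1 / (z - w)^2)"
  proof (rule borel_probs_on_integrable_bound[OF \<mu>, of _ "1 / d^2"])
    fix w assume "w \<in> C"
    then have "d^2 \<le> (cmod (z - w))^2" using d by (intro power_mono) auto
    then show "cmod (1 / (z - w)^2) \<le> 1 / d^2" using d by (simp add: norm_divide norm_power frac_le)
  qed measurable
  have "(cauchy_transform \<mu> has_derivative (*) D) (at z within UNIV)"
  proof (rule has_derivativeI_sandwich[where e = "d/2" and H = "\<lambda>y. 2 / d^3 * cmod (y - z)"])
    fix y assume y: "y \<noteq> z" "dist y z < d/2"
    define h where "h = y - z"
    have h: "cmod h < d/2" "h \<noteq> 0" using y by (auto simp: h_def dist_norm)
    \<comment> \<open>An increment below \<open>d/2\<close> keeps \<open>y\<close> at distance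
      \<open>d/2\<close> from \<open>C\<close>; the constant \<open>2 / d^3\<close> is the
      reciprocal of \<open>d/2 * d^2\<close>.\<close>
    have lo: "d/2 \<le> cmod (y - w)" if "w \<in> C" for w
    proof -
      have "cmod (z - w) \<le> cmod (y - w) + cmod h" using norm_triangle_ineq4[of "y - w" h] by (simp add: h_def)
      then show ?thesis using d(2)[OF that] h by linarith
    qed
    have iy: "integrable \<mu> (\<lambda>w. 1 / (y - w))"
    proof (rule borel_probs_on_integrable_bound[OF \<mu>, of _ "1 / (d/2)"])
      fix w assume w: "w \<in> C"
      show "cmod (1 / (y - w)) \<le> 1 / (d/2)"
        unfolding norm_divide norm_one by (rule frac_le) (use d(1) lo[OF w] in auto)
    qed measurable
    have "cauchy_transform \<mu> y - cauchy_transform \<mu> z - D * h = (\<integral>w. 1 / (y - w) - 1 / (z - w) + h * (1 / (z - w)^2) \<partial>\<mu>)"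
    proof -
      have "(\<integral>w. a w - b w + h * c w \<partial>\<mu>) = (\<integral>w. a w \<partial>\<mu>) - (\<integral>w. b w \<partial>\<mu>) + h * (\<integral>w. c w \<partial>\<mu>)"
        if "integrable \<mu> a" "integrable \<mu> b" "integrable \<mu> c" for a b c :: "complex \<Rightarrow> complex"
        using that by simp
      from this[OF iy i0 i2] show ?thesis unfolding cauchy_transform_def D_def by (simp only: mult.commute) simp
    qed
    also have "cmod \<dots> \<le> 2 / d^3 * (cmod h)^2"
    proof (rule borel_probs_on_integrable_bound(2)[OF \<mu>])
      fix w assume w: "w \<in> C"
      have n0: "y - w \<noteq> 0" "z - w \<noteq> 0" using lo[OF w] d(2)[OF w] d(1) by auto
      have "1 / (y - w) - 1 / (z - w) + h * (1 / (z - w)^2) = h^2 / ((y - w) * (z - w)^2)"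
      proof -
        have "1 / Y - 1 / Z + (Y - Z) * (1 / Z^2) = (Y - Z)^2 / (Y * Z^2)" if "Y \<noteq> 0" "Z \<noteq> 0" for Y Z :: complex
          using that by (simp add: divide_simps power2_eq_square) (simp add: algebra_simps)
        from this[OF n0] show ?thesis by (simp add: h_def)
      qed
      also have "cmod \<dots> = (cmod h)^2 / (cmod (y - w) * (cmod (z - w))^2)" by (simp add: norm_divide norm_mult norm_power)
      also have "\<dots> \<le> (cmod h)^2 / (d/2 * d^2)"
        using lo[OF w] d(2)[OF w] d(1) by (intro divide_left_mono mult_mono power_mono mult_pos_pos) auto
      also have "\<dots> = 2 / d^3 * (cmod h)^2" using d(1) by (simp add: power2_eq_square power3_eq_cube field_simps)
      finally show "cmod (1 / (y - w) - 1 / (z - w) + h * (1 / (z - w)^2)) \<le> 2 / d^3 * (cmod h)^2" .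
    qed measurable
    finally have "cmod (cauchy_transform \<mu> y - cauchy_transform \<mu> z - D * h) \<le> 2 / d^3 * (cmod h)^2" .
    then show "norm (cauchy_transform \<mu> y - cauchy_transform \<mu> z - D * (y - z)) / norm (y - z) \<le> 2 / d^3 * cmod (y - z)"
      using h by (simp add: h_def[symmetric] divide_le_eq power2_eq_square mult.assoc)
  next
    have "((\<lambda>y. 2 / d^3 * cmod (y - z)) \<longlongrightarrow> 2 / d^3 * cmod (z - z)) (at z)" by (intro tendsto_intros)
    then show "((\<lambda>y. 2 / d^3 * cmod (y - z)) \<longlongrightarrow> 0) (at z)" by simp
  qed (use d in \<open>auto simp: bounded_linear_mult_right\<close>)
  then show ?thesis by (simp add: has_field_derivative_def D_def)
qed

lemma cauchy_transform_holomorphic: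
  assumes "\<mu> \<in> borel_probs_on C" "closed C"
  shows "cauchy_transform \<mu> holomorphic_on - C"
  using cauchy_transform_has_derivative[OF assms] assms(2)
  by (auto simp: holomorphic_on_open open_Compl)

lemma ln_cmod_one_plus:
  assumes "cmod u \<le> 1/2" shows "\<bar>ln (cmod (1 + u)) - Re u\<bar> \<le> 2 * (cmod u)^2"
proof -
  have "1 + u \<noteq> 0"
  proof
    assume "1 + u = 0"
    then have "u = -1" by (simp add: add_eq_0_iff)
    then show False using assms by simp
  qed
  then have "ln (cmod (1 + u)) - Re u = Re (Ln (1 + u) - u)" by (simp add: Re_Ln)
  also have "\<bar>\<dots>\<bar> \<le> cmod (Ln (1 + u) - u)" by (rule abs_Re_le_cmod)
  also have "\<dots> \<le> (cmod u)^2 / (1 - cmod u)" by (rule Ln_approx_linear) (use assms in simp)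
  also have "\<dots> \<le> (cmod u)^2 / (1/2)" using assms by (intro divide_left_mono) auto
  finally show ?thesis by simp
qed

lemma potential_has_derivative:
  assumes \<mu>: "\<mu> \<in> borel_probs_on C" "compact C" and z: "z \<notin> C"
  shows "(potential \<mu> has_derivative (\<lambda>h. Re (cauchy_transform \<mu> z * h))) (at z)"
proof -
  have cl: "closed C" using \<mu> compact_imp_closed by auto
  obtain d where d: "d > 0" "\<And>w. w \<in> C \<Longrightarrow> d \<le> cmod (z - w)"
    using distance_to_closed[OF cl z] by blast
  obtain R where R: "R > 0" "C \<subseteq> cball 0 R"
    by (rule compact_subset_cball[OF \<mu>(2)])
  have i0: "integrable \<mu> (\<lambda>w. 1 / (z - w))"
    by (rule borel_probs_on_integrable_bound[OF \<mu>(1) cl, of _ "1 / d"]) (use d in \<open>auto simp: norm_divide intro!: frac_le\<close>)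
  have iln: "integrable \<mu> (\<lambda>w. ln (cmod (y - w)))" if lo: "e > 0" "\<And>w. w \<in> C \<Longrightarrow> e \<le> cmod (y - w)" for y e
  proof (rule borel_probs_on_integrable_bound[OF \<mu>(1) cl, of _ "\<bar>ln e\<bar> + \<bar>ln (cmod y + R)\<bar>"])
    fix w assume w: "w \<in> C"
    have "cmod (y - w) \<le> cmod y + R" using norm_triangle_ineq4[of y w] w R by force
    then have "ln (cmod (y - w)) \<le> ln (cmod y + R)" "ln e \<le> ln (cmod (y - w))"
      using lo(1) lo(2)[OF w] by (auto intro!: ln_mono)
    then show "norm (ln (cmod (y - w))) \<le> \<bar>ln e\<bar> + \<bar>ln (cmod y + R)\<bar>" unfolding real_norm_def by linarith
  qed measurable
  have "(potential \<mu> has_derivative (\<lambda>h. Re (cauchy_transform \<mu> z * h))) (at z within UNIV)"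
  proof (rule has_derivativeI_sandwich[where e = "d/2" and H = "\<lambda>y. 2 / d^2 * cmod (y - z)"])
    show "bounded_linear (\<lambda>h. Re (cauchy_transform \<mu> z * h))"
      by (intro bounded_linear_compose[OF bounded_linear_Re] bounded_linear_mult_right)
    fix y assume y: "y \<noteq> z" "dist y z < d/2"
    define h where "h = y - z"
    have h: "cmod h < d/2" "h \<noteq> 0" using y by (auto simp: h_def dist_norm)
    have lo: "d/2 \<le> cmod (y - w)" if "w \<in> C" for w
    proof -
      have "cmod (z - w) \<le> cmod (y - w) + cmod h" using norm_triangle_ineq4[of "y - w" h] by (simp add: h_def)
      then show ?thesis using d(2)[OF that] h by linarith
    qed
    have iy: "integrable \<mu> (\<lambda>w. ln (cmod (y - w)))" by (rule iln[OF _ lo]) (use d in auto)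
    have iz: "integrable \<mu> (\<lambda>w. ln (cmod (z - w)))" by (rule iln[OF d])
    have "Re (cauchy_transform \<mu> z * h) = (\<integral>w. Re (1 / (z - w) * h) \<partial>\<mu>)"
    proof -
      have "cauchy_transform \<mu> z * h = (\<integral>w. 1 / (z - w) * h \<partial>\<mu>)" unfolding cauchy_transform_def
        by (rule Bochner_Integration.integral_mult_left[symmetric]) (rule i0)
      moreover have "(\<integral>w. Re (1 / (z - w) * h) \<partial>\<mu>) = Re (\<integral>w. 1 / (z - w) * h \<partial>\<mu>)"
        by (rule integral_Re) (intro Bochner_Integration.integrable_mult_left impI i0)
      ultimately show ?thesis by (simp only:)
    qed
    then have "potential \<mu> y - potential \<mu> z - Re (cauchy_transform \<mu> z * h) = 
      (\<integral>w. ln (cmod (y - w)) - ln (cmod (z - w)) - Re (1 / (z - w) * h) \<partial>\<mu>)"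
    proof -
      have "(\<integral>w. a w - b w - c w \<partial>\<mu>) = (\<integral>w. a w \<partial>\<mu>) - (\<integral>w. b w \<partial>\<mu>) - (\<integral>w. c w \<partial>\<mu>)"
        if "integrable \<mu> a" "integrable \<mu> b" "integrable \<mu> c" for a b c :: "complex \<Rightarrow> real"
        using that by simp
      moreover have "integrable \<mu> (\<lambda>w. Re (1 / (z - w) * h))"
        by (intro integrable_Re Bochner_Integration.integrable_mult_left impI i0)
      ultimately have "(\<integral>w. ln (cmod (y - w)) - ln (cmod (z - w)) - Re (1 / (z - w) * h) \<partial>\<mu>)
        = potential \<mu> y - potential \<mu> z - (\<integral>w. Re (1 / (z - w) * h) \<partial>\<mu>)"
        unfolding potential_def using iy iz by blast
      then show ?thesis by (simp only: \<open>Re (cauchy_transform \<mu> z * h) = (\<integral>w. Re (1 / (z - w) * h) \<partial>\<mu>)\<close>)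
    qed
    also have "\<bar>\<dots>\<bar> \<le> 2 / d^2 * (cmod h)^2"
      unfolding real_norm_def[symmetric]
    proof (rule borel_probs_on_integrable_bound(2)[OF \<mu>(1) cl])
      fix w assume w: "w \<in> C"
      have n0: "y - w \<noteq> 0" "z - w \<noteq> 0" using lo[OF w] d(2)[OF w] d(1) by auto
      \<comment> \<open>The difference of logarithms is \<open>ln (cmod (1 + u))\<close>, whose
        linear part is \<open>Re u\<close> and whose quadratic error is uniform in
        \<open>w\<close>.\<close>
      define u where "u = h / (z - w)"
      have cu: "cmod u \<le> cmod h / d" unfolding u_def norm_divide using d(2)[OF w] d(1) by (intro divide_left_mono mult_pos_pos) auto
      also have "\<dots> \<le> 1/2" using h d(1) by (simp add: field_simps)
      finally have u2: "cmod u \<le> 1/2" .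
      have "y - w = (z - w) * (1 + u)" using n0 by (simp add: u_def h_def field_simps)
      moreover have "1 + u \<noteq> 0" using n0 calculation by auto
      ultimately have "ln (cmod (y - w)) = ln (cmod (z - w)) + ln (cmod (1 + u))"
        using n0 by (simp add: norm_mult ln_mult_pos)
      then have "\<bar>ln (cmod (y - w)) - ln (cmod (z - w)) - Re (1 / (z - w) * h)\<bar> = \<bar>ln (cmod (1 + u)) - Re u\<bar>"
        by (simp add: u_def)
      also have "\<dots> \<le> 2 * (cmod u)^2" by (rule ln_cmod_one_plus[OF u2])
      also have "\<dots> \<le> 2 * (cmod h / d)^2" using cu by (intro mult_left_mono power_mono) auto
      finally show "norm (ln (cmod (y - w)) - ln (cmod (z - w)) - Re (1 / (z - w) * h)) \<le> 2 / d^2 * (cmod h)^2"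
        by (simp add: power_divide)
    qed measurable
    finally have "\<bar>potential \<mu> y - potential \<mu> z - Re (cauchy_transform \<mu> z * h)\<bar> \<le> 2 / d^2 * (cmod h)^2" .
    then show "norm (potential \<mu> y - potential \<mu> z - Re (cauchy_transform \<mu> z * (y - z))) / norm (y - z) \<le> 2 / d^2 * cmod (y - z)"
      using h by (simp add: h_def[symmetric] divide_le_eq power2_eq_square mult.assoc)
  next
    have "((\<lambda>y. 2 / d^2 * cmod (y - z)) \<longlongrightarrow> 2 / d^2 * cmod (z - z)) (at z)" by (intro tendsto_intros)
    then show "((\<lambda>y. 2 / d^2 * cmod (y - z)) \<longlongrightarrow> 0) (at z)" by simp
  qed (use d in auto)
  then show ?thesis by simp
qed

text \<open>These bounds stand in for the asymptotics \<open>ln (cmod z)\<close> at infinity. They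
  depend on the radius only, hence are uniform in the measure.\<close>

lemma potential_bounds:
  assumes \<mu>: "\<mu> \<in> borel_probs_on C" "compact C" and R: "C \<subseteq> cball 0 R" and z: "cmod z > R"
  shows "ln (cmod z - R) \<le> potential \<mu> z" "potential \<mu> z \<le> ln (cmod z + R)"
proof -
  have cl: "closed C" using \<mu> compact_imp_closed by auto
  define d where "d = cmod z - R"
  have d: "d > 0" using z by (simp add: d_def)
  have lo: "d \<le> cmod (z - w)" if "w \<in> C" for w
    using norm_triangle_ineq2[of z w] that R by (force simp: d_def)
  have hi: "cmod (z - w) \<le> cmod z + R" if "w \<in> C" for w
    using norm_triangle_ineq4[of z w] that R by force
  interpret prob_space \<mu> using \<mu> by (simp add: borel_probs_on_def)
  note c = continuous_on_section[OF continuous_trunc_log[OF d], of z]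
  have pe: "potential \<mu> z = (\<integral>w. ln (max d (cmod (z - w))) \<partial>\<mu>)" by (rule potential_eq_trunc[OF \<mu>(1) cl lo])
  have "(\<integral>w. ln (cmod z - R) \<partial>\<mu>) \<le> (\<integral>w. ln (max d (cmod (z - w))) \<partial>\<mu>)"
    by (rule borel_probs_on_integral_le[OF \<mu> continuous_on_const c]) (use d in \<open>auto simp: d_def\<close>)
  then show "ln (cmod z - R) \<le> potential \<mu> z"
    unfolding pe by (simp add: prob_space)
  have "(\<integral>w. ln (max d (cmod (z - w))) \<partial>\<mu>) \<le> (\<integral>w. ln (cmod z + R) \<partial>\<mu>)"
  proof (rule borel_probs_on_integral_le[OF \<mu> c continuous_on_const])
    fix w assume w: "w \<in> C"
    show "ln (max d (cmod (z - w))) \<le> ln (cmod z + R)"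
      using lo[OF w] hi[OF w] d by (intro ln_mono) auto
  qed
  then show "potential \<mu> z \<le> ln (cmod z + R)"
    unfolding pe by (simp add: prob_space)
qed

text \<open>The identity theorem is applied to the Cauchy transforms. Equal gradients on the
  connected complement leave a constant difference, which is 0 near infinity.\<close>

lemma potential_unique_continuation:
  assumes C: "compact C" "connected (- C)" and \<mu>: "\<mu> \<in> borel_probs_on C" "\<nu> \<in> borel_probs_on C"
    and eq: "\<And>z. cmod z > R \<Longrightarrow> potential \<mu> z = potential \<nu> z" and z: "z \<notin> C"
  shows "potential \<mu> z = potential \<nu> z"
proof -
  have cl: "closed C" using C compact_imp_closed by auto
  obtain R0 where R0: "R0 > 0" "C \<subseteq> cball 0 R0"
    by (rule compact_subset_cball[OF C(1)])
  define r where "r = max R R0"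
  define U where "U = - cball (0::complex) r"
  have U: "open U" "U \<subseteq> - C" unfolding U_def r_def using R0 by (auto intro: order_trans)
  have pt: "complex_of_real (r + 1) \<in> U" using R0 by (simp add: U_def r_def)
  define f where "f z = potential \<mu> z - potential \<nu> z" for z
  have fd: "(f has_derivative (\<lambda>h. Re ((cauchy_transform \<mu> z - cauchy_transform \<nu> z) * h))) (at z)" if "z \<notin> C" for z
    unfolding f_def using has_derivative_diff[OF potential_has_derivative[OF \<mu>(1) C(1) that] potential_has_derivative[OF \<mu>(2) C(1) that]]
    by (simp add: left_diff_distrib)
  have f0: "f z = 0" if "z \<in> U" for z using that eq by (simp add: f_def U_def r_def)
  have CU: "cauchy_transform \<mu> z = cauchy_transform \<nu> z" if z: "z \<in> U" for z
  proof -
    have "(f has_derivative (\<lambda>h. 0)) (at z)"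
      by (rule has_derivative_transform_within_open[OF has_derivative_const U(1) z]) (simp add: f0)
    then have "(\<lambda>h. Re ((cauchy_transform \<mu> z - cauchy_transform \<nu> z) * h)) = (\<lambda>h. 0)"
      using fd[of z] z U(2) by (intro has_derivative_unique[of f]) auto
    \<comment> \<open>Evaluating the differential at the conjugate of its coefficient gives the
      squared modulus of that coefficient.\<close>
    from fun_cong[OF this, of "cnj (cauchy_transform \<mu> z - cauchy_transform \<nu> z)"]
    have "(cmod (cauchy_transform \<mu> z - cauchy_transform \<nu> z))\<^sup>2 = 0"
      unfolding complex_norm_square[symmetric] Re_complex_of_real .
    then show ?thesis by simp
  qed
  have CE: "cauchy_transform \<mu> z = cauchy_transform \<nu> z" if "z \<notin> C" for z
    by (rule analytic_continuation_open[of U "- C"])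
       (use U pt C(2) cl that CU cauchy_transform_holomorphic \<mu> in \<open>auto simp: open_Compl\<close>)
  have "f z = f (complex_of_real (r + 1))"
  proof (rule has_derivative_zero_unique_connected[OF _ C(2)])
    show "(f has_derivative (\<lambda>x. 0)) (at x)" if "x \<in> - C" for x using fd[of x] CE[of x] that by simp
  qed (use z pt U cl in \<open>auto simp: open_Compl\<close>)
  then show ?thesis using f0[OF pt] by (simp add: f_def)
qed

text \<open>The minimum principle: a minimum attained off \<open>C\<close> makes the potential
  locally constant, then constant on the connected complement, against its growth at
  infinity.\<close>

lemma potential_strict_minimum:
  assumes C: "compact C" "connected (- C)" and \<mu>: "\<mu> \<in> borel_probs_on C"
    and ge: "\<And>z. z \<notin> C \<Longrightarrow> c \<le> potential \<mu> z" and z0: "z0 \<notin> C"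
  shows "c < potential \<mu> z0"
proof (rule ccontr)
  assume "\<not> c < potential \<mu> z0"
  then have p0: "potential \<mu> z0 = c" using ge[OF z0] by simp
  have cl: "closed C" using C compact_imp_closed by auto
  then have op: "open (- C)" by (simp add: open_Compl)
  obtain e where e: "e > 0" "ball z0 e \<subseteq> - C" using op z0 by (auto simp: open_contains_ball)
  define G where "G = cauchy_transform \<mu>"
  have Ghol: "G holomorphic_on - C" unfolding G_def by (rule cauchy_transform_holomorphic[OF \<mu> cl])
  \<comment> \<open>A primitive is taken on a disc only, since the complement of \<open>C\<close> is
    not simply connected. Its real part is the potential up to a constant.\<close>
  obtain H where H: "\<And>z. z \<in> ball z0 e \<Longrightarrow> (H has_field_derivative G z) (at z within ball z0 e)"
    using holomorphic_convex_primitive'[OF convex_ball open_ball holomorphic_on_subset[OF Ghol e(2)]] by blast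
  have H': "(H has_field_derivative G z) (at z)" if "z \<in> ball z0 e" for z
    using H[OF that] that by (simp add: at_within_open[OF _ open_ball])
  define f where "f z = potential \<mu> z - Re (H z)" for z
  have pd: "(potential \<mu> has_derivative (\<lambda>h. Re (G z * h))) (at z)" if "z \<notin> C" for z
    unfolding G_def by (rule potential_has_derivative[OF \<mu> C(1) that])
  have fd: "(f has_derivative (\<lambda>h. 0)) (at z)" if z: "z \<in> ball z0 e" for z
  proof -
    have "((\<lambda>z. Re (H z)) has_derivative (\<lambda>h. Re (G z * h))) (at z)"
      using H'[OF z] unfolding has_field_derivative_def by (rule has_derivative_Re)
    from has_derivative_diff[OF pd this] show ?thesis using z e unfolding f_def by auto
  qed
  have fc: "f z = f z0" if "z \<in> ball z0 e" for z
    by (rule has_derivative_zero_unique_connected[OF open_ball connected_ball fd]) (use that e in auto)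
  have Hhol: "H holomorphic_on ball z0 e" unfolding holomorphic_on_open[OF open_ball] using H' by blast
  \<comment> \<open>The modulus is \<open>exp (- Re (H z))\<close>, so a minimum of the potential is
    a maximum of this modulus.\<close>
  have "(\<lambda>z. exp (- H z)) constant_on ball z0 e"
  proof (rule maximum_modulus_principle[where U = "ball z0 e" and \<xi> = z0])
    show "(\<lambda>z. exp (- H z)) holomorphic_on ball z0 e" using Hhol by (intro holomorphic_intros)
    fix z assume z: "z \<in> ball z0 e"
    have "potential \<mu> z0 \<le> potential \<mu> z" using ge[of z] z e p0 by auto
    then have "Re (H z0) \<le> Re (H z)" using fc[OF z] by (simp add: f_def)
    then show "cmod (exp (- H z)) \<le> cmod (exp (- H z0))" by simp
  qed (use e in auto)
  then obtain k where k: "\<And>z. z \<in> ball z0 e \<Longrightarrow> exp (- H z) = k" unfolding constant_on_def by blast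
  have G0: "G z = 0" if z: "z \<in> ball z0 e" for z
  proof -
    have "((\<lambda>z. exp (- H z)) has_field_derivative exp (- H z) * - G z) (at z)"
      using H'[OF z] by (auto intro!: derivative_eq_intros)
    moreover have "((\<lambda>z. exp (- H z)) has_field_derivative 0) (at z)"
      by (rule has_field_derivative_transform_within_open[OF DERIV_const[of k] open_ball z]) (simp add: k)
    ultimately have "exp (- H z) * - G z = 0" by (rule DERIV_unique)
    then show ?thesis by simp
  qed
  have GC: "G z = 0" if "z \<notin> C" for z
    by (rule analytic_continuation_open[of "ball z0 e" "- C" G "\<lambda>_. 0"]) (use e op C(2) Ghol G0 that in auto)
  have const: "potential \<mu> z = c" if "z \<notin> C" for z
  proof -
    have "potential \<mu> z = potential \<mu> z0"
    proof (rule has_derivative_zero_unique_connected[OF op C(2)])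
      show "(potential \<mu> has_derivative (\<lambda>h. 0)) (at x)" if "x \<in> - C" for x using pd[of x] GC[of x] that by simp
    qed (use that z0 in auto)
    then show ?thesis using p0 by simp
  qed
  obtain R where R: "R > 0" "C \<subseteq> cball 0 R"
    by (rule compact_subset_cball[OF C(1)])
  \<comment> \<open>Chosen with \<open>cmod y - R = exp (c + 1)\<close>, so that the potential at
    \<open>y\<close> is at least \<open>c + 1\<close>.\<close>
  define y where "y = complex_of_real (R + exp (c + 1))"
  have cy: "cmod y = R + exp (c + 1)" using R by (simp add: y_def norm_of_real del: of_real_add)
  then have "y \<notin> C" using R by force
  moreover have "ln (cmod y - R) \<le> potential \<mu> y" by (rule potential_bounds[OF \<mu> C(1) R(2)]) (simp add: cy)
  ultimately show False using const cy by simp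
qed

subsection \<open>Zeros of polynomials\<close>

lemma borel_probs_on_mono:
  assumes "\<mu> \<in> borel_probs_on C" "closed C" "C \<subseteq> D" "closed D"
  shows "\<mu> \<in> borel_probs_on D"
proof -
  note d = borel_probs_onD[OF assms(1,2)]
  have "AE z in \<mu>. z \<in> D" using d(4) by eventually_elim (use assms in auto)
  then show ?thesis by (intro borel_probs_onI d assms)
qed

lemma zero_measure_exists:
  fixes q :: "complex poly"
  assumes n: "degree q > 0" and R: "{z. poly q z = 0} \<subseteq> cball 0 R"
  shows "\<exists>\<mu> \<in> borel_probs_on (cball 0 R). \<forall>h :: complex \<Rightarrow> real. continuous_on UNIV h \<longrightarrow>
    (\<integral>z. h z \<partial>\<mu>) = (\<Sum>x\<in>#proots q. h x) / degree q"
proof -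
  obtain xs where xs: "mset xs = proots q" using ex_mset by blast
  have len: "length xs = degree q" using size_proots_complex[of q] by (simp add: xs[symmetric])
  have q0: "q \<noteq> 0" using n by auto
  define \<mu> where "\<mu> = uniform_on {..<length xs} (\<lambda>i. xs ! i)"
  have ne: "{..<length xs} \<noteq> {}" using len n by auto
  have "(\<lambda>i. xs ! i) ` {..<length xs} \<subseteq> set xs" by auto
  also have "set xs = {z. poly q z = 0}" using q0 by (metis set_mset_mset xs set_count_proots)
  finally have "\<mu> \<in> borel_probs_on (cball 0 R)" unfolding \<mu>_def using R ne
    by (intro uniform_on_borel_probs) auto
  moreover have "(\<integral>z. h z \<partial>\<mu>) = (\<Sum>x\<in>#proots q. h x) / degree q" if h: "continuous_on UNIV h" for h :: "complex \<Rightarrow> real"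
  proof -
    have "(\<integral>z. h z \<partial>\<mu>) = (\<Sum>i<length xs. h (xs ! i)) / length xs"
      unfolding \<mu>_def using uniform_on_integral[OF _ ne h] by simp
    also have "(\<Sum>i<length xs. h (xs ! i)) = sum_list (map h xs)"
      by (simp add: sum_list_sum_nth atLeast0LessThan)
    also have "\<dots> = (\<Sum>x\<in>#proots q. h x)" by (simp add: xs[symmetric] sum_mset_sum_list[symmetric])
    finally show ?thesis by (simp add: len)
  qed
  ultimately show ?thesis by blast
qed

lemma prod_mset_eq_exp:
  fixes f :: "'a \<Rightarrow> real"
  assumes "\<And>x. x \<in># A \<Longrightarrow> f x > 0"
  shows "(\<Prod>x\<in>#A. f x) = exp (\<Sum>x\<in>#A. ln (f x))"
  using assms by (induction A) (auto simp: exp_add)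

lemma prod_mset_ge_power:
  fixes f :: "'a \<Rightarrow> real"
  assumes "\<And>x. x \<in># A \<Longrightarrow> c \<le> f x" "0 \<le> c"
  shows "c ^ size A \<le> (\<Prod>x\<in>#A. f x)"
  using assms
proof (induction A)
  case (add a A)
  have "c \<le> f a" "c ^ size A \<le> (\<Prod>x\<in>#A. f x)" using add by auto
  moreover have "0 \<le> f a" using calculation(1) add.prems(2) by simp
  ultimately have "c * c ^ size A \<le> f a * (\<Prod>x\<in>#A. f x)" using add.prems(2) by (intro mult_mono) auto
  then show ?case by simp
qed simp

text \<open>If all near zeros were farther away, their at most \<open>M\<close> factors would
  multiply to at least \<open>exp (- n \<delta>)\<close>, with \<open>n\<close> the degree. Leading
  coefficient and far factors give \<open>exp (2 n \<delta>)\<close> up to a bounded factor, and the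
  total would exceed \<open>r\<close>.\<close>

lemma near_zero_of_small_value:
  fixes q :: "complex poly" and c \<delta> :: real
  assumes n: "degree q > 0" and \<rho>: "\<rho> > 0" and M: "M > 0"
    and size: "size {#x \<in># proots q. x \<in> cball z0 (2 * \<rho>)#} \<le> M"
    and z: "z \<in> cball z0 \<rho>" "cmod (poly q z) \<le> r"
    and pot: "degree q * (c + 3 * \<delta>) \<le> (\<Sum>x\<in>#proots q. ln (max \<rho> (cmod (z - x))))"
    and a: "- (degree q * (c + \<delta>)) \<le> ln (cmod (lead_coeff q))"
    and big: "r * exp (M * \<bar>ln (3 * \<rho>)\<bar>) < exp (degree q * \<delta>)" and \<delta>: "\<delta> > 0"
  shows "\<exists>x \<in># {#x \<in># proots q. x \<in> cball z0 (2 * \<rho>)#}. cmod (z - x) \<le> exp (- (degree q * \<delta> / M))"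
proof (rule ccontr)
  assume no: "\<not> ?thesis"
  define Z1 where "Z1 = {#x \<in># proots q. x \<in> cball z0 (2 * \<rho>)#}"
  define Z2 where "Z2 = {#x \<in># proots q. x \<notin> cball z0 (2 * \<rho>)#}"
  define n where "n = real (degree q)"
  define B where "B = \<bar>ln (3 * \<rho>)\<bar>"
  have split: "proots q = Z1 + Z2" unfolding Z1_def Z2_def by (rule multiset_partition)
  have far: "\<rho> \<le> cmod (z - x)" if "x \<in># Z2" for x
  proof -
    have "dist z0 x > 2 * \<rho>" using that by (simp add: Z2_def)
    moreover have "dist z0 x \<le> dist z0 z + dist z x" by (rule dist_triangle)
    moreover have "dist z0 z \<le> \<rho>" using z by simp
    ultimately show ?thesis by (simp add: dist_norm)
  qed
  \<comment> \<open>A near zero contributes at most \<open>B\<close> to the truncated sum, and for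
    far zeros the truncation is inactive; hence the bound for the truncated sum passes to the far
    zeros with a loss of \<open>M * B\<close>.\<close>
  have near: "ln (max \<rho> (cmod (z - x))) \<le> B" if "x \<in># Z1" for x
  proof -
    have "dist z0 x \<le> 2 * \<rho>" using that by (simp add: Z1_def)
    moreover have "dist z x \<le> dist z0 z + dist z0 x" by (rule dist_triangle3)
    ultimately have "cmod (z - x) \<le> 3 * \<rho>" using z by (simp add: dist_norm)
    then have "ln (max \<rho> (cmod (z - x))) \<le> ln (3 * \<rho>)" using \<rho> by (intro ln_mono) auto
    then show ?thesis unfolding B_def by linarith
  qed
  have "(\<Sum>x\<in>#Z1. ln (max \<rho> (cmod (z - x)))) \<le> (\<Sum>x\<in>#Z1. B)" using near by (intro sum_mset_mono) auto
  also have "\<dots> = size Z1 * B" by (simp add: sum_mset_constant)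
  also have "\<dots> \<le> M * B" using size unfolding Z1_def[symmetric] by (intro mult_right_mono) (auto simp: B_def)
  finally have s1: "(\<Sum>x\<in>#Z1. ln (max \<rho> (cmod (z - x)))) \<le> M * B" .
  have s2: "(\<Sum>x\<in>#Z2. ln (max \<rho> (cmod (z - x)))) = (\<Sum>x\<in>#Z2. ln (cmod (z - x)))"
    using far by (intro arg_cong[where f = sum_mset] image_mset_cong) (simp add: max_absorb2)
  have S2: "n * (c + 3 * \<delta>) - M * B \<le> (\<Sum>x\<in>#Z2. ln (cmod (z - x)))"
    using pot s1 s2 unfolding split n_def by simp
  have "(\<Prod>x\<in>#Z2. cmod (z - x)) = exp (\<Sum>x\<in>#Z2. ln (cmod (z - x)))"
    by (rule prod_mset_eq_exp) (rule less_le_trans[OF \<rho> far])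
  then have "exp (n * (c + 3 * \<delta>) - M * B) \<le> (\<Prod>x\<in>#Z2. cmod (z - x))" using S2 by simp
  moreover have "exp (- (n * (c + \<delta>))) \<le> cmod (lead_coeff q)"
  proof -
    have "cmod (lead_coeff q) > 0" using n by auto
    then have "exp (ln (cmod (lead_coeff q))) = cmod (lead_coeff q)" by (rule exp_ln)
    moreover have "exp (- (n * (c + \<delta>))) \<le> exp (ln (cmod (lead_coeff q)))" using a by (simp add: n_def)
    ultimately show ?thesis by simp
  qed
  ultimately have "exp (- (n * (c + \<delta>))) * exp (n * (c + 3 * \<delta>) - M * B) \<le> cmod (lead_coeff q) * (\<Prod>x\<in>#Z2. cmod (z - x))"
    by (intro mult_mono) auto
  moreover have "exp (- (n * (c + \<delta>))) * exp (n * (c + 3 * \<delta>) - M * B) = exp (2 * n * \<delta> - M * B)"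
    by (simp add: exp_add[symmetric] algebra_simps)
  ultimately have lo2: "exp (2 * n * \<delta> - M * B) \<le> cmod (lead_coeff q) * (\<Prod>x\<in>#Z2. cmod (z - x))" by simp
  \<comment> \<open>Normalized so that \<open>\<tau> ^ M = exp (- (n * \<delta>))\<close>.\<close>
  define \<tau> where "\<tau> = exp (- (n * \<delta> / M))"
  have \<tau>1: "0 < \<tau>" "\<tau> \<le> 1" unfolding \<tau>_def using \<delta> M by (auto simp: n_def)
  have "exp (- (n * \<delta>)) = \<tau> ^ M" unfolding \<tau>_def using M by (simp add: exp_of_nat_mult[symmetric])
  also have "\<dots> \<le> \<tau> ^ size Z1" using \<tau>1 size unfolding Z1_def[symmetric] by (intro power_decreasing) auto
  also have "\<dots> \<le> (\<Prod>x\<in>#Z1. cmod (z - x))"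
    using no \<tau>1 unfolding Z1_def[symmetric] \<tau>_def n_def by (intro prod_mset_ge_power) (auto simp: not_le less_imp_le)
  finally have lo1: "exp (- (n * \<delta>)) \<le> (\<Prod>x\<in>#Z1. cmod (z - x))" .
  have "exp (- (n * \<delta>)) * exp (2 * n * \<delta> - M * B) \<le> (\<Prod>x\<in>#Z1. cmod (z - x)) * (cmod (lead_coeff q) * (\<Prod>x\<in>#Z2. cmod (z - x)))"
    by (rule mult_mono[OF lo1 lo2 order_trans[OF _ lo1]]) simp_all
  also have "\<dots> = cmod (poly q z)"
    unfolding poly_eq_prod_roots[of q z] norm_mult norm_prod_mset unfolding split by simp
  also have "\<dots> \<le> r" by (rule z)
  finally have "exp (n * \<delta> - M * B) \<le> r" by (simp add: exp_add[symmetric] algebra_simps)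
  then have "exp (n * \<delta> - M * B) * exp (M * B) \<le> r * exp (M * B)" by (intro mult_right_mono) auto
  then have "exp (n * \<delta>) \<le> r * exp (M * B)" by (simp add: exp_add[symmetric])
  then show False using big by (simp add: n_def B_def)
qed

lemma bounded_weak_conv_subseq:
  assumes "bounded_weak_conv \<mu> \<nu>" "strict_mono r"
  shows "bounded_weak_conv (\<mu> \<circ> r) \<nu>"
  unfolding bounded_weak_conv_def
proof (intro allI impI)
  fix f :: "complex \<Rightarrow> real" assume "continuous_on UNIV f"
  then have "(\<lambda>k. \<integral>z. f z \<partial>\<mu> k) \<longlonglongrightarrow> (\<integral>z. f z \<partial>\<nu>)" using assms(1) unfolding bounded_weak_conv_def by blast
  from LIMSEQ_subseq_LIMSEQ[OF this assms(2)]
  show "(\<lambda>k. \<integral>z. f z \<partial>(\<mu> \<circ> r) k) \<longlonglongrightarrow> (\<integral>z. f z \<partial>\<nu>)" by (simp add: o_def)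
qed

lemma potential_zero_measure:
  fixes q :: "complex poly"
  assumes n: "degree q > 0" and \<mu>: "\<mu> \<in> borel_probs_on (cball 0 R)"
    and int: "\<And>h :: complex \<Rightarrow> real. continuous_on UNIV h \<Longrightarrow> (\<integral>z. h z \<partial>\<mu>) = (\<Sum>x\<in>#proots q. h x) / degree q"
    and R: "{z. poly q z = 0} \<subseteq> cball 0 R" and z: "cmod z > R"
  shows "ln (cmod (poly q z)) / degree q = ln (cmod (lead_coeff q)) / degree q + potential \<mu> z"
proof -
  define d where "d = cmod z - R"
  have d: "d > 0" using z by (simp add: d_def)
  have lo: "d \<le> cmod (z - w)" if "w \<in> cball 0 R" for w
    using norm_triangle_ineq2[of z w] that by (simp add: d_def)
  have q0: "q \<noteq> 0" using n by auto
  have roots: "d \<le> cmod (z - x)" if "x \<in># proots q" for x using that q0 R by (intro lo) auto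
  have "potential \<mu> z = (\<integral>w. ln (max d (cmod (z - w))) \<partial>\<mu>)" by (rule potential_eq_trunc[OF \<mu> closed_cball lo])
  also have "\<dots> = (\<Sum>x\<in>#proots q. ln (max d (cmod (z - x)))) / degree q"
    by (rule int[OF continuous_on_section[OF continuous_trunc_log[OF d]]])
  also have "(\<Sum>x\<in>#proots q. ln (max d (cmod (z - x)))) = (\<Sum>x\<in>#proots q. ln (cmod (z - x)))"
    using roots by (intro arg_cong[where f = sum_mset] image_mset_cong) (simp add: max_absorb2)
  finally have p: "potential \<mu> z = (\<Sum>x\<in>#proots q. ln (cmod (z - x))) / degree q" .
  have "cmod (poly q z) = cmod (lead_coeff q) * exp (\<Sum>x\<in>#proots q. ln (cmod (z - x)))"
    unfolding poly_eq_prod_roots[of q z] norm_mult norm_prod_mset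
    by (subst prod_mset_eq_exp[OF less_le_trans[OF d roots]]) simp_all
  then have "ln (cmod (poly q z)) = ln (cmod (lead_coeff q)) + (\<Sum>x\<in>#proots q. ln (cmod (z - x)))"
    using q0 by (simp add: ln_mult_pos)
  then show ?thesis unfolding p by (simp add: add_divide_distrib)
qed

theorem theorem2:
  fixes K :: "complex set" and q :: "nat \<Rightarrow> complex poly" and r :: real
  assumes "compact K" and "\<not> polar K" and "polynomially_convex K"
    and "filterlim (\<lambda>k. degree (q k)) at_top sequentially"
    and "K_regular K q"
    and "centers_on q K"
    and "r > 0"
  shows "weak_star_converges
           (\<lambda>k. equilibrium_measure (poly (q k) -` cball 0 r))
           (equilibrium_measure K)"
proof -

  \<comment> \<open>Equilibrium potential and Green's function of \<open>K\<close>\<close>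
  note K = assms(1) and deg = assms(4) and r = assms(7)
  have Kc: "closed K" using K compact_imp_closed by auto
  have conn: "connected (- K)" using assms(3) by (simp add: polynomially_convex_def)
  define \<omega> where "\<omega> = equilibrium_measure K"
  obtain C \<mu>0 where C: "compact C" "C \<subseteq> K" "\<mu>0 \<in> borel_probs_on C" "log_energy \<mu>0 \<noteq> -\<infinity>"
    using assms(2) unfolding polar_def by blast
  have \<mu>0: "\<mu>0 \<in> borel_probs_on K" using borel_probs_on_mono[OF C(3) compact_imp_closed[OF C(1)] C(2) Kc] .
  have max: "maximizes_energy K \<omega>" and le: "log_energy \<mu>0 \<le> log_energy \<omega>"
    unfolding \<omega>_def by (rule equilibrium_measure_maximizes[OF K \<mu>0 C(4)])+
  then have \<omega>: "\<omega> \<in> borel_probs_on K" by (simp add: maximizes_energy_def)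
  obtain c where c: "log_energy \<omega> = ereal c"
    using log_energy_not_PInf[OF \<omega> K] le C(4) by (cases "log_energy \<omega>") auto
  have ge: "c \<le> potential \<omega> z" if "z \<notin> K" for z
    using equilibrium_potential_ge[OF K c[unfolded \<omega>_def] \<omega>[unfolded \<omega>_def] that] by (simp add: \<omega>_def)
  have gt: "c < potential \<omega> z" if "z \<notin> K" for z
    by (rule potential_strict_minimum[OF K conn \<omega> ge that])
  have green: "green_function K z = potential \<omega> z - c" if "z \<notin> K" for z
    using log_potential_eq_potential[OF \<omega> K that] c by (simp add: green_function_def \<omega>_def)

  \<comment> \<open>Radii and zero counting measures\<close>
  obtain R1 where R1: "R1 > 0" "K \<subseteq> ball 0 R1" and ul: "uniform_limit (- ball 0 R1)
      (\<lambda>k z. ln (cmod (poly (q k) z)) / real (degree (q k))) (green_function K) sequentially"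
    using assms(5) unfolding K_regular_def by blast
  obtain N R2 where R2: "R2 > 0" and zeros': "\<forall>k\<ge>N. {z. poly (q k) z = 0} \<subseteq> ball 0 R2"
    and few': "\<forall>L. closed L \<and> L \<inter> K = {} \<longrightarrow> (\<exists>M>0. \<forall>k\<ge>N. size {# z \<in># proots (q k). z \<in> L #} \<le> M)"
    using assms(6) unfolding centers_on_def by (elim conjE exE)
  have zeros: "{z. poly (q k) z = 0} \<subseteq> ball 0 R2" if "k \<ge> N" for k using zeros' that by simp
  have few: "\<exists>M>0. \<forall>k\<ge>N. size {# z \<in># proots (q k). z \<in> L #} \<le> M" if "closed L" "L \<inter> K = {}" for L
    using few' that by simp
  define R where "R = max R1 R2"
  have R: "R > 0" "K \<subseteq> cball 0 R" using R1 by (auto simp: R_def)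
  have zR: "{z. poly (q k) z = 0} \<subseteq> cball 0 R" if "k \<ge> N" for k using zeros[OF that] by (auto simp: R_def)
  define n where "n k = real (degree (q k))" for k
  have nlim: "filterlim n at_top sequentially" unfolding n_def
    by (rule filterlim_compose[OF filterlim_real_sequentially deg])
  define A where "A k = ln (cmod (lead_coeff (q k))) / n k" for k
  define W where "W k = poly (q k) -` cball 0 r" for k
  define \<Omega> where "\<Omega> k = equilibrium_measure (W k)" for k
  have "\<forall>\<^sub>F k in sequentially. 1 \<le> n k" using nlim by (simp add: filterlim_at_top)
  then have good: "\<forall>\<^sub>F k in sequentially. k \<ge> N \<and> degree (q k) > 0"
    using eventually_ge_at_top[of N] by eventually_elim (auto simp: n_def)
  \<comment> \<open>The guard makes the choice total; nothing is claimed for indices that are too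
    small.\<close>
  have "\<forall>k. \<exists>\<mu>. k \<ge> N \<and> degree (q k) > 0 \<longrightarrow> \<mu> \<in> borel_probs_on (cball 0 R) \<and>
      (\<forall>h :: complex \<Rightarrow> real. continuous_on UNIV h \<longrightarrow> (\<integral>z. h z \<partial>\<mu>) = (\<Sum>x\<in>#proots (q k). h x) / degree (q k))"
    using zero_measure_exists[OF _ zR] by blast
  from choice[OF this] obtain \<mu> where \<mu>: "\<And>k. k \<ge> N \<Longrightarrow> degree (q k) > 0 \<Longrightarrow> \<mu> k \<in> borel_probs_on (cball 0 R)"
    and \<mu>int: "\<And>k h. k \<ge> N \<Longrightarrow> degree (q k) > 0 \<Longrightarrow> continuous_on UNIV (h :: complex \<Rightarrow> real) \<Longrightarrow>
       (\<integral>z. h z \<partial>\<mu> k) = (\<Sum>x\<in>#proots (q k). h x) / degree (q k)" by blast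
  have lnq: "ln (cmod (poly (q k) z)) / n k = A k + potential (\<mu> k) z"
    if "k \<ge> N" "degree (q k) > 0" "cmod z > R" for k z
    unfolding n_def A_def by (rule potential_zero_measure[OF that(2) \<mu>[OF that(1,2)] \<mu>int[OF that(1,2)] zR[OF that(1)] that(3)])
  have reg: "(\<lambda>k. ln (cmod (poly (q k) z)) / n k) \<longlonglongrightarrow> potential \<omega> z - c" if z: "cmod z > R" for z
  proof -
    have "z \<in> - ball 0 R1" using z by (auto simp: R_def)
    moreover have "z \<notin> K" using z R by force
    ultimately show ?thesis using tendsto_uniform_limitI[OF ul, of z] green[of z] by (simp add: n_def)
  qed

  \<comment> \<open>Asymptotics of the leading coefficients\<close>
  have Alim: "A \<longlonglongrightarrow> - c"
  proof (rule tendstoI)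
    fix e :: real assume e: "e > 0"
    \<comment> \<open>At a single point far out all potentials of measures on the disc differ by
      less than \<open>e/2\<close>. This determines \<open>A k\<close> before anything is known
      about convergence of the zero measures.\<close>
    have "((\<lambda>x. ln (x + R) - ln (x - R)) \<longlongrightarrow> 0) at_top" by real_asymp
    then have "\<forall>\<^sub>F x in at_top. dist (ln (x + R) - ln (x - R)) 0 < e/2" using e by (intro tendstoD) auto
    then have "\<forall>\<^sub>F x in at_top. x > R \<and> dist (ln (x + R) - ln (x - R)) 0 < e/2"
      using eventually_gt_at_top[of R] by eventually_elim simp
    then obtain x where x: "x > R" "dist (ln (x + R) - ln (x - R)) 0 < e/2"
      by (auto dest!: eventually_happens)
    define z where "z = complex_of_real x"
    have cz: "cmod z = x" using x R by (simp add: z_def)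
    have "\<forall>\<^sub>F k in sequentially. dist (ln (cmod (poly (q k) z)) / n k) (potential \<omega> z - c) < e/2"
      using reg[of z] x e cz by (intro tendstoD) auto
    with good show "\<forall>\<^sub>F k in sequentially. dist (A k) (- c) < e"
    proof eventually_elim
      case (elim k)
      have "ln (cmod (poly (q k) z)) / n k = A k + potential (\<mu> k) z" using elim x cz by (intro lnq) auto
      moreover have "ln (x - R) \<le> potential (\<mu> k) z" "potential (\<mu> k) z \<le> ln (x + R)"
        using potential_bounds[OF \<mu> compact_cball order_refl, of k z] elim x cz by auto
      moreover have "ln (x - R) \<le> potential \<omega> z" "potential \<omega> z \<le> ln (x + R)"
        using potential_bounds[OF \<omega> K R(2), of z] x cz by auto
      ultimately show ?case using elim x(2) unfolding dist_real_def by linarith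
    qed
  qed
  have potlim: "(\<lambda>k. potential (\<mu> k) z) \<longlonglongrightarrow> potential \<omega> z" if z: "cmod z > R" for z
  proof -
    have "(\<lambda>k. ln (cmod (poly (q k) z)) / n k - A k) \<longlonglongrightarrow> potential \<omega> z - c - (- c)"
      by (intro tendsto_diff reg[OF z] Alim)
    moreover have "\<forall>\<^sub>F k in sequentially. ln (cmod (poly (q k) z)) / n k - A k = potential (\<mu> k) z"
      using good by eventually_elim (use lnq z in auto)
    ultimately show ?thesis by (simp add: tendsto_cong)
  qed

  \<comment> \<open>Energies and location of the preimages\<close>
  define R3 where "R3 = R + exp (c + 2)"
  have R3: "R3 > 0" "R \<le> R3" using R by (auto simp: R3_def add_pos_pos)
  define E where "E k = ln r / n k - A k" for k
  have Elim: "E \<longlonglongrightarrow> c"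
  proof -
    have "(\<lambda>k. ln r * inverse (n k) - A k) \<longlonglongrightarrow> ln r * 0 - (- c)"
      by (intro tendsto_intros Alim tendsto_inverse_0_at_top nlim)
    then show ?thesis by (simp add: E_def[abs_def] divide_inverse)
  qed
  have \<Omega>W: "\<Omega> k \<in> borel_probs_on (W k) \<and> ereal (E k) \<le> log_energy (\<Omega> k)" if k: "degree (q k) > 0" for k
  proof -
    obtain \<nu> where \<nu>: "\<nu> \<in> borel_probs_on (W k)" "ereal (ln (r / cmod (lead_coeff (q k))) / degree (q k)) \<le> log_energy \<nu>"
      using lemniscate_energy[OF k r] unfolding W_def by blast
    have "q k \<noteq> 0" using k by auto
    then have "ln (r / cmod (lead_coeff (q k))) / degree (q k) = E k" using r
      by (simp add: E_def A_def n_def ln_div diff_divide_distrib)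
    then have E: "ereal (E k) \<le> log_energy \<nu>" using \<nu>(2) by simp
    then have fin: "log_energy \<nu> \<noteq> -\<infinity>" by auto
    note eq = equilibrium_measure_maximizes[OF lemniscate_compact[OF k, of r, folded W_def] \<nu>(1) fin, folded \<Omega>_def]
    show ?thesis using eq(1) order_trans[OF E eq(2)] by (simp add: maximizes_energy_def)
  qed
  have "\<forall>\<^sub>F k in sequentially. A k > - c - 1" using Alim by (rule order_tendstoD) simp
  moreover have "\<forall>\<^sub>F k in sequentially. n k > ln r" using nlim by (simp add: filterlim_at_top_dense)
  moreover have "\<forall>\<^sub>F k in sequentially. E k > c - 1" using Elim by (rule order_tendstoD) simp
  ultimately have "\<forall>\<^sub>F k in sequentially. k \<ge> N \<and> degree (q k) > 0 \<and> W k \<subseteq> cball 0 R3 \<and> E k \<ge> c - 1"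
    using good
  proof eventually_elim
    case (elim k)
    have "z \<in> cball 0 R3" if z: "z \<in> W k" for z
    proof (rule ccontr)
      assume "z \<notin> cball 0 R3"
      then have z3: "cmod z > R3" by simp
      then have zR: "cmod z > R" using R3 by simp
      \<comment> \<open>Beyond \<open>R3\<close> the potential is at least \<open>c + 2\<close>
        while \<open>A k > - c - 1\<close>, so \<open>ln (cmod (poly (q k) z))\<close> is at least
        \<open>n k\<close>, which exceeds \<open>ln r\<close>.\<close>
      have "c + 2 = ln (R3 - R)" by (simp add: R3_def)
      also have "\<dots> \<le> ln (cmod z - R)" using z3 by (intro ln_mono) (auto simp: R3_def)
      also have "\<dots> \<le> potential (\<mu> k) z"
        using potential_bounds[OF \<mu> compact_cball order_refl, of k z] elim zR by auto
      finally have "1 \<le> A k + potential (\<mu> k) z" using elim by simp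
      also have "\<dots> = ln (cmod (poly (q k) z)) / n k" using elim zR by (intro lnq[symmetric]) auto
      finally have "n k \<le> ln (cmod (poly (q k) z))" using elim by (simp add: n_def field_simps)
      then have l: "ln r < ln (cmod (poly (q k) z))" using elim by simp
      \<comment> \<open>Because of \<open>ln 0 = 0\<close>, zeros have to be excluded before the
        inequality of logarithms yields one of moduli.\<close>
      have "z \<notin> ball 0 R2" using zR by (simp add: R_def)
      then have "poly (q k) z \<noteq> 0" using zeros[of k] elim by auto
      then have "r < cmod (poly (q k) z)" using l r by simp
      then show False using z by (simp add: W_def)
    qed
    then show ?case using elim by auto
  qed
  then obtain N2 where N2: "\<And>k. k \<ge> N2 \<Longrightarrow> k \<ge> N \<and> degree (q k) > 0 \<and> W k \<subseteq> cball 0 R3 \<and> E k \<ge> c - 1"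
    by (auto simp: eventually_sequentially)
  have \<Omega>R: "\<Omega> k \<in> borel_probs_on (cball 0 R3)" if "k \<ge> N2" for k
    using borel_probs_on_mono[of "\<Omega> k" "W k" "cball 0 R3"] \<Omega>W[of k] N2[OF that] lemniscate_compact[of "q k" r]
    by (auto simp: W_def compact_imp_closed)

  \<comment> \<open>Cluster points of the equilibrium measures\<close>
  have sub: "\<exists>t. strict_mono (t :: nat \<Rightarrow> nat) \<and> bounded_weak_conv (\<Omega> \<circ> (s \<circ> t)) \<omega>" 
    if s: "strict_mono (s :: nat \<Rightarrow> nat)" "\<And>j. s j \<ge> N2" for s
  proof -
    have \<Omega>s: "(\<Omega> \<circ> s) j \<in> borel_probs_on (cball 0 R3)" for j using \<Omega>R s(2) by simp
    have ne3: "cball (0::complex) R3 \<noteq> {}" "cball (0::complex) R \<noteq> {}" using R3 R by auto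
    obtain t1 \<nu> where t1: "strict_mono t1" and \<nu>: "\<nu> \<in> borel_probs_on (cball 0 R3)" and c1: "bounded_weak_conv ((\<Omega> \<circ> s) \<circ> t1) \<nu>"
      by (rule weak_compactness[OF compact_cball ne3(1) \<Omega>s])
    have \<mu>s: "(\<mu> \<circ> (s \<circ> t1)) j \<in> borel_probs_on (cball 0 R)" for j using \<mu> N2 s(2) by simp
    obtain t2 \<mu>' where t2: "strict_mono t2" and \<mu>': "\<mu>' \<in> borel_probs_on (cball 0 R)" and c2: "bounded_weak_conv ((\<mu> \<circ> (s \<circ> t1)) \<circ> t2) \<mu>'"
      by (rule weak_compactness[OF compact_cball ne3(2) \<mu>s])
    define u where "u = s \<circ> (t1 \<circ> t2)"
    have u: "strict_mono u" unfolding u_def using s t1 t2 by (intro strict_mono_o)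
    have uN: "u j \<ge> N2" for j using s(2) by (simp add: u_def)
    have cO: "bounded_weak_conv (\<Omega> \<circ> u) \<nu>" using bounded_weak_conv_subseq[OF c1 t2] by (simp add: u_def o_assoc)
    have cM: "bounded_weak_conv (\<mu> \<circ> u) \<mu>'" using c2 by (simp add: u_def o_assoc)
    have uk: "u j \<ge> N" "degree (q (u j)) > 0" for j using N2[OF uN[of j]] by auto
    have Mu: "(\<mu> \<circ> u) j \<in> borel_probs_on (cball 0 R)" for j using \<mu> uk by simp
    have Ou: "(\<Omega> \<circ> u) j \<in> borel_probs_on (cball 0 R3)" for j using \<Omega>R uN by simp
    have nu: "filterlim (\<lambda>j. n (u j)) at_top sequentially"
      using filterlim_compose[OF nlim filterlim_subseq[OF u]] .

    \<comment> \<open>Zero measures lose their mass off \<open>K\<close>\<close>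
    have \<mu>K: "\<mu>' \<in> borel_probs_on K"
    proof (rule weak_limit_support[OF compact_cball \<mu>' cM Kc])
      fix z0 assume z0: "z0 \<notin> K"
      obtain \<rho> where \<rho>: "\<rho> > 0" "cball z0 \<rho> \<subseteq> - K" using z0 Kc by (metis Compl_iff open_Compl open_contains_cball)
      obtain M where M: "\<And>k. k \<ge> N \<Longrightarrow> size {# z \<in># proots (q k). z \<in> cball z0 \<rho> #} \<le> M"
        using few[of "cball z0 \<rho>"] \<rho>(2) by auto
      define h where "h w = max 0 (\<rho> - dist z0 w)" for w
      have hc: "continuous_on UNIV h" unfolding h_def by (intro continuous_intros)
      have "(\<lambda>j. \<integral>w. h w \<partial>(\<mu> \<circ> u) j) \<longlonglongrightarrow> 0"
      proof (rule tendsto_sandwich[OF _ _ tendsto_const])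
        show "\<forall>\<^sub>F j in sequentially. 0 \<le> (\<integral>w. h w \<partial>(\<mu> \<circ> u) j)"
          by (intro always_eventually allI integral_nonneg_AE AE_I2) (simp add: h_def)
        have "(\<integral>w. h w \<partial>\<mu> (u j)) \<le> M * \<rho> * inverse (n (u j))" for j
        proof -
          \<comment> \<open>At most \<open>M\<close> zeros meet the tent function, each with weight
            \<open>1 / n (u j)\<close> and height at most \<open>\<rho>\<close>.\<close>
          define near far where "near = {# z \<in># proots (q (u j)). z \<in> cball z0 \<rho> #}"
            and "far = {# z \<in># proots (q (u j)). z \<notin> cball z0 \<rho> #}"
          have "(\<Sum>x\<in>#proots (q (u j)). h x) = (\<Sum>x\<in>#near + far. h x)"
            unfolding near_def far_def by (rule arg_cong[OF multiset_partition])
          also have "\<dots> = (\<Sum>x\<in>#near. h x) + (\<Sum>x\<in>#far. h x)"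
            by (simp only: image_mset_union sum_mset.union)
          also have "(\<Sum>x\<in>#far. h x) = 0"
            by (intro sum_mset.neutral) (auto simp: h_def far_def)
          also have "(\<Sum>x\<in>#near. h x) \<le> (\<Sum>x\<in>#near. \<rho>)"
            by (intro sum_mset_mono) (use \<rho> in \<open>auto simp: h_def near_def\<close>)
          also have "\<dots> \<le> M * \<rho>" using M[OF uk(1)[of j]] \<rho> by (simp add: near_def mult_right_mono)
          finally have "(\<Sum>x\<in>#proots (q (u j)). h x) / n (u j) \<le> M * \<rho> / n (u j)"
            by (intro divide_right_mono) (auto simp: n_def)
          then show ?thesis using \<mu>int[OF uk hc, of j] by (simp add: n_def divide_inverse)
        qed
        then show "\<forall>\<^sub>F j in sequentially. (\<integral>w. h w \<partial>(\<mu> \<circ> u) j) \<le> M * \<rho> * inverse (n (u j))" by (intro always_eventually) simp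
        have "(\<lambda>j. M * \<rho> * inverse (n (u j))) \<longlonglongrightarrow> M * \<rho> * 0" by (intro tendsto_intros tendsto_inverse_0_at_top nu)
        then show "(\<lambda>j. M * \<rho> * inverse (n (u j))) \<longlonglongrightarrow> 0" by simp
      qed
      then show "\<exists>\<rho>>0. (\<lambda>j. \<integral>w. max 0 (\<rho> - dist z0 w) \<partial>(\<mu> \<circ> u) j) \<longlonglongrightarrow> 0" using \<rho>(1) unfolding h_def by blast
    qed

    \<comment> \<open>Equality of potentials off \<open>K\<close>\<close>
    have peq: "potential \<mu>' z = potential \<omega> z" if z: "z \<notin> K" for z
    proof (rule potential_unique_continuation[OF K conn \<mu>K \<omega> _ z])
      fix z assume z: "cmod z > R"
      define d where "d = cmod z - R"
      have d: "d > 0" using z by (simp add: d_def)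
      have lo: "d \<le> cmod (z - w)" if "w \<in> cball 0 R" for w
        using norm_triangle_ineq2[of z w] that by (simp add: d_def)
      have tr: "potential \<theta> z = (\<integral>w. ln (max d (cmod (z - w))) \<partial>\<theta>)" if "\<theta> \<in> borel_probs_on (cball 0 R)" for \<theta>
        by (rule potential_eq_trunc[OF that closed_cball lo])
      have "(\<lambda>j. potential ((\<mu> \<circ> u) j) z) \<longlonglongrightarrow> potential \<mu>' z"
        unfolding tr[OF Mu] tr[OF \<mu>']
        using cM continuous_on_section[OF continuous_trunc_log[OF d], of z] unfolding bounded_weak_conv_def by blast
      moreover have "(\<lambda>j. potential ((\<mu> \<circ> u) j) z) \<longlonglongrightarrow> potential \<omega> z"
        using LIMSEQ_subseq_LIMSEQ[OF potlim[OF z] u] by (simp add: o_def)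
      ultimately show "potential \<mu>' z = potential \<omega> z" by (rule LIMSEQ_unique)
    qed

    \<comment> \<open>Equilibrium measures lose their mass off \<open>K\<close>\<close>
    have \<nu>K: "\<nu> \<in> borel_probs_on K"
    proof (rule weak_limit_support[OF compact_cball \<nu> cO Kc])
      fix z0 assume z0: "z0 \<notin> K"
      obtain \<rho>' where \<rho>': "\<rho>' > 0" "cball z0 \<rho>' \<subseteq> - K" using z0 Kc by (metis Compl_iff open_Compl open_contains_cball)
      \<comment> \<open>Halving leaves room: zeros outside the disc of radius
        \<open>2 * \<rho>\<close> keep distance at least \<open>\<rho>\<close> from every point of
        \<open>S\<close>.\<close>
      define \<rho> where "\<rho> = \<rho>' / 2"
      have \<rho>: "\<rho> > 0" "cball z0 (2 * \<rho>) \<subseteq> - K" using \<rho>' by (auto simp: \<rho>_def)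
      define S where "S = cball z0 \<rho>"
      have SK: "z \<notin> K" if "z \<in> S" for z using that \<rho> by (force simp: S_def)
      obtain M where M0: "M > 0" and M: "\<And>k. k \<ge> N \<Longrightarrow> size {# z \<in># proots (q k). z \<in> cball z0 (2 * \<rho>) #} \<le> M"
        using few[of "cball z0 (2 * \<rho>)"] \<rho>(2) by auto
      have pc: "continuous_on S (potential \<omega>)"
        using potential_has_derivative[OF \<omega> K] SK
        by (intro continuous_at_imp_continuous_on ballI) (blast intro: has_derivative_continuous)
      obtain z1 where z1: "z1 \<in> S" "\<And>z. z \<in> S \<Longrightarrow> potential \<omega> z1 \<le> potential \<omega> z"
        using continuous_attains_inf[OF _ _ pc] \<rho> unfolding S_def by (metis cball_eq_empty compact_cball not_less_iff_gr_or_eq)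
      \<comment> \<open>The gap is spent in four equal parts: uniform approximation of the
        potential, the leading coefficient, the near zeros, and a remainder that beats
        \<open>r\<close> and the bounded factors.\<close>
      define \<delta> where "\<delta> = (potential \<omega> z1 - c) / 4"
      have \<delta>: "\<delta> > 0" unfolding \<delta>_def using gt[OF SK[OF z1(1)]] by simp
      have p4: "c + 4 * \<delta> \<le> potential \<omega> z" if "z \<in> S" for z using z1(2)[OF that] unfolding \<delta>_def by (simp add: field_simps)
      note k = continuous_trunc_log[OF \<rho>(1)]
      have pm: "(\<integral>w. ln (max \<rho> (cmod (z - w))) \<partial>\<mu>') = potential \<omega> z" if z: "z \<in> S" for z
      proof -
        have "\<rho> \<le> cmod (z - w)" if w: "w \<in> K" for w
        proof -
          have "w \<notin> cball z0 (2 * \<rho>)" using \<rho>(2) w by auto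
          then have "dist z0 w > 2 * \<rho>" by simp
          moreover have "dist z0 w \<le> dist z0 z + dist z w" by (rule dist_triangle)
          moreover have "dist z0 z \<le> \<rho>" using z by (simp add: S_def)
          ultimately show ?thesis by (simp add: dist_norm)
        qed
        from potential_eq_trunc[OF \<mu>K Kc this] show ?thesis using peq[OF SK[OF z]] by simp
      qed
      have "compact S" by (simp add: S_def)
      then have "\<forall>\<^sub>F j in sequentially. \<forall>z\<in>S. dist (\<integral>w. ln (max \<rho> (cmod (z - w))) \<partial>(\<mu> \<circ> u) j) (\<integral>w. ln (max \<rho> (cmod (z - w))) \<partial>\<mu>') < \<delta>"
        using uniform_limit_integral_kernel[OF k compact_cball _ Mu \<mu>' cM] \<delta> unfolding uniform_limit_iff by blast
      moreover have "\<forall>\<^sub>F j in sequentially. A (u j) > - c - \<delta>"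
        using LIMSEQ_subseq_LIMSEQ[OF Alim u] \<delta> by (intro order_tendstoD(1)[of _ "- c"]) (auto simp: o_def)
      moreover have "\<forall>\<^sub>F j in sequentially. r * exp (M * \<bar>ln (3 * \<rho>)\<bar>) < exp (n (u j) * \<delta>)"
      proof -
        have "\<forall>\<^sub>F j in sequentially. n (u j) > ln (r * exp (M * \<bar>ln (3 * \<rho>)\<bar>)) / \<delta>" using nu by (simp add: filterlim_at_top_dense)
        then show ?thesis
        proof eventually_elim
          case (elim j)
          then have "ln (r * exp (M * \<bar>ln (3 * \<rho>)\<bar>)) < n (u j) * \<delta>" using \<delta> by (simp add: field_simps)
          then have "exp (ln (r * exp (M * \<bar>ln (3 * \<rho>)\<bar>))) < exp (n (u j) * \<delta>)" by simp
          then show ?case using r by simp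
        qed
      qed
      ultimately have small: "\<forall>\<^sub>F j in sequentially. \<forall>z\<in>S \<inter> W (u j). \<exists>x \<in># {#x \<in># proots (q (u j)). x \<in> cball z0 (2 * \<rho>)#}.
          cmod (z - x) \<le> exp (- (n (u j) * \<delta> / M))"
      proof eventually_elim
        case (elim j)
        show ?case
        proof
          fix z assume z: "z \<in> S \<inter> W (u j)"
          have np: "n (u j) > 0" using uk by (simp add: n_def)
          have "c + 3 * \<delta> \<le> (\<integral>w. ln (max \<rho> (cmod (z - w))) \<partial>\<mu> (u j))"
            using elim(1)[THEN bspec, of z] z p4[of z] unfolding dist_real_def by (auto simp: pm)
          also have "\<dots> = (\<Sum>x\<in>#proots (q (u j)). ln (max \<rho> (cmod (z - x)))) / n (u j)"
            unfolding n_def by (rule \<mu>int[OF uk continuous_on_section[OF k]])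
          finally have pot: "n (u j) * (c + 3 * \<delta>) \<le> (\<Sum>x\<in>#proots (q (u j)). ln (max \<rho> (cmod (z - x))))"
            using np by (simp add: field_simps)
          have a: "- (n (u j) * (c + \<delta>)) \<le> ln (cmod (lead_coeff (q (u j))))"
          proof -
            have "- (c + \<delta>) \<le> ln (cmod (lead_coeff (q (u j)))) / n (u j)" using elim(2) by (simp add: A_def)
            then have "n (u j) * - (c + \<delta>) \<le> n (u j) * (ln (cmod (lead_coeff (q (u j)))) / n (u j))"
              using np by (intro mult_left_mono) auto
            then show ?thesis using np by (simp add: algebra_simps)
          qed
          show "\<exists>x \<in># {#x \<in># proots (q (u j)). x \<in> cball z0 (2 * \<rho>)#}. cmod (z - x) \<le> exp (- (n (u j) * \<delta> / M))"
            using near_zero_of_small_value[OF uk(2) \<rho>(1) M0 M[OF uk(1)] _ _ pot[unfolded n_def] a[unfolded n_def] elim(3)[unfolded n_def] \<delta>] z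
            by (simp add: S_def W_def n_def)
        qed
      qed
      \<comment> \<open>The constants of \<open>measure_cball_bound\<close> for the radius
        \<open>R3\<close>. Energies of the \<open>\<Omega> k\<close> are at least
        \<open>c - 1\<close>, hence the numerator \<open>B - c + 1\<close> in \<open>g\<close>, and
        \<open>ln \<tau>\<close> equals minus the last term of its denominator.\<close>
      define B where "B = ln (4 * R3\<^sup>2 + (1 + R3\<^sup>2)\<^sup>2) / 2"
      define b where "b = ln (4 + (1 + R3\<^sup>2)\<^sup>2) / 2"
      define g where "g j = sqrt ((B - c + 1) / (B - b + n (u j) * \<delta> / M))" for j
      have glim: "g \<longlonglongrightarrow> 0"
      proof -
        have "filterlim (\<lambda>j. B - b + n (u j) * (\<delta> / M)) at_top sequentially"
          using \<delta> M0 by (intro filterlim_tendsto_add_at_top[OF tendsto_const] filterlim_at_top_mult_tendsto_pos[OF tendsto_const _ nu]) auto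
        then have "(\<lambda>j. (B - c + 1) / (B - b + n (u j) * \<delta> / M)) \<longlonglongrightarrow> 0"
          by (intro tendsto_divide_0[OF tendsto_const] filterlim_at_top_imp_at_infinity) simp
        from tendsto_real_sqrt[OF this] show ?thesis by (simp add: g_def[abs_def])
      qed
      have "\<forall>\<^sub>F j in sequentially. n (u j) > \<bar>B - b\<bar> * M / \<delta>" using nu by (simp add: filterlim_at_top_dense)
      with small have mS: "\<forall>\<^sub>F j in sequentially. measure (\<Omega> (u j)) S \<le> M * g j"
      proof eventually_elim
        case (elim j)
        define \<tau> where "\<tau> = exp (- (n (u j) * \<delta> / M))"
        \<comment> \<open>Keeps the denominator in \<open>g\<close> positive.\<close>
        have nd: "n (u j) * \<delta> / M > \<bar>B - b\<bar>" using elim(2) \<delta> M0 by (simp add: field_simps)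
        have \<tau>: "0 < \<tau>" "\<tau> \<le> 1" "ln \<tau> = - (n (u j) * \<delta> / M)" unfolding \<tau>_def using \<delta> by (auto simp: n_def)
        define Z where "Z = {#x \<in># proots (q (u j)). x \<in> cball z0 (2 * \<rho>)#}"
        have OW: "\<Omega> (u j) \<in> borel_probs_on (W (u j))" "ereal (E (u j)) \<le> log_energy (\<Omega> (u j))" using \<Omega>W[OF uk(2)] by auto
        have OR: "\<Omega> (u j) \<in> borel_probs_on (cball 0 R3)" using \<Omega>R uN by simp
        have "ereal (c - 1) \<le> ereal (E (u j))" using N2[OF uN[of j]] by simp
        from order_trans[OF this OW(2)] have en: "ereal (c - 1) \<le> log_energy (\<Omega> (u j))" .
        have ball: "measure (\<Omega> (u j)) (cball x \<tau>) \<le> g j" for x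
        proof -
          have "(measure (\<Omega> (u j)) (cball x \<tau>))\<^sup>2 * (B - b + n (u j) * \<delta> / M) \<le> B - c + 1"
            using measure_cball_bound[OF compact_cball OR R3(1) order_refl en \<tau>(1,2), of x] \<tau>(3)
            by (simp add: B_def b_def algebra_simps)
          then have "(measure (\<Omega> (u j)) (cball x \<tau>))\<^sup>2 \<le> (B - c + 1) / (B - b + n (u j) * \<delta> / M)"
            using nd by (subst pos_le_divide_eq) linarith+
          then show ?thesis unfolding g_def by (rule real_le_rsqrt)
        qed
        have Wc: "closed (W (u j))" using lemniscate_compact[OF uk(2)[of j], of r] compact_imp_closed by (auto simp: W_def)
        note d = borel_probs_onD[OF OW(1) Wc]
        interpret prob_space "\<Omega> (u j)" by (rule d)
        \<comment> \<open>Up to a null set, \<open>S\<close> meets \<open>\<Omega> (u j)\<close>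
          only in the preimage, which the tiny discs around the near zeros cover there.\<close>
        have "prob S \<le> prob (\<Union>x\<in>set_mset Z. cball x \<tau>)"
        proof (rule finite_measure_mono_AE)
          show "AE z in \<Omega> (u j). z \<in> S \<longrightarrow> z \<in> (\<Union>x\<in>set_mset Z. cball x \<tau>)"
            using d(4)
          proof eventually_elim
            case W: (elim z)
            show ?case
            proof
              assume "z \<in> S"
              then obtain x where "x \<in># Z" "cmod (z - x) \<le> \<tau>" using elim(1) W unfolding Z_def \<tau>_def by blast
              then show "z \<in> (\<Union>x\<in>set_mset Z. cball x \<tau>)" by (auto simp: dist_norm norm_minus_commute)
            qed
          qed
          have "(\<Union>x\<in>set_mset Z. cball x \<tau>) \<in> sets borel" by (intro sets.finite_UN) auto
          then show "(\<Union>x\<in>set_mset Z. cball x \<tau>) \<in> events" by (simp add: d(1))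
        qed
        also have "\<dots> \<le> (\<Sum>x\<in>set_mset Z. prob (cball x \<tau>))"
          by (intro finite_measure_subadditive_finite) (auto simp: d(1))
        also have "\<dots> \<le> (\<Sum>x\<in>set_mset Z. g j)" by (intro sum_mono ball)
        also have "\<dots> = card (set_mset Z) * g j" by simp
        also have "\<dots> \<le> M * g j"
        proof (rule mult_right_mono)
          have "card (set_mset Z) \<le> size Z" 
            unfolding size_multiset_overloaded_eq card_eq_sum by (intro sum_mono) (simp add: Suc_le_eq)
          also have "\<dots> \<le> M" unfolding Z_def by (rule M[OF uk(1)])
          finally show "real (card (set_mset Z)) \<le> real M" by simp
          show "0 \<le> g j" using ball[of 0] measure_nonneg order_trans by blast
        qed
        finally show ?case .
      qed
      have "(\<lambda>j. \<integral>w. max 0 (\<rho> - dist z0 w) \<partial>(\<Omega> \<circ> u) j) \<longlonglongrightarrow> 0"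
      proof (rule tendsto_sandwich[OF _ _ tendsto_const])
        show "\<forall>\<^sub>F j in sequentially. 0 \<le> (\<integral>w. max 0 (\<rho> - dist z0 w) \<partial>(\<Omega> \<circ> u) j)"
          by (intro always_eventually allI integral_nonneg_AE AE_I2) simp
        show "\<forall>\<^sub>F j in sequentially. (\<integral>w. max 0 (\<rho> - dist z0 w) \<partial>(\<Omega> \<circ> u) j) \<le> \<rho> * (M * g j)"
          using mS
        proof eventually_elim
          case (elim j)
          note d = borel_probs_onD[OF Ou[of j] closed_cball]
          interpret prob_space "(\<Omega> \<circ> u) j" by (rule d)
          have Sm: "S \<in> events" by (simp only: d(1)) (simp add: S_def)
          have "(\<integral>w. max 0 (\<rho> - dist z0 w) \<partial>(\<Omega> \<circ> u) j) \<le> (\<integral>w. \<rho> * indicator S w \<partial>(\<Omega> \<circ> u) j)"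
          proof (rule integral_mono)
            show "integrable ((\<Omega> \<circ> u) j) (\<lambda>w. max 0 (\<rho> - dist z0 w))"
              by (rule borel_probs_on_integrable[OF Ou compact_cball]) (intro continuous_intros)
            show "integrable ((\<Omega> \<circ> u) j) (\<lambda>w. \<rho> * indicator S w)"
              using Sm emeasure_finite[of S]
              by (intro Bochner_Integration.integrable_mult_right impI integrable_real_indicator) (simp_all add: top.not_eq_extremum)
          qed (use \<rho> in \<open>auto simp: S_def indicator_def\<close>)
          also have "\<dots> = \<rho> * prob S" using Sm by simp
          also have "\<dots> \<le> \<rho> * (M * g j)" using elim \<rho> by simp
          finally show ?case .
        qed
        have "(\<lambda>j. \<rho> * (M * g j)) \<longlonglongrightarrow> \<rho> * (real M * 0)" by (intro tendsto_intros glim)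
        then show "(\<lambda>j. \<rho> * (M * g j)) \<longlonglongrightarrow> 0" by simp
      qed
      then show "\<exists>\<rho>>0. (\<lambda>j. \<integral>w. max 0 (\<rho> - dist z0 w) \<partial>(\<Omega> \<circ> u) j) \<longlonglongrightarrow> 0" using \<rho>(1) by blast
    qed

    \<comment> \<open>Identification of the cluster point\<close>
    have "\<forall>\<^sub>F j in sequentially. ereal ((E \<circ> u) j) \<le> log_energy ((\<Omega> \<circ> u) j)"
      using \<Omega>W uk by (intro always_eventually) simp
    with log_energy_usc'[OF compact_cball Ou \<nu> cO LIMSEQ_subseq_LIMSEQ[OF Elim u]]
    have E\<nu>: "ereal c \<le> log_energy \<nu>" .
    have "maximizes_energy K \<nu>" unfolding maximizes_energy_def
    proof (intro conjI ballI \<nu>K)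
      fix \<theta> assume "\<theta> \<in> borel_probs_on K"
      then have "log_energy \<theta> \<le> ereal c" using max c by (simp add: maximizes_energy_def)
      then show "log_energy \<theta> \<le> log_energy \<nu>" using E\<nu> by (rule order_trans)
    qed
    then have "\<nu> = \<omega>" unfolding \<omega>_def using E\<nu> by (intro equilibrium_measure_eqI[OF K]) auto
    then have "bounded_weak_conv (\<Omega> \<circ> (s \<circ> (t1 \<circ> t2))) \<omega>" using cO by (simp add: u_def)
    moreover have "strict_mono (t1 \<circ> t2)" using t1 t2 by (rule strict_mono_o)
    ultimately show ?thesis by blast
  qed

  \<comment> \<open>From subsequences to the whole sequence\<close>
  have "(\<lambda>k. \<integral>z. f z \<partial>\<Omega> k) \<longlonglongrightarrow> (\<integral>z. f z \<partial>\<omega>)" if f: "continuous_on UNIV f" for f :: "complex \<Rightarrow> real"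
  proof (rule tendstoI, rule ccontr)
    fix e :: real assume e: "e > 0" and "\<not> (\<forall>\<^sub>F k in sequentially. dist (\<integral>z. f z \<partial>\<Omega> k) (\<integral>z. f z \<partial>\<omega>) < e)"
    then obtain s0 where s0: "strict_mono (s0 :: nat \<Rightarrow> nat)" "\<And>j. \<not> dist (\<integral>z. f z \<partial>\<Omega> (s0 j)) (\<integral>z. f z \<partial>\<omega>) < e"
      using not_eventually_sequentiallyD by blast
    \<comment> \<open>The shift puts all indices beyond \<open>N2\<close>, where the measures live
      on a common disc.\<close>
    define s where "s j = s0 (j + N2)" for j
    have s: "strict_mono s" "\<And>j. s j \<ge> N2"
    proof -
      show "strict_mono s" using s0(1) by (simp add: s_def strict_mono_def)
      show "s j \<ge> N2" for j using seq_suble[OF s0(1), of "j + N2"] by (simp add: s_def)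
    qed
    obtain t where t: "strict_mono (t :: nat \<Rightarrow> nat)" "bounded_weak_conv (\<Omega> \<circ> (s \<circ> t)) \<omega>" using sub[OF s] by blast
    then have "(\<lambda>j. \<integral>z. f z \<partial>\<Omega> (s (t j))) \<longlonglongrightarrow> (\<integral>z. f z \<partial>\<omega>)" using f by (simp add: bounded_weak_conv_def)
    then have "\<forall>\<^sub>F j in sequentially. dist (\<integral>z. f z \<partial>\<Omega> (s (t j))) (\<integral>z. f z \<partial>\<omega>) < e" using e by (rule tendstoD)
    then show False using s0(2) by (auto simp: s_def dest!: eventually_happens)
  qed
  then show ?thesis unfolding weak_star_converges_def \<Omega>_def W_def \<omega>_def by blast
qed

end
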